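(* Suppose that: (1) for all $t=0,\dots,T-1$, $\boldsymbol\Gamma_t$ is a closed convex valued set-valued mapping; (2) for all $t=0,\dots,T-1$, $f_t$ and $L_t$ are continuously differentiable with respect to their first two arguments (state and control); $K$ is continuously differentiable; $L_t$ and $f_t$ are normal integrands; the derivatives of $f_t$, $L_t$ and $K$ are square integrable (in the sense given in the context); (3) (Markovian case) $\mathcal G_t=\mathcal F_t$ for all $t=0,\dots,T$; the random variables $\mathbf w_0,\dots,\mathbf w_T$ are independent; and for all $t=0,\dots,T-1$ there is a set $\Gamma_t\subset\mathbb U_t$ with $\boldsymbol\Gamma_t(\omega)=\Gamma_t$ $\mathbb P$-a.s. Assume that there exist two random processes $(\mathbf u_t)_{t=0,\dots,T-1}\in\mathcal U$ and $(\mathbf x_t)_{t=0,\dots,T}\in\mathcal X$ solution of the problem $$\min_{(\mathbf u,\mathbf x)\in\mathcal U\times\mathcal X}\ \mathbb E\Big(\sum_{t=0}^{T-1}L_t(\mathbf x_t,\mathbf u_t,\mathbf w_{t+1})+K(\mathbf x_T)\Big)$$ subject to $\mathbf x_0=\mathbf w_0$, $\mathbf x_{t+1}=f_t(\mathbf x_t,\mathbf u_t,\mathbf w_{t+1})$ $\mathbb P$-a.s. and $\mathbf u_t\in\mathcal U^{\rm as}_t\cap\mathcal U^{\rm me}_t$ for all $t=0,\dots,T-1$. Then there exists a process $(\boldsymbol\Lambda_t)_{t=0,\dots,T}\in\mathcal X$ satisfying, for all $t=0,\dots,T-1$, \begin{align*} &\mathbf x_0=\mathbf w_0,\qquad \mathbf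 x_{t+1}=f_t(\mathbf x_t,\mathbf u_t,\mathbf w_{t+1}),\\ &\boldsymbol\Lambda_T=K'^\top(\mathbf x_T),\qquad \boldsymbol\Lambda_t=\mathbb E\big((L_t)'^\top_x(\mathbf x_t,\mathbf u_t,\mathbf w_{t+1})+(f_t)'^\top_x(\mathbf x_t,\mathbf u_t,\mathbf w_{t+1})\boldsymbol\Lambda_{t+1}\,\big|\,\mathcal F_t\big),\\ &\mathbb E\big((L_t)'_u(\mathbf x_t,\mathbf u_t,\mathbf w_{t+1})+\boldsymbol\Lambda_{t+1}^\top(f_t)'_u(\mathbf x_t,\mathbf u_t,\mathbf w_{t+1})\,\big|\,\mathcal G_t\big)\in-\partial\chi_{\mathcal U^{\rm as}_t}(\mathbf u_t), \end{align*} and such that, for all $t=0,\dots,T-1$, (a) $\boldsymbol\Lambda_{t+1}\preceq\mathbf x_{t+1}$; (b) $\mathbf u_t\preceq\mathbf x_t$; (c) $\mathbb P$-a.s., $$\mathbb E\big((L_t)'_u(\mathbf x_t,\mathbf u_t,\mathbf w_{t+1})+\boldsymbol\Lambda_{t+1}^\top(f_t)'_u(\mathbf x_t,\mathbf u_t,\mathbf w_{t+1})\,\big|\,\mathcal F_t\big)=\mathbb E\big((L_t)'_u(\mathbf x_t,\mathbf u_t,\mathbf w_{t+1})+\boldsymbol\Lambda_{t+1}^\top(f_t)'_u(\mathbf x_t,\mathbf u_t,\mathbf w_{t+1})\,\big|\,\mathbf x_t\big).$$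
   Context: $(\Omega,\mathcal A,\mathbb P)$ is a probability space and $T\ge 1$ an integer. $\mathbb W_t=\mathbb R^{d_{w_t}}$, $\mathbb X_t=\mathbb R^{d_{x_t}}$, $\mathbb Y_t=\mathbb R^{d_{y_t}}$ ($t=0,\dots,T$) and $\mathbb U_t=\mathbb R^{d_{u_t}}$ ($t=0,\dots,T-1$) are the noise, state, observation and control spaces. $\mathcal X_t$ is the set of $\mathbb X_t$-valued random variables on $(\Omega,\mathcal A,\mathbb P)$ and $\mathcal X=\mathcal X_0\times\dots\times\mathcal X_T$; $\mathcal U_t=L^2(\Omega,\mathcal A,\mathbb P;\mathbb U_t)$ and $\mathcal U=\mathcal U_0\times\dots\times\mathcal U_{T-1}$. The noise process is $\mathbf w=(\mathbf w_0,\dots,\mathbf w_T)$ with $\mathbf w_t$ a $\mathbb W_t$-valued random variable (and $\mathbb W_0=\mathbb X_0$). Dynamics: $f_t:\mathbb X_t\times\mathbb U_t\times\mathbb W_{t+1}\to\mathbb X_{t+1}$; costs: $L_t:\mathbb X_t\times\mathbb U_t\times\mathbb W_{t+1}\to\mathbb R$ and $K:\mathbb X_T\to\mathbb R$. Observations: $\mathbf y_t=\widetilde h_t(\mathbf w_0,\dots,\mathbf w_T)$ $\mathbb P$-a.s. with $\widetilde h_t:\mathbb W_0\times\dots\times\mathbb W_T\to\mathbb Y_t$ measurable; $\mathcal G_t=\sigma(\mathbf y_t)$; $\mathcal F_t=\sigma(\mathbf w_0,\dots,\mathbf w_t)$. $\boldsymbol\Gamma_t:\Omega\rightrightarrows\mathbb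 U_t$ are set-valued mappings, and $$\mathcal U^{\rm as}_t=\{\mathbf u_t\in\mathcal U_t:\mathbf u_t(\omega)\in\boldsymbol\Gamma_t(\omega)\ \mathbb P\text{-a.s.}\},\quad \mathcal U^{\rm me}_t=\{\mathbf u_t\in\mathcal U_t:\mathbf u_t\text{ is }\mathcal G_t\text{-measurable}\}.$$ For random variables, $\mathbf y_1\preceq\mathbf y_2$ means that $\mathbf y_1$ is measurable with respect to $\mathbf y_2$, i.e. $\sigma(\mathbf y_1)\subset\sigma(\mathbf y_2)$, equivalently $\mathbf y_1=\phi\circ\mathbf y_2$ for a measurable mapping $\phi$. Normal integrands are in the sense of Rockafellar–Wets, Definition 14.27 ((state, control) being the decision argument, the noise the measurable parameter; componentwise for $f_t$). Derivatives with respect to $x$ and $u$ are row vectors/Jacobian matrices, $\top$ denotes transpose; row vectors are identified with their transposes via the inner product. For a convex subset $C$ of a Hilbert space and $u\in C$, $\chi_C$ is the indicator function ($0$ on $C$, $+\infty$ elsewhere) and $\partial\chi_C(u)=\{r:\langle r,v-u\rangle\le0\ \forall v\in C\}$ (here in $\mathcal U_t$). Meaning of "the derivatives are square integrable": the assumption permits all integration and differentiation operations. Namely, writing $j(u,w)$ for the total cost $\sum_t L_t(x_t,u_t,w_{t+1})+K(x_T)$ as a function of $(u,w)$ after elimination of the state by the dynamics, $J(\mathbf u)=\mathbb E(j(\mathbf u,\mathbf w))$ is finite on $\mathcal U$, and for every $\mathbf u\in\mathcal U$, along the corresponding state trajectory, the derivatives in $x$ and $u$ of $f_t,L_t,K$,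 the co-states defined by $\boldsymbol\lambda_T=K'^\top(\mathbf x_T)$, $\boldsymbol\lambda_t=(L_t)'^\top_x+(f_t)'^\top_x\boldsymbol\lambda_{t+1}$, and the derivative $j'_u(\mathbf u,\mathbf w)$ are square integrable.
   Formalization: (b) can fail for a given solution (e.g. zero dynamics and costs), so the optimality system is proved for every solution, (a) and (c) for every solution satisfying (b), and, whenever a solution exists, there is shown to be a solution satisfying the system with (a), (b) and (c). *)

theory Defs
  imports "HOL-Probability.Probability"
begin

text \<open>
  The spaces of the problem have time-dependent dimensions, which Isabelle types cannot express.
  A space \<open>\<real>\<^sup>d\<close> is rendered as a \<open>d\<close>-dimensional linear subspace \<open>S\<close> of an arbitrary Euclidean
  space, with the inherited inner product, topology and Borel sets; every finite family of spaces
  \<open>\<real>\<^sup>d\<close> embeds isometrically in this way.  Functions on such spaces are total HOL functions whose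
  values outside the subspaces are irrelevant, and all derivatives are taken within the subspaces.
\<close>

section \<open>Derivatives on a linear subspace\<close>

text \<open>
  The transposed derivative of \<open>g\<close> at \<open>x\<close>, applied to \<open>y\<close>.  Within a subspace \<open>S\<close> the Frechet
  derivative is determined on \<open>S\<close> only; the vector \<open>d \<in> S\<close> below is nevertheless unique.
\<close>

definition adj_deriv ::
    "'a::euclidean_space set \<Rightarrow> ('a \<Rightarrow> 'b::real_inner) \<Rightarrow> 'a \<Rightarrow> 'b \<Rightarrow> 'a" where
  "adj_deriv S g x y =
     (THE d. d \<in> S \<and> (\<forall>h\<in>S. d \<bullet> h = y \<bullet> frechet_derivative g (at x within S) h))"

definition grad_on :: "'a::euclidean_space set \<Rightarrow> ('a \<Rightarrow> real) \<Rightarrow> 'a \<Rightarrow> 'a" where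
  "grad_on S g x = adj_deriv S g x 1"

definition C1_on :: "'a::real_normed_vector set \<Rightarrow> ('a \<Rightarrow> 'b::real_normed_vector) \<Rightarrow> bool" where
  "C1_on S g \<longleftrightarrow> (\<exists>g' :: 'a \<Rightarrow> 'a \<Rightarrow>\<^sub>L 'b.
     (\<forall>p\<in>S. (g has_derivative blinfun_apply (g' p)) (at p within S)) \<and> continuous_on S g')"


section \<open>Normal integrands (Rockafellar--Wets, Definition 14.27)\<close>

definition measurable_multifun :: "'t measure \<Rightarrow> ('t \<Rightarrow> 'b::topological_space set) \<Rightarrow> bool" where
  "measurable_multifun A S \<longleftrightarrow> (\<forall>O'. open O' \<longrightarrow> {t \<in> space A. S t \<inter> O' \<noteq> {}} \<in> sets A)"

definition epi_on :: "'b set \<Rightarrow> ('b \<Rightarrow> ereal) \<Rightarrow> ('b \<times> real) set" where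
  "epi_on D g = {(p, \<alpha>). p \<in> D \<and> g p \<le> ereal \<alpha>}"

text \<open>\<open>D\<close> is the space of the decision argument, \<open>A\<close> that of the measurable parameter.\<close>

definition normal_integrand ::
    "'t measure \<Rightarrow> 'b::euclidean_space set \<Rightarrow> ('t \<Rightarrow> 'b \<Rightarrow> ereal) \<Rightarrow> bool" where
  "normal_integrand A D g \<longleftrightarrow>
     (\<forall>t\<in>space A. closed (epi_on D (g t))) \<and> measurable_multifun A (\<lambda>t. epi_on D (g t))"


section \<open>Random variables\<close>

definition RV :: "'a measure \<Rightarrow> 'b::euclidean_space set \<Rightarrow> ('a \<Rightarrow> 'b) set" where
  "RV M S = {g \<in> borel_measurable M. \<forall>\<omega>\<in>space M. g \<omega> \<in> S}"

definition L2 :: "'a measure \<Rightarrow> 'b::euclidean_space set \<Rightarrow> ('a \<Rightarrow> 'b) set" where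
  "L2 M S = {g \<in> RV M S. integrable M (\<lambda>\<omega>. (norm (g \<omega>))\<^sup>2)}"

definition sigma_rv :: "'a measure \<Rightarrow> ('a \<Rightarrow> 'b::topological_space) \<Rightarrow> 'a measure" where
  "sigma_rv M g = vimage_algebra (space M) g borel"

definition noise_algebra ::
    "'a measure \<Rightarrow> (nat \<Rightarrow> 'a \<Rightarrow> 'b::topological_space) \<Rightarrow> nat \<Rightarrow> 'a measure" where
  "noise_algebra M w t =
     vimage_algebra (space M) (\<lambda>\<omega>. \<lambda>s\<in>{..t}. w s \<omega>) (PiM {..t} (\<lambda>_. borel))"

definition rv_preceq ::
    "'a measure \<Rightarrow> ('a \<Rightarrow> 'b::topological_space) \<Rightarrow> ('a \<Rightarrow> 'c::topological_space) \<Rightarrow> bool" where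
  "rv_preceq M g h \<longleftrightarrow> sets (sigma_rv M g) \<subseteq> sets (sigma_rv M h)"

definition cond_exp_vec ::
    "'a measure \<Rightarrow> 'a measure \<Rightarrow> ('a \<Rightarrow> 'b::euclidean_space) \<Rightarrow> 'a \<Rightarrow> 'b" where
  "cond_exp_vec M F g = (\<lambda>\<omega>. \<Sum>b\<in>Basis. real_cond_exp M F (\<lambda>\<omega>'. g \<omega>' \<bullet> b) \<omega> *\<^sub>R b)"

text \<open>\<open>\<partial>\<chi>\<^sub>C(u)\<close> in the Hilbert space \<open>L2 M S\<close>, for a convex set \<open>C\<close> and \<open>u \<in> C\<close>.\<close>

definition subdiff_indicator ::
    "'a measure \<Rightarrow> 'b::euclidean_space set \<Rightarrow> ('a \<Rightarrow> 'b) set \<Rightarrow> ('a \<Rightarrow> 'b) \<Rightarrow> ('a \<Rightarrow> 'b) set" where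
  "subdiff_indicator M S C u =
     {r \<in> L2 M S. \<forall>v\<in>C. (\<integral>\<omega>. r \<omega> \<bullet> (v \<omega> - u \<omega>) \<partial>M) \<le> 0}"


section \<open>Controls, states and admissibility\<close>

text \<open>Only \<open>u t\<close> for \<open>t < T\<close> and \<open>x t\<close> for \<open>t \<le> T\<close> are relevant.\<close>

definition controls ::
    "'a measure \<Rightarrow> nat \<Rightarrow> (nat \<Rightarrow> 'u::euclidean_space set) \<Rightarrow> (nat \<Rightarrow> 'a \<Rightarrow> 'u) set" where
  "controls M T U = {u. \<forall>t<T. u t \<in> L2 M (U t)}"

definition states ::
    "'a measure \<Rightarrow> nat \<Rightarrow> (nat \<Rightarrow> 'e::euclidean_space set) \<Rightarrow> (nat \<Rightarrow> 'a \<Rightarrow> 'e) set" where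
  "states M T X = {x. \<forall>t\<le>T. x t \<in> RV M (X t)}"

definition U_as ::
    "'a measure \<Rightarrow> 'u::euclidean_space set \<Rightarrow> ('a \<Rightarrow> 'u set) \<Rightarrow> ('a \<Rightarrow> 'u) set" where
  "U_as M S \<Gamma> = {u \<in> L2 M S. AE \<omega> in M. u \<omega> \<in> \<Gamma> \<omega>}"

definition U_me ::
    "'a measure \<Rightarrow> 'u::euclidean_space set \<Rightarrow> 'a measure \<Rightarrow> ('a \<Rightarrow> 'u) set" where
  "U_me M S G = {u \<in> L2 M S. u \<in> borel_measurable G}"


section \<open>Dynamics, costs and co-states\<close>

primrec traj ::
    "(nat \<Rightarrow> 'e \<Rightarrow> 'u \<Rightarrow> 'e \<Rightarrow> 'e) \<Rightarrow> (nat \<Rightarrow> 'u) \<Rightarrow> (nat \<Rightarrow> 'e) \<Rightarrow> nat \<Rightarrow> 'e" where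
  "traj f u w 0 = w 0"
| "traj f u w (Suc t) = f t (traj f u w t) (u t) (w (Suc t))"

definition total_cost ::
    "nat \<Rightarrow> (nat \<Rightarrow> 'e \<Rightarrow> 'u \<Rightarrow> 'e \<Rightarrow> 'e) \<Rightarrow> (nat \<Rightarrow> 'e \<Rightarrow> 'u \<Rightarrow> 'e \<Rightarrow> real) \<Rightarrow> ('e \<Rightarrow> real) \<Rightarrow>
     (nat \<Rightarrow> 'u) \<Rightarrow> (nat \<Rightarrow> 'e) \<Rightarrow> real" where
  "total_cost T f L K u w =
     (\<Sum>t<T. L t (traj f u w t) (u t) (w (Suc t))) + K (traj f u w T)"

definition dLx ::
    "(nat \<Rightarrow> 'e::euclidean_space set) \<Rightarrow> (nat \<Rightarrow> 'e \<Rightarrow> 'u \<Rightarrow> 'e \<Rightarrow> real) \<Rightarrow> nat \<Rightarrow> 'e \<Rightarrow> 'u \<Rightarrow> 'e \<Rightarrow> 'e" where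
  "dLx X L t x u w = grad_on (X t) (\<lambda>x'. L t x' u w) x"

definition dLu ::
    "(nat \<Rightarrow> 'u::euclidean_space set) \<Rightarrow> (nat \<Rightarrow> 'e \<Rightarrow> 'u \<Rightarrow> 'e \<Rightarrow> real) \<Rightarrow> nat \<Rightarrow> 'e \<Rightarrow> 'u \<Rightarrow> 'e \<Rightarrow> 'u" where
  "dLu U L t x u w = grad_on (U t) (\<lambda>u'. L t x u' w) u"

text \<open>\<open>dfx \<dots> p\<close> and \<open>dfu \<dots> p\<close> are the products of the transposed partial Jacobians of \<open>f t\<close> with \<open>p\<close>.\<close>

definition dfx ::
    "(nat \<Rightarrow> 'e::euclidean_space set) \<Rightarrow> (nat \<Rightarrow> 'e \<Rightarrow> 'u \<Rightarrow> 'e \<Rightarrow> 'e) \<Rightarrow> nat \<Rightarrow> 'e \<Rightarrow> 'u \<Rightarrow> 'e \<Rightarrow> 'e \<Rightarrow> 'e" where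
  "dfx X f t x u w p = adj_deriv (X t) (\<lambda>x'. f t x' u w) x p"

definition dfu ::
    "(nat \<Rightarrow> 'u::euclidean_space set) \<Rightarrow> (nat \<Rightarrow> 'e \<Rightarrow> 'u \<Rightarrow> 'e \<Rightarrow> 'e::euclidean_space) \<Rightarrow>
     nat \<Rightarrow> 'e \<Rightarrow> 'u \<Rightarrow> 'e \<Rightarrow> 'e \<Rightarrow> 'u" where
  "dfu U f t x u w p = adj_deriv (U t) (\<lambda>u'. f t x u' w) u p"

function costate ::
    "nat \<Rightarrow> (nat \<Rightarrow> 'e::euclidean_space set) \<Rightarrow> (nat \<Rightarrow> 'e \<Rightarrow> 'u \<Rightarrow> 'e \<Rightarrow> 'e) \<Rightarrow>
     (nat \<Rightarrow> 'e \<Rightarrow> 'u \<Rightarrow> 'e \<Rightarrow> real) \<Rightarrow> ('e \<Rightarrow> real) \<Rightarrow> (nat \<Rightarrow> 'u) \<Rightarrow> (nat \<Rightarrow> 'e) \<Rightarrow> nat \<Rightarrow> 'e" where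
  "costate T X f L K u w t =
     (if t < T
      then dLx X L t (traj f u w t) (u t) (w (Suc t)) +
           dfx X f t (traj f u w t) (u t) (w (Suc t)) (costate T X f L K u w (Suc t))
      else grad_on (X T) K (traj f u w T))"
  by pat_completeness auto
termination
  by (relation "Wellfounded.measure (\<lambda>(T, X, f, L, K, u, w, t). T - t)") auto

declare costate.simps [simp del]

text \<open>The component with index \<open>t\<close> of \<open>j'\<^sub>u(u, w)\<close>, a partial gradient in the control \<open>u t\<close>.\<close>

definition dju ::
    "nat \<Rightarrow> (nat \<Rightarrow> 'u::euclidean_space set) \<Rightarrow> (nat \<Rightarrow> 'e \<Rightarrow> 'u \<Rightarrow> 'e \<Rightarrow> 'e) \<Rightarrow>
     (nat \<Rightarrow> 'e \<Rightarrow> 'u \<Rightarrow> 'e \<Rightarrow> real) \<Rightarrow> ('e \<Rightarrow> real) \<Rightarrow> (nat \<Rightarrow> 'u) \<Rightarrow> (nat \<Rightarrow> 'e) \<Rightarrow> nat \<Rightarrow> 'u" where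
  "dju T U f L K u w t = grad_on (U t) (\<lambda>v. total_cost T f L K (u(t := v)) w) (u t)"

text \<open>
  A random Jacobian is square integrable iff its transposed products with fixed vectors are.
  Note that the control ranges over all of \<open>\<U>\<close>, without any measurability or \<open>\<Gamma>\<close>-constraint.
\<close>

definition derivatives_square_integrable ::
    "'a measure \<Rightarrow> nat \<Rightarrow> (nat \<Rightarrow> 'e::euclidean_space set) \<Rightarrow> (nat \<Rightarrow> 'u::euclidean_space set) \<Rightarrow>
     (nat \<Rightarrow> 'e \<Rightarrow> 'u \<Rightarrow> 'e \<Rightarrow> 'e) \<Rightarrow> (nat \<Rightarrow> 'e \<Rightarrow> 'u \<Rightarrow> 'e \<Rightarrow> real) \<Rightarrow> ('e \<Rightarrow> real) \<Rightarrow>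
     (nat \<Rightarrow> 'a \<Rightarrow> 'e) \<Rightarrow> bool" where
  "derivatives_square_integrable M T X U f L K w \<longleftrightarrow>
     (\<forall>u\<in>controls M T U.
       let x = (\<lambda>t \<omega>. traj f (\<lambda>s. u s \<omega>) (\<lambda>s. w s \<omega>) t) in
         integrable M (\<lambda>\<omega>. total_cost T f L K (\<lambda>s. u s \<omega>) (\<lambda>s. w s \<omega>)) \<and>
         (\<forall>t<T. (\<lambda>\<omega>. dLx X L t (x t \<omega>) (u t \<omega>) (w (Suc t) \<omega>)) \<in> L2 M (X t) \<and>
                (\<lambda>\<omega>. dLu U L t (x t \<omega>) (u t \<omega>) (w (Suc t) \<omega>)) \<in> L2 M (U t) \<and>
                (\<forall>y\<in>X (Suc t).
                   (\<lambda>\<omega>. dfx X f t (x t \<omega>) (u t \<omega>) (w (Suc t) \<omega>) y) \<in> L2 M (X t) \<and>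
                   (\<lambda>\<omega>. dfu U f t (x t \<omega>) (u t \<omega>) (w (Suc t) \<omega>) y) \<in> L2 M (U t))) \<and>
         (\<lambda>\<omega>. grad_on (X T) K (x T \<omega>)) \<in> L2 M (X T) \<and>
         (\<forall>t\<le>T. (\<lambda>\<omega>. costate T X f L K (\<lambda>s. u s \<omega>) (\<lambda>s. w s \<omega>) t) \<in> L2 M (X t)) \<and>
         (\<forall>t<T. (\<lambda>\<omega>. dju T U f L K (\<lambda>s. u s \<omega>) (\<lambda>s. w s \<omega>) t) \<in> L2 M (U t)))"


section \<open>The optimal control problem\<close>

definition state_equation ::
    "'a measure \<Rightarrow> nat \<Rightarrow> (nat \<Rightarrow> 'e \<Rightarrow> 'u \<Rightarrow> 'e \<Rightarrow> 'e) \<Rightarrow> (nat \<Rightarrow> 'a \<Rightarrow> 'e) \<Rightarrow>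
     (nat \<Rightarrow> 'a \<Rightarrow> 'u) \<Rightarrow> (nat \<Rightarrow> 'a \<Rightarrow> 'e) \<Rightarrow> bool" where
  "state_equation M T f w u x \<longleftrightarrow>
     (AE \<omega> in M. x 0 \<omega> = w 0 \<omega>) \<and>
     (\<forall>t<T. AE \<omega> in M. x (Suc t) \<omega> = f t (x t \<omega>) (u t \<omega>) (w (Suc t) \<omega>))"

definition feasible ::
    "'a measure \<Rightarrow> nat \<Rightarrow> (nat \<Rightarrow> 'e::euclidean_space set) \<Rightarrow> (nat \<Rightarrow> 'u::euclidean_space set) \<Rightarrow>
     (nat \<Rightarrow> 'e \<Rightarrow> 'u \<Rightarrow> 'e \<Rightarrow> 'e) \<Rightarrow> (nat \<Rightarrow> 'a \<Rightarrow> 'e) \<Rightarrow> (nat \<Rightarrow> 'a measure) \<Rightarrow>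
     (nat \<Rightarrow> 'a \<Rightarrow> 'u set) \<Rightarrow> (nat \<Rightarrow> 'a \<Rightarrow> 'u) \<Rightarrow> (nat \<Rightarrow> 'a \<Rightarrow> 'e) \<Rightarrow> bool" where
  "feasible M T X U f w G \<Gamma> u x \<longleftrightarrow>
     u \<in> controls M T U \<and> x \<in> states M T X \<and> state_equation M T f w u x \<and>
     (\<forall>t<T. u t \<in> U_as M (U t) (\<Gamma> t) \<inter> U_me M (U t) (G t))"

definition expected_cost ::
    "'a measure \<Rightarrow> nat \<Rightarrow> (nat \<Rightarrow> 'e \<Rightarrow> 'u \<Rightarrow> 'e \<Rightarrow> real) \<Rightarrow> ('e \<Rightarrow> real) \<Rightarrow>
     (nat \<Rightarrow> 'a \<Rightarrow> 'e) \<Rightarrow> (nat \<Rightarrow> 'a \<Rightarrow> 'u) \<Rightarrow> (nat \<Rightarrow> 'a \<Rightarrow> 'e) \<Rightarrow> real" where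
  "expected_cost M T L K w u x =
     (\<integral>\<omega>. (\<Sum>t<T. L t (x t \<omega>) (u t \<omega>) (w (Suc t) \<omega>)) + K (x T \<omega>) \<partial>M)"

definition is_solution ::
    "'a measure \<Rightarrow> nat \<Rightarrow> (nat \<Rightarrow> 'e::euclidean_space set) \<Rightarrow> (nat \<Rightarrow> 'u::euclidean_space set) \<Rightarrow>
     (nat \<Rightarrow> 'e \<Rightarrow> 'u \<Rightarrow> 'e \<Rightarrow> 'e) \<Rightarrow> (nat \<Rightarrow> 'e \<Rightarrow> 'u \<Rightarrow> 'e \<Rightarrow> real) \<Rightarrow> ('e \<Rightarrow> real) \<Rightarrow>
     (nat \<Rightarrow> 'a \<Rightarrow> 'e) \<Rightarrow> (nat \<Rightarrow> 'a measure) \<Rightarrow> (nat \<Rightarrow> 'a \<Rightarrow> 'u set) \<Rightarrow>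
     (nat \<Rightarrow> 'a \<Rightarrow> 'u) \<Rightarrow> (nat \<Rightarrow> 'a \<Rightarrow> 'e) \<Rightarrow> bool" where
  "is_solution M T X U f L K w G \<Gamma> u x \<longleftrightarrow>
     feasible M T X U f w G \<Gamma> u x \<and>
     (\<forall>u' x'. feasible M T X U f w G \<Gamma> u' x' \<longrightarrow>
        expected_cost M T L K w u x \<le> expected_cost M T L K w u' x')"


section \<open>Optimality conditions\<close>

definition x_gradient ::
    "(nat \<Rightarrow> 'e::euclidean_space set) \<Rightarrow> (nat \<Rightarrow> 'e \<Rightarrow> 'u \<Rightarrow> 'e \<Rightarrow> 'e) \<Rightarrow>
     (nat \<Rightarrow> 'e \<Rightarrow> 'u \<Rightarrow> 'e \<Rightarrow> real) \<Rightarrow> (nat \<Rightarrow> 'a \<Rightarrow> 'e) \<Rightarrow> (nat \<Rightarrow> 'a \<Rightarrow> 'u) \<Rightarrow>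
     (nat \<Rightarrow> 'a \<Rightarrow> 'e) \<Rightarrow> (nat \<Rightarrow> 'a \<Rightarrow> 'e) \<Rightarrow> nat \<Rightarrow> 'a \<Rightarrow> 'e" where
  "x_gradient X f L w u x \<Lambda> t = (\<lambda>\<omega>.
     dLx X L t (x t \<omega>) (u t \<omega>) (w (Suc t) \<omega>) +
     dfx X f t (x t \<omega>) (u t \<omega>) (w (Suc t) \<omega>) (\<Lambda> (Suc t) \<omega>))"

definition u_gradient ::
    "(nat \<Rightarrow> 'u::euclidean_space set) \<Rightarrow> (nat \<Rightarrow> 'e \<Rightarrow> 'u \<Rightarrow> 'e \<Rightarrow> 'e::euclidean_space) \<Rightarrow>
     (nat \<Rightarrow> 'e \<Rightarrow> 'u \<Rightarrow> 'e \<Rightarrow> real) \<Rightarrow> (nat \<Rightarrow> 'a \<Rightarrow> 'e) \<Rightarrow> (nat \<Rightarrow> 'a \<Rightarrow> 'u) \<Rightarrow>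
     (nat \<Rightarrow> 'a \<Rightarrow> 'e) \<Rightarrow> (nat \<Rightarrow> 'a \<Rightarrow> 'e) \<Rightarrow> nat \<Rightarrow> 'a \<Rightarrow> 'u" where
  "u_gradient U f L w u x \<Lambda> t = (\<lambda>\<omega>.
     dLu U L t (x t \<omega>) (u t \<omega>) (w (Suc t) \<omega>) +
     dfu U f t (x t \<omega>) (u t \<omega>) (w (Suc t) \<omega>) (\<Lambda> (Suc t) \<omega>))"

text \<open>
  Conditional expectations are determined up to null sets, so they are compared almost surely;
  in the last condition \<open>-r\<close> is the representative lying in \<open>-\<partial>\<chi>\<close>.
\<close>

definition optimality_system ::
    "'a measure \<Rightarrow> nat \<Rightarrow> (nat \<Rightarrow> 'e::euclidean_space set) \<Rightarrow> (nat \<Rightarrow> 'u::euclidean_space set) \<Rightarrow>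
     (nat \<Rightarrow> 'e \<Rightarrow> 'u \<Rightarrow> 'e \<Rightarrow> 'e) \<Rightarrow> (nat \<Rightarrow> 'e \<Rightarrow> 'u \<Rightarrow> 'e \<Rightarrow> real) \<Rightarrow> ('e \<Rightarrow> real) \<Rightarrow>
     (nat \<Rightarrow> 'a \<Rightarrow> 'e) \<Rightarrow> (nat \<Rightarrow> 'a measure) \<Rightarrow> (nat \<Rightarrow> 'a \<Rightarrow> 'u set) \<Rightarrow>
     (nat \<Rightarrow> 'a \<Rightarrow> 'u) \<Rightarrow> (nat \<Rightarrow> 'a \<Rightarrow> 'e) \<Rightarrow> (nat \<Rightarrow> 'a \<Rightarrow> 'e) \<Rightarrow> bool" where
  "optimality_system M T X U f L K w G \<Gamma> u x \<Lambda> \<longleftrightarrow>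
     \<Lambda> \<in> states M T X \<and>
     state_equation M T f w u x \<and>
     (AE \<omega> in M. \<Lambda> T \<omega> = grad_on (X T) K (x T \<omega>)) \<and>
     (\<forall>t<T. AE \<omega> in M.
        \<Lambda> t \<omega> = cond_exp_vec M (noise_algebra M w t) (x_gradient X f L w u x \<Lambda> t) \<omega>) \<and>
     (\<forall>t<T. \<exists>r \<in> subdiff_indicator M (U t) (U_as M (U t) (\<Gamma> t)) (u t).
        AE \<omega> in M. cond_exp_vec M (G t) (u_gradient U f L w u x \<Lambda> t) \<omega> = - r \<omega>)"

end

theory Submission
  imports Defs
begin

text \<open>
  Pointwise, the gradient of the cost in \<open>u\<^sub>t\<close> is
  \<open>(L\<^sub>t)'\<^sub>u + (f\<^sub>t)'\<^sub>u \<lambda>\<^sub>t\<^sub>+\<^sub>1\<close> with the co-state \<open>\<lambda>\<close>.  Perturbing an optimal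
  control inside the convex set \<open>\<Gamma>\<^sub>t\<close> and projecting onto \<open>\<F>\<^sub>t\<close> puts its conditional
  expectation into the normal cone, and \<open>\<Lambda>\<^sub>t = E(\<lambda>\<^sub>t | \<F>\<^sub>t)\<close> satisfies the adjoint
  equation by the tower property.  If \<open>u\<^sub>t\<close> is a function of \<open>x\<^sub>t\<close>, then, backwards in time, every
  conditional expectation given \<open>\<F>\<^sub>t\<close> is one of a function of \<open>x\<^sub>t\<close> and of the independent noise
  \<open>w\<^sub>t\<^sub>+\<^sub>1\<close>, hence a function of \<open>x\<^sub>t\<close>.

  An arbitrary solution need not be a feedback in the state.  To obtain one that is, the dependence on the past is
  removed forwards in time: conditionally on the state (and on the coordinates of the past not yet treated), a scalar
  coordinate of the past is replaced by its conditional quantile at an independent uniform level \<open>q\<close>.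
  This does not change the joint law with the state and the future noise, hence neither the average cost, so almost
  every level \<open>q\<close> gives another optimal control, which no longer depends on that coordinate.
\<close>

text \<open>The cost is not assumed convex in the control and the dynamics may be nonlinear, so a
  solution cannot be turned into a feedback by averaging it given the state. A quantile selects an
  actual value of the past instead, which for almost every level respects the constraint set.
  Quantiles live on the line; this is why scalar coordinates are treated one at a time. A coordinate
  must be replaced in all later controls at once, since otherwise their joint law with the state and
  the noise would change. Two obstacles shape many statements. \<open>rv_preceq\<close> compares
  sigma-algebras exactly, without completion by null sets, whereas states, co-states and conditional
  expectations are determined almost surely only; versions therefore have to be chosen as genuine
  functions of the state. And square integrability of the derivatives is assumed for each control
  separately, with no uniform bound near an optimal one, so the dominating function for
  differentiating the expected cost has to be extracted from one suitably chosen control.\<close>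

section \<open>Measurability of normal integrands and factorisation\<close>

text \<open>Lower semicontinuity in terms of hitting conditions, countably many of them when
  \<open>E\<close> is countable. The boxes are centred at points of \<open>E\<close> and not at
  \<open>p\<close>, because \<open>p\<close> will depend on the parameter, while measurability of a
  multifunction speaks about fixed open sets only.\<close>

lemma closed_epi_less_iff:
  fixes p :: "'b::euclidean_space" and g :: "'b \<Rightarrow> ereal"
  assumes cl: "closed (epi_on D g)" and p: "p \<in> D"
    and dense: "\<And>V. open V \<Longrightarrow> V \<noteq> {} \<Longrightarrow> \<exists>d\<in>E. d \<in> V"
  shows "g p < ereal c \<longleftrightarrow>
    (\<exists>c'\<in>{r\<in>\<rat>. r < c}. \<forall>n. \<exists>q\<in>E. dist q p < 1 / Suc n \<and> epi_on D g \<inter> (ball q (1 / Suc n) \<times> {..<c'}) \<noteq> {})"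
proof
  assume less: "g p < ereal c"
  \<comment> \<open>Two levels fit between \<open>g p\<close> and \<open>c\<close>: the real
    \<open>c''\<close> is the height of an epigraph point above \<open>p\<close>, and the rational
    \<open>c'\<close> lies strictly above it, so the open box contains that point.\<close>
  have "\<exists>c''. g p < ereal c'' \<and> c'' < c"
    using less ereal_dense2[OF less] by auto
  then obtain c'' where c'': "g p < ereal c''" "c'' < c" by auto
  obtain c' where c': "c' \<in> \<rat>" "c'' < c'" "c' < c" using Rats_dense_in_real[OF c''(2)] by auto
  show "\<exists>c'\<in>{r\<in>\<rat>. r < c}. \<forall>n. \<exists>q\<in>E. dist q p < 1 / Suc n \<and> epi_on D g \<inter> (ball q (1 / Suc n) \<times> {..<c'}) \<noteq> {}"
  proof (intro bexI[of _ c'] allI)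
    fix n
    obtain q where q: "q \<in> E" "q \<in> ball p (1 / Suc n)"
      using dense[of "ball p (1 / Suc n)"] by auto
    have "(p, c'') \<in> epi_on D g \<inter> (ball q (1 / Suc n) \<times> {..<c'})"
      using p c''(1) c'(2) q(2) by (auto simp: epi_on_def dist_commute)
    then show "\<exists>q\<in>E. dist q p < 1 / Suc n \<and> epi_on D g \<inter> (ball q (1 / Suc n) \<times> {..<c'}) \<noteq> {}"
      using q by (intro bexI[of _ q] conjI) (auto simp: dist_commute)
  qed (use c' in auto)
next
  assume "\<exists>c'\<in>{r\<in>\<rat>. r < c}. \<forall>n. \<exists>q\<in>E. dist q p < 1 / Suc n \<and> epi_on D g \<inter> (ball q (1 / Suc n) \<times> {..<c'}) \<noteq> {}"
  then obtain c' where c': "c' < c"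
    and ex: "\<And>n. \<exists>q\<in>E. dist q p < 1 / Suc n \<and> epi_on D g \<inter> (ball q (1 / Suc n) \<times> {..<c'}) \<noteq> {}"
    by auto
  \<comment> \<open>Raising the height from \<open>a\<close> to the fixed \<open>c'\<close> leaves
    only the first coordinate to converge. Closedness then gives \<open>g p \<le> c'\<close>, which
    is still strictly below \<open>c\<close>.\<close>
  have "\<exists>p'. (p', c') \<in> epi_on D g \<and> dist p' p < 2 / Suc n" for n
  proof -
    obtain q p' a where "dist q p < 1 / Suc n" "p' \<in> D" "g p' \<le> ereal a" "dist q p' < 1 / Suc n" "a < c'"
      using ex[of n] by (auto simp: epi_on_def)
    moreover from this have "g p' \<le> ereal c'" using order_trans[of "g p'" "ereal a" "ereal c'"] by auto
    moreover have "dist p' p \<le> dist q p' + dist q p" by (metis dist_commute dist_triangle)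
    ultimately show ?thesis by (intro exI[of _ p']) (auto simp: epi_on_def)
  qed
  then obtain P where P: "\<And>n. (P n, c') \<in> epi_on D g" "\<And>n. dist (P n) p < 2 / Suc n" by metis
  have "(\<lambda>n. 2 / Suc n) \<longlonglongrightarrow> (0::real)"
    using LIMSEQ_inverse_real_of_nat[THEN tendsto_mult_left[where c=2]] by (simp add: field_simps)
  then have "(\<lambda>n. dist (P n) p) \<longlonglongrightarrow> 0"
    by (rule Lim_null_comparison[rotated]) (use P(2) in \<open>auto intro!: always_eventually less_imp_le simp del: of_nat_Suc\<close>)
  then have "P \<longlonglongrightarrow> p" by (rule tendsto_dist_iff[THEN iffD2])
  then have "(\<lambda>n. (P n, c')) \<longlonglongrightarrow> (p, c')" by (intro tendsto_Pair) auto
  then have "(p, c') \<in> epi_on D g" using closed_sequentially[OF cl, of "\<lambda>n. (P n, c')"] P(1) by blast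
  then show "g p < ereal c" using c' by (auto simp: epi_on_def intro: le_less_trans)
qed

text \<open>Rockafellar--Wets, Proposition 14.28.\<close>

lemma measurable_normal_integrand:
  fixes g :: "'t \<Rightarrow> 'b::euclidean_space \<Rightarrow> real"
  assumes ni: "normal_integrand A D (\<lambda>t p. ereal (g t p))"
    and b: "b \<in> N \<rightarrow>\<^sub>M A" and p[measurable]: "p \<in> borel_measurable N"
    and D: "\<And>\<omega>. \<omega> \<in> space N \<Longrightarrow> p \<omega> \<in> D"
  shows "(\<lambda>\<omega>. g (b \<omega>) (p \<omega>)) \<in> borel_measurable N"
proof (rule borel_measurable_iff_less[THEN iffD2], rule allI)
  fix c :: real
  obtain E :: "'b set" where E: "countable E" "\<And>V. open V \<Longrightarrow> V \<noteq> {} \<Longrightarrow> \<exists>d\<in>E. d \<in> V"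
    using countable_dense_exists[where 'a='b] by auto
  have cl: "closed (epi_on D (\<lambda>p. ereal (g (b \<omega>) p)))" if "\<omega> \<in> space N" for \<omega>
    using ni measurable_space[OF b that] by (auto simp: normal_integrand_def)
  have *[measurable]: "{\<omega> \<in> space N. epi_on D (\<lambda>p. ereal (g (b \<omega>) p)) \<inter> V \<noteq> {}} \<in> sets N" if "open V" for V
  proof -
    have "{t \<in> space A. epi_on D (\<lambda>p. ereal (g t p)) \<inter> V \<noteq> {}} \<in> sets A"
      using ni that by (auto simp: normal_integrand_def measurable_multifun_def)
    from measurable_sets[OF b this] show ?thesis
      by (rule back_subst[where P="\<lambda>S. S \<in> sets N"]) (use measurable_space[OF b] in auto)
  qed
  \<comment> \<open>For fixed indices both conditions are measurable: the first involves
    \<open>p\<close> alone, the second is a hitting condition with a fixed open box. What remains is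
    a countable combination of such sets.\<close>
  define S where "S c' n q = {\<omega>\<in>space N. dist q (p \<omega>) < 1 / Suc n} \<inter>
      {\<omega> \<in> space N. epi_on D (\<lambda>p. ereal (g (b \<omega>) p)) \<inter> (ball q (1 / Suc n) \<times> {..<c'}) \<noteq> {}}" for c' n q
  have S[measurable]: "S c' n q \<in> sets N" for c' n q
    unfolding S_def by (intro sets.Int * open_Times) auto
  have "{\<omega>\<in>space N. g (b \<omega>) (p \<omega>) < c} =
     {\<omega>\<in>space N. \<exists>c'\<in>{r\<in>\<rat>. r < c}. \<forall>n. \<exists>q\<in>E. \<omega> \<in> S c' n q}"
    (is "?L = ?R")
  proof (rule Collect_cong, rule conj_cong[OF refl])
    fix \<omega> assume \<omega>: "\<omega> \<in> space N"
    show "g (b \<omega>) (p \<omega>) < c \<longleftrightarrow> (\<exists>c'\<in>{r\<in>\<rat>. r < c}. \<forall>n. \<exists>q\<in>E. \<omega> \<in> S c' n q)"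
      using closed_epi_less_iff[OF cl[OF \<omega>] D[OF \<omega>] E(2), of c] \<omega> by (simp add: S_def)
  qed
  also have "?R \<in> sets N"
  proof -
    have cr: "countable {r\<in>\<rat>. r < c}" by (rule countable_subset[OF _ countable_rat]) auto
    have U: "(\<Union>q\<in>E. S c' n q) \<in> sets N" for c' n
      using S E(1) by (intro sets.countable_UN') auto
    have I: "(\<Inter>n. \<Union>q\<in>E. S c' n q) \<in> sets N" for c'
      using U by (intro sets.countable_INT) auto
    have "?R = space N \<inter> (\<Union>c'\<in>{r\<in>\<rat>. r < c}. \<Inter>n. \<Union>q\<in>E. S c' n q)"
      by auto
    also have "\<dots> \<in> sets N"
      by (intro sets.Int sets.top sets.countable_UN'[OF cr]) (use I in auto)
    finally show ?thesis .
  qed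
  finally show "{\<omega>\<in>space N. g (b \<omega>) (p \<omega>) < c} \<in> sets N" .
qed

text \<open>Doob-Dynkin factorisation. With values in \<open>ennreal\<close> the limit step is
  harmless: the supremum of the factors exists on all of \<open>N\<close>, also off the range of
  \<open>X\<close>, where the factors need not be monotone.\<close>

lemma doob_dynkin_nonneg:
  fixes h :: "'a \<Rightarrow> ennreal"
  assumes X: "X \<in> \<Omega> \<rightarrow> space N" and h: "h \<in> borel_measurable (vimage_algebra \<Omega> X N)"
  shows "\<exists>\<phi>\<in>borel_measurable N. \<forall>\<omega>\<in>\<Omega>. h \<omega> = \<phi> (X \<omega>)"
  using h
proof (induction h rule: borel_measurable_induct)
  case (cong f g)
  then show ?case by (metis space_vimage_algebra)
next
  case (set A)
  then obtain B where "B \<in> sets N" "A = X -` B \<inter> \<Omega>" using X by (auto simp: sets_vimage_algebra2)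
  then show ?case by (intro bexI[of _ "indicator B"]) (auto simp: indicator_def)
next
  case (mult u c)
  then obtain \<phi> where "\<phi> \<in> borel_measurable N" "\<forall>\<omega>\<in>\<Omega>. u \<omega> = \<phi> (X \<omega>)" by blast
  then show ?case by (intro bexI[of _ "\<lambda>a. c * \<phi> a"]) simp_all
next
  case (add u v)
  then obtain \<phi> \<psi> where "\<phi> \<in> borel_measurable N" "\<forall>\<omega>\<in>\<Omega>. u \<omega> = \<phi> (X \<omega>)"
    "\<psi> \<in> borel_measurable N" "\<forall>\<omega>\<in>\<Omega>. v \<omega> = \<psi> (X \<omega>)" by blast
  then show ?case by (intro bexI[of _ "\<lambda>a. \<psi> a + \<phi> a"]) simp_all
next
  case (seq U)
  then have "\<forall>i. \<exists>\<phi>. \<phi> \<in> borel_measurable N \<and> (\<forall>\<omega>\<in>\<Omega>. U i \<omega> = \<phi> (X \<omega>))" by blast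
  then obtain \<phi> where \<phi>: "\<And>i. \<phi> i \<in> borel_measurable N" "\<And>i \<omega>. \<omega> \<in> \<Omega> \<Longrightarrow> U i \<omega> = \<phi> i (X \<omega>)" by metis
  show ?case by (intro bexI[of _ "\<lambda>a. SUP i. \<phi> i a"]) (use \<phi> in \<open>simp_all add: image_comp\<close>)
qed

lemma doob_dynkin_real:
  fixes h :: "'a \<Rightarrow> real"
  assumes X: "X \<in> \<Omega> \<rightarrow> space N" and h[measurable]: "h \<in> borel_measurable (vimage_algebra \<Omega> X N)"
  shows "\<exists>\<phi>\<in>borel_measurable N. \<forall>\<omega>\<in>\<Omega>. h \<omega> = \<phi> (X \<omega>)"
proof -
  have "(\<lambda>\<omega>. ennreal (h \<omega>)) \<in> borel_measurable (vimage_algebra \<Omega> X N)"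
    "(\<lambda>\<omega>. ennreal (- h \<omega>)) \<in> borel_measurable (vimage_algebra \<Omega> X N)" by measurable
  from doob_dynkin_nonneg[OF X this(1)] doob_dynkin_nonneg[OF X this(2)]
  obtain \<phi> \<psi> where \<phi>: "\<phi> \<in> borel_measurable N" "\<forall>\<omega>\<in>\<Omega>. ennreal (h \<omega>) = \<phi> (X \<omega>)"
    and \<psi>: "\<psi> \<in> borel_measurable N" "\<forall>\<omega>\<in>\<Omega>. ennreal (- h \<omega>) = \<psi> (X \<omega>)"
    by blast
  have "\<forall>\<omega>\<in>\<Omega>. h \<omega> = enn2real (\<phi> (X \<omega>)) - enn2real (\<psi> (X \<omega>))"
  proof (intro ballI)
    fix \<omega> assume "\<omega> \<in> \<Omega>"
    then have "ennreal (h \<omega>) = \<phi> (X \<omega>)" "ennreal (- h \<omega>) = \<psi> (X \<omega>)"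
      using \<phi>(2) \<psi>(2) by blast+
    from this[symmetric] show "h \<omega> = enn2real (\<phi> (X \<omega>)) - enn2real (\<psi> (X \<omega>))"
      by (cases "h \<omega> \<ge> 0") (simp_all add: ennreal_neg)
  qed
  then show ?thesis
    using \<phi>(1) \<psi>(1)
    by (intro bexI[of _ "\<lambda>a. enn2real (\<phi> a) - enn2real (\<psi> a)"]) simp_all
qed

lemma doob_dynkin:
  fixes h :: "'a \<Rightarrow> 'b::euclidean_space"
  assumes X: "X \<in> \<Omega> \<rightarrow> space N" and h[measurable]: "h \<in> borel_measurable (vimage_algebra \<Omega> X N)"
  obtains \<phi> where "\<phi> \<in> borel_measurable N" "\<And>\<omega>. \<omega> \<in> \<Omega> \<Longrightarrow> h \<omega> = \<phi> (X \<omega>)"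
proof -
  have "\<forall>i. \<exists>\<phi>\<in>borel_measurable N. \<forall>\<omega>\<in>\<Omega>. h \<omega> \<bullet> i = \<phi> (X \<omega>)"
    by (intro allI doob_dynkin_real[OF X]) simp
  then obtain \<phi> where \<phi>: "\<And>i. \<phi> i \<in> borel_measurable N" "\<And>i \<omega>. \<omega> \<in> \<Omega> \<Longrightarrow> h \<omega> \<bullet> i = \<phi> i (X \<omega>)" by metis
  show ?thesis
  proof
    show "(\<lambda>a. \<Sum>i\<in>Basis. \<phi> i a *\<^sub>R i) \<in> borel_measurable N" using \<phi>(1) by simp
    show "h \<omega> = (\<Sum>i\<in>Basis. \<phi> i (X \<omega>) *\<^sub>R i)" if "\<omega> \<in> \<Omega>" for \<omega>
      using \<phi>(2)[OF that] euclidean_representation[of "h \<omega>"] by simp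
  qed
qed

text \<open>Serves to change the encoding of the same information: the past noise as vectors or as
  scalar coordinates, with one coordinate split off, or with trivial components deleted.\<close>

lemma measurable_vimage_algebra_factor:
  assumes g: "g \<in> borel_measurable (vimage_algebra \<Omega> h N)" and h: "h \<in> \<Omega> \<rightarrow> space N"
    and \<theta>: "\<theta> \<in> N' \<rightarrow>\<^sub>M N" and h': "h' \<in> \<Omega> \<rightarrow> space N'" and eq: "\<And>\<omega>. \<omega> \<in> \<Omega> \<Longrightarrow> h \<omega> = \<theta> (h' \<omega>)"
  shows "g \<in> borel_measurable (vimage_algebra \<Omega> h' N')"
proof -
  have "sets (vimage_algebra \<Omega> h N) \<subseteq> sets (vimage_algebra \<Omega> h' N')"
  proof
    fix A assume "A \<in> sets (vimage_algebra \<Omega> h N)"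
    then obtain B where B: "B \<in> sets N" "A = h -` B \<inter> \<Omega>" by (auto simp: sets_vimage_algebra2[OF h])
    have "A = h' -` (\<theta> -` B \<inter> space N') \<inter> \<Omega>" using h' eq by (auto simp: B(2))
    then show "A \<in> sets (vimage_algebra \<Omega> h' N')"
      using measurable_sets[OF \<theta> B(1)] unfolding sets_vimage_algebra2[OF h'] by blast
  qed
  then show ?thesis using g by (auto simp: measurable_def)
qed

section \<open>Conditional quantiles\<close>

text \<open>A version of the conditional tail probability of \<open>r\<close> given \<open>z\<close>
  that is a function of \<open>z\<close> and decreases in the rational level at every point, not
  just almost surely. This makes the events of the quantile construction nested without exceptional
  null sets.\<close>

lemma (in prob_space) conditional_tails:
  fixes r :: "'a \<Rightarrow> real"
  assumes z[measurable]: "z \<in> M \<rightarrow>\<^sub>M N" and r[measurable]: "r \<in> borel_measurable M"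
  obtains g :: "real \<Rightarrow> 'b \<Rightarrow> real"
  where "\<And>c. g c \<in> borel_measurable N"
    and "\<And>c n. g c n \<in> {0..1}"
    and "\<And>c c' n. c \<in> \<rat> \<Longrightarrow> c' \<in> \<rat> \<Longrightarrow> c \<le> c' \<Longrightarrow> g c' n \<le> g c n"
    and "\<And>c A. c \<in> \<rat> \<Longrightarrow> A \<in> sets N \<Longrightarrow>
      (\<integral>\<^sup>+\<omega>. indicator A (z \<omega>) * ennreal (g c (z \<omega>)) \<partial>M) = emeasure M {\<omega> \<in> space M. z \<omega> \<in> A \<and> c < r \<omega>}"
proof -
  define F where "F = vimage_algebra (space M) z N"
  have F: "subalgebra M F"
    using measurable_space[OF z] measurable_sets[OF z]
    by (auto simp: F_def subalgebra_def sets_vimage_algebra2 Pi_iff)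
  interpret finite_measure_subalgebra M F
    by unfold_locales (rule F)
  have zsp: "z \<in> space M \<rightarrow> space N" using measurable_space[OF z] by auto
  define I :: "real \<Rightarrow> 'a \<Rightarrow> real" where "I c = indicator {\<omega> \<in> space M. c < r \<omega>}" for c
  have I: "integrable M (I c)" for c
    unfolding I_def by (intro integrable_real_indicator) (auto simp: less_top[symmetric])
  have "\<forall>c. \<exists>g\<in>borel_measurable N. \<forall>\<omega>\<in>space M. real_cond_exp M F (I c) \<omega> = g (z \<omega>)"
    by (intro allI doob_dynkin_real[OF zsp]) (simp flip: F_def)
  then obtain g0 where [measurable]: "\<And>c. g0 c \<in> borel_measurable N"
    and g0: "\<And>c \<omega>. \<omega> \<in> space M \<Longrightarrow> real_cond_exp M F (I c) \<omega> = g0 c (z \<omega>)" by metis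
  \<comment> \<open>The truncation costs nothing almost surely, since the conditional expectation of
    an indicator lies in [0, 1], and it makes the suprema below finite.\<close>
  define g1 where "g1 c n = max 0 (min 1 (g0 c n))" for c n
  have g1: "0 \<le> g1 c n" "g1 c n \<le> 1" for c n by (auto simp: g1_def)
  have [measurable]: "g1 c \<in> borel_measurable N" for c unfolding g1_def by measurable
  \<comment> \<open>The supremum over larger rationals enforces monotonicity in the level and stays
    measurable, being countable. Irrational levels receive the default 0; only the bounds and
    measurability are claimed for them.\<close>
  define g where "g c n = (if c \<in> \<rat> then SUP c'\<in>{c'\<in>\<rat>. c \<le> c'}. g1 c' n else 0)" for c n
  have cr: "countable {c'\<in>\<rat>. c \<le> c'}" for c :: real by (rule countable_subset[OF _ countable_rat]) auto
  have bdd: "bdd_above ((\<lambda>c'. g1 c' n) ` {c' \<in> \<rat>. c \<le> c'})" for c n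
    using g1 by (intro bdd_aboveI2[where M=1]) auto
  have up: "c \<in> \<rat> \<Longrightarrow> c' \<in> \<rat> \<Longrightarrow> c \<le> c' \<Longrightarrow> g1 c' n \<le> g c n" for c c' n
    unfolding g_def using bdd by (auto intro!: cSUP_upper)
  have g: "g c n \<in> {0..1}" for c n
  proof (cases "c \<in> \<rat>")
    case True
    then have "g c n \<le> 1" unfolding g_def using g1 by (auto intro!: cSUP_least)
    then show ?thesis using up[OF True True, of n] g1(1)[of c n] by auto
  qed (simp add: g_def)
  have meas: "g c \<in> borel_measurable N" for c
    unfolding g_def using cr bdd by (cases "c \<in> \<rat>") (auto intro!: borel_measurable_cSUP)
  have anti: "g c' n \<le> g c n" if "c \<in> \<rat>" "c' \<in> \<rat>" "c \<le> c'" for c c' n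
  proof -
    have "(SUP x\<in>{x\<in>\<rat>. c' \<le> x}. g1 x n) \<le> (SUP x\<in>{x\<in>\<rat>. c \<le> x}. g1 x n)"
      using that bdd by (intro cSUP_subset_mono) auto
    then show ?thesis using that by (simp add: g_def)
  qed
  have eq: "AE \<omega> in M. g c (z \<omega>) = real_cond_exp M F (I c) \<omega>" if c: "c \<in> \<rat>" for c
  proof -
    \<comment> \<open>Countably many comparisons hold together outside one null set, and there the
      supremum is attained at \<open>c\<close> itself.\<close>
    have "AE \<omega> in M. \<forall>c'\<in>{c'\<in>\<rat>. c \<le> c'}. real_cond_exp M F (I c') \<omega> \<le> real_cond_exp M F (I c) \<omega>"
      using cr by (intro AE_ball_countable[THEN iffD2] ballI real_cond_exp_mono I) (auto simp: I_def indicator_def)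
    moreover have "AE \<omega> in M. real_cond_exp M F (I c) \<omega> \<ge> 0"
      by (intro real_cond_exp_ge_c I) (auto simp: I_def)
    moreover have "AE \<omega> in M. real_cond_exp M F (I c) \<omega> \<le> 1"
      by (intro real_cond_exp_le_c I) (auto simp: I_def indicator_def)
    ultimately show ?thesis
      using AE_space
    proof eventually_elim
      case (elim \<omega>)
        have "g1 c' (z \<omega>) \<le> real_cond_exp M F (I c) \<omega>" if "c' \<in> \<rat>" "c \<le> c'" for c'
          using elim that g0 by (auto simp: g1_def)
        then have "g c (z \<omega>) \<le> real_cond_exp M F (I c) \<omega>"
          unfolding g_def using c by (auto intro!: cSUP_least)
        moreover have "real_cond_exp M F (I c) \<omega> \<le> g c (z \<omega>)"
          using up[OF c c, of "z \<omega>"] elim g0 by (auto simp: g1_def)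
        ultimately show ?case by simp
    qed
  qed
  show ?thesis
  proof (rule that[OF meas g anti])
    fix c :: real and A assume c: "c \<in> \<rat>" and A[measurable]: "A \<in> sets N"
    note meas[measurable]
    have zA: "z -` A \<inter> space M \<in> sets F"
      using A by (auto simp: F_def sets_vimage_algebra2[OF zsp])
    have zM: "z -` A \<inter> space M \<in> sets M" by measurable
    have "(\<integral>\<^sup>+\<omega>. indicator A (z \<omega>) * ennreal (g c (z \<omega>)) \<partial>M) = (\<integral>\<^sup>+\<omega>. ennreal (indicator A (z \<omega>) * g c (z \<omega>)) \<partial>M)"
      by (intro nn_integral_cong) (auto simp: indicator_def)
    also have "\<dots> = ennreal (\<integral>\<omega>. indicator A (z \<omega>) * g c (z \<omega>) \<partial>M)"
    proof (intro nn_integral_eq_integral integrable_const_bound[where B=1])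
      show "AE \<omega> in M. norm (indicator A (z \<omega>) * g c (z \<omega>)) \<le> 1"
        using g by (auto simp: indicator_def)
      show "AE \<omega> in M. 0 \<le> indicator A (z \<omega>) * g c (z \<omega>)"
        using g by (auto simp: indicator_def)
    qed measurable
    also have "(\<integral>\<omega>. indicator A (z \<omega>) * g c (z \<omega>) \<partial>M) = (\<integral>\<omega>\<in>z -` A \<inter> space M. real_cond_exp M F (I c) \<omega> \<partial>M)"
      unfolding set_lebesgue_integral_def
    proof (intro integral_cong_AE)
      show "AE \<omega> in M. indicator A (z \<omega>) * g c (z \<omega>) = indicat_real (z -` A \<inter> space M) \<omega> *\<^sub>R real_cond_exp M F (I c) \<omega>"
        using eq[OF c] AE_space by eventually_elim (auto simp: indicator_def)
    qed (use zM in measurable)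
    also have "\<dots> = (\<integral>\<omega>\<in>z -` A \<inter> space M. I c \<omega> \<partial>M)"
      by (rule real_cond_exp_intA[symmetric, OF I zA])
    also have "\<dots> = (\<integral>\<omega>. indicator {\<omega> \<in> space M. z \<omega> \<in> A \<and> c < r \<omega>} \<omega> \<partial>M)"
      unfolding set_lebesgue_integral_def by (intro Bochner_Integration.integral_cong) (auto simp: I_def indicator_def)
    also have "\<dots> = measure M {\<omega> \<in> space M. z \<omega> \<in> A \<and> c < r \<omega>}"
      by (simp add: Int_absorb2 Collect_restrict)
    finally show "(\<integral>\<^sup>+\<omega>. indicator A (z \<omega>) * ennreal (g c (z \<omega>)) \<partial>M) = emeasure M {\<omega> \<in> space M. z \<omega> \<in> A \<and> c < r \<omega>}"
      by (simp add: emeasure_eq_measure)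
  qed
qed

text \<open>\<open>\<eta> (n, q)\<close> is the quantile of level \<open>1 - q\<close> of \<open>r\<close> conditionally on \<open>z = n\<close>.\<close>

lemma (in prob_space) conditional_quantile:
  fixes r :: "'a \<Rightarrow> real"
  assumes z[measurable]: "z \<in> M \<rightarrow>\<^sub>M N" and r[measurable]: "r \<in> borel_measurable M"
    and r01: "\<And>\<omega>. \<omega> \<in> space M \<Longrightarrow> r \<omega> \<in> {0..1}"
  defines "Q \<equiv> uniform_measure lborel {0..1::real}"
  obtains \<eta> where "\<eta> \<in> borel_measurable (N \<Otimes>\<^sub>M borel)"
    and "distr (distr M N z \<Otimes>\<^sub>M Q) (N \<Otimes>\<^sub>M borel) (\<lambda>(n, q). (n, \<eta> (n, q))) =
      distr M (N \<Otimes>\<^sub>M borel) (\<lambda>\<omega>. (z \<omega>, r \<omega>))"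
proof -
  interpret Q: prob_space Q unfolding Q_def by (intro prob_space_uniform_measure) auto
  have setsQ[measurable_cong]: "sets Q = sets borel" by (simp add: Q_def)
  have spQ[simp]: "space Q = UNIV" by (simp add: Q_def)
  interpret \<nu>: prob_space "distr M N z" by (rule prob_space_distr) measurable
  obtain g :: "real \<Rightarrow> 'b \<Rightarrow> real"
    where g[measurable]: "\<And>c. g c \<in> borel_measurable N"
    and g01: "\<And>c n. g c n \<in> {0..1}"
    and anti: "\<And>c c' n. c \<in> \<rat> \<Longrightarrow> c' \<in> \<rat> \<Longrightarrow> c \<le> c' \<Longrightarrow> g c' n \<le> g c n"
    and tail: "\<And>c A. c \<in> \<rat> \<Longrightarrow> A \<in> sets N \<Longrightarrow>
      (\<integral>\<^sup>+\<omega>. indicator A (z \<omega>) * ennreal (g c (z \<omega>)) \<partial>M) = emeasure M {\<omega> \<in> space M. z \<omega> \<in> A \<and> c < r \<omega>}"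
    using conditional_tails[OF z r] by blast
  define C where "C = \<rat> \<inter> {0..1::real}"
  have countC: "countable C" unfolding C_def by (rule countable_subset[OF _ countable_rat]) auto
  \<comment> \<open>The element 0 keeps the set nonempty and does no harm because \<open>r\<close>
    takes values in [0, 1]. Rational levels suffice, as \<open>\<eta>\<close> will only be examined
    through strict inequalities.\<close>
  define \<eta> where "\<eta> = (\<lambda>(n, q). Sup (insert 0 {c\<in>C. q < g c n}))"
  have eta_less: "c < \<eta> (n, q) \<longleftrightarrow> c < 0 \<or> (\<exists>c'\<in>C. c < c' \<and> q < g c' n)" for c n q
  proof -
    have "bdd_above (insert 0 {c\<in>C. q < g c n})" by (intro bdd_aboveI[where M=1]) (auto simp: C_def)
    then have "c < \<eta> (n, q) \<longleftrightarrow> (\<exists>x\<in>insert 0 {c\<in>C. q < g c n}. c < x)"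
      unfolding \<eta>_def split by (subst less_cSup_iff) auto
    then show ?thesis by blast
  qed
  have [measurable]: "\<eta> \<in> borel_measurable (N \<Otimes>\<^sub>M borel)"
  proof (rule borel_measurable_iff_greater[THEN iffD2], rule allI)
    fix c :: real
    have "{x \<in> space (N \<Otimes>\<^sub>M borel). c < \<eta> x} = {x \<in> space (N \<Otimes>\<^sub>M borel). c < 0 \<or> (\<exists>c'\<in>C. c < c' \<and> snd x < g c' (fst x))}"
      using eta_less by (intro Collect_cong) (auto simp: split_paired_all)
    also have "\<dots> \<in> sets (N \<Otimes>\<^sub>M borel)" using countC by measurable
    finally show "{x \<in> space (N \<Otimes>\<^sub>M borel). c < \<eta> x} \<in> sets (N \<Otimes>\<^sub>M borel)" .
  qed
  \<comment> \<open>A uniform level falls below \<open>a\<close> with probability \<open>a\<close>;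
    this turns the condition \<open>q < g c n\<close> into the conditional probability
    \<open>g c n\<close>.\<close>
  have Qg: "emeasure Q {..<a} = ennreal a" if "a \<in> {0..1}" for a
  proof -
    have "{0..1} \<inter> {..<a} = {0..<a}" using that by auto
    then have "emeasure Q {..<a} = ennreal a / ennreal 1" using that by (simp add: Q_def)
    then show ?thesis using that by (subst (asm) divide_ennreal) auto
  qed
  have sub: "emeasure (distr M N z \<Otimes>\<^sub>M Q) {x\<in>space (N \<Otimes>\<^sub>M borel). fst x \<in> A \<and> snd x < g c (fst x)} =
      emeasure M {\<omega> \<in> space M. z \<omega> \<in> A \<and> c < r \<omega>}" if c: "c \<in> \<rat>" and A[measurable]: "A \<in> sets N" for c A
  proof -
    have m: "{x\<in>space (N \<Otimes>\<^sub>M borel). fst x \<in> A \<and> snd x < g c (fst x)} \<in> sets (distr M N z \<Otimes>\<^sub>M Q)"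
      by measurable
    have "emeasure (distr M N z \<Otimes>\<^sub>M Q) {x\<in>space (N \<Otimes>\<^sub>M borel). fst x \<in> A \<and> snd x < g c (fst x)} =
       (\<integral>\<^sup>+n. indicator A n * ennreal (g c n) \<partial>distr M N z)"
      unfolding Q.emeasure_pair_measure_alt[OF m]
    proof (intro nn_integral_cong)
      fix n assume n: "n \<in> space (distr M N z)"
      have "Pair n -` {x\<in>space (N \<Otimes>\<^sub>M borel). fst x \<in> A \<and> snd x < g c (fst x)} = (if n \<in> A then {..< g c n} else {})"
        using n by (auto simp: space_pair_measure)
      then show "emeasure Q (Pair n -` {x\<in>space (N \<Otimes>\<^sub>M borel). fst x \<in> A \<and> snd x < g c (fst x)}) = indicator A n * ennreal (g c n)"
        using Qg[OF g01] by simp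
    qed
    also have "\<dots> = (\<integral>\<^sup>+\<omega>. indicator A (z \<omega>) * ennreal (g c (z \<omega>)) \<partial>M)"
      by (subst nn_integral_distr) auto
    finally show ?thesis using tail[OF c A] by simp
  qed
  \<comment> \<open>For \<open>c\<close> in [0, 1), the event \<open>c < \<eta>\<close> is the union
    of the events \<open>q < g c' n\<close> over rational \<open>c' > c\<close>. Continuity of
    measure from below extends the identity from rational levels to every real one.\<close>
  have key: "emeasure (distr M N z \<Otimes>\<^sub>M Q) {x\<in>space (N \<Otimes>\<^sub>M borel). fst x \<in> A \<and> c < \<eta> x} =
      emeasure M {\<omega> \<in> space M. z \<omega> \<in> A \<and> c < r \<omega>}" if A[measurable]: "A \<in> sets N" for c A
  proof -
    consider "c < 0" | "c \<ge> 1" | "0 \<le> c" "c < 1" by linarith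
    then show ?thesis
    proof cases
      case 1
      have "{x\<in>space (N \<Otimes>\<^sub>M borel). fst x \<in> A \<and> c < \<eta> x} = A \<times> UNIV"
        using eta_less 1 sets.sets_into_space[OF A] by (auto simp: space_pair_measure)
      moreover have "{\<omega> \<in> space M. z \<omega> \<in> A \<and> c < r \<omega>} = z -` A \<inter> space M"
        using 1 r01 by force
      moreover have "emeasure (distr M N z \<Otimes>\<^sub>M Q) (A \<times> UNIV) = emeasure (distr M N z) A"
        using Q.emeasure_space_1 by (subst Q.emeasure_pair_measure_Times) (auto simp: setsQ)
      ultimately show ?thesis by (simp add: emeasure_distr)
    next
      case 2
      have "{x\<in>space (N \<Otimes>\<^sub>M borel). fst x \<in> A \<and> c < \<eta> x} = {}"
        using eta_less 2 by (auto simp: C_def split_paired_all)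
      moreover have "{\<omega> \<in> space M. z \<omega> \<in> A \<and> c < r \<omega>} = {}" using 2 r01 by force
      ultimately show ?thesis by (simp only: emeasure_empty)
    next
      case 3
      let ?C = "C \<inter> {c<..}"
      obtain q1 where q1: "q1 \<in> \<rat>" "c < q1" "q1 < 1" using Rats_dense_in_real[OF 3(2)] by auto
      have ne: "?C \<noteq> {}" using q1 3 by (auto simp: C_def intro!: exI[of _ q1])
      have cC: "countable ?C" using countC by auto
      \<comment> \<open>Running minima of an enumeration give a decreasing sequence that is cofinal
        in the rational levels above \<open>c\<close>; both sides thereby become increasing
        unions.\<close>
      define d where "d k = Min (from_nat_into ?C ` {..k::nat})" for k
      have dC: "d k \<in> ?C" for k
        unfolding d_def using Min_in[of "from_nat_into ?C ` {..k}"] from_nat_into[OF ne] by fastforce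
      have ddec: "d (Suc k) \<le> d k" for k unfolding d_def by (intro Min_antimono) auto
      have dcof: "\<exists>k. d k \<le> c'" if c': "c' \<in> ?C" for c'
      proof -
        obtain k where "from_nat_into ?C k = c'" using from_nat_into_surj[OF cC c'] by blast
        then show ?thesis unfolding d_def by (intro exI[of _ k] Min_le) auto
      qed
      have dq: "d k \<in> \<rat>" "c < d k" for k using dC[of k] by (auto simp: C_def)
      define L where "L k = {x\<in>space (N \<Otimes>\<^sub>M borel). fst x \<in> A \<and> snd x < g (d k) (fst x)}" for k
      define R where "R k = {\<omega> \<in> space M. z \<omega> \<in> A \<and> d k < r \<omega>}" for k
      have LR: "emeasure (distr M N z \<Otimes>\<^sub>M Q) (L k) = emeasure M (R k)" for k
        unfolding L_def R_def by (rule sub[OF dq(1) A])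
      have "incseq L"
        using anti[OF dq(1) dq(1) ddec] by (intro incseq_SucI) (auto simp: L_def intro: less_le_trans)
      have "incseq R"
        using ddec by (intro incseq_SucI) (auto simp: R_def intro: le_less_trans)
      have "(\<Union>k. L k) = {x\<in>space (N \<Otimes>\<^sub>M borel). fst x \<in> A \<and> c < \<eta> x}"
      proof safe
        fix n q assume "(n, q) \<in> space (N \<Otimes>\<^sub>M borel)" "fst (n, q) \<in> A" "c < \<eta> (n, q)"
        moreover from this(3) obtain c' where c': "c' \<in> ?C" "q < g c' n" using 3 by (auto simp: eta_less)
        moreover from dcof[OF c'(1)] obtain k where "d k \<le> c'" by auto
        ultimately show "(n, q) \<in> (\<Union>k. L k)"
          using anti[of "d k" c' n] dq(1)[of k] by (auto simp: L_def C_def intro!: exI[of _ k])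
      next
        fix n q k assume "(n, q) \<in> L k"
        then show "c < \<eta> (n, q)" using dC[of k] by (auto simp: eta_less L_def)
      qed (auto simp: L_def)
      moreover have "(\<Union>k. R k) = {\<omega> \<in> space M. z \<omega> \<in> A \<and> c < r \<omega>}"
      proof safe
        fix \<omega> assume \<omega>: "\<omega> \<in> space M" "z \<omega> \<in> A" "c < r \<omega>"
        obtain q where q: "q \<in> \<rat>" "c < q" "q < r \<omega>" using Rats_dense_in_real[OF \<omega>(3)] by auto
        then have "q \<in> ?C" using 3 r01[OF \<omega>(1)] by (auto simp: C_def)
        from dcof[OF this] show "\<omega> \<in> (\<Union>k. R k)" using \<omega> q by (auto simp: R_def intro: le_less_trans)
      next
        fix \<omega> k assume "\<omega> \<in> R k" then show "c < r \<omega>" using dq(2)[of k] by (auto simp: R_def)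
      qed (auto simp: R_def)
      moreover have "(SUP k. emeasure (distr M N z \<Otimes>\<^sub>M Q) (L k)) = emeasure (distr M N z \<Otimes>\<^sub>M Q) (\<Union>k. L k)"
        by (rule SUP_emeasure_incseq[OF _ \<open>incseq L\<close>]) (auto simp: L_def)
      moreover have "(SUP k. emeasure M (R k)) = emeasure M (\<Union>k. R k)"
        by (rule SUP_emeasure_incseq[OF _ \<open>incseq R\<close>]) (auto simp: R_def)
      ultimately show ?thesis using LR by simp
    qed
  qed
  interpret pair_prob_space "distr M N z" Q ..
  have rect: "emeasure (distr M N z \<Otimes>\<^sub>M Q) {x\<in>space (N \<Otimes>\<^sub>M borel). fst x \<in> A \<and> \<eta> x \<in> B} =
      emeasure M {\<omega> \<in> space M. z \<omega> \<in> A \<and> r \<omega> \<in> B}" if A[measurable]: "A \<in> sets N" and B[measurable]: "B \<in> sets borel" for A B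
  proof -
    \<comment> \<open>With \<open>A\<close> fixed, both sides are finite measures on the line as
      functions of \<open>B\<close>, and such measures are determined by their values on the
      half-lines above \<open>c\<close>.\<close>
    let ?m1 = "distr (density (distr M N z \<Otimes>\<^sub>M Q) (\<lambda>x. indicator A (fst x))) borel \<eta>"
    let ?m2 = "distr (density M (\<lambda>\<omega>. indicator A (z \<omega>))) borel r"
    have m1: "emeasure ?m1 B = emeasure (distr M N z \<Otimes>\<^sub>M Q) {x\<in>space (N \<Otimes>\<^sub>M borel). fst x \<in> A \<and> \<eta> x \<in> B}"
      if [measurable]: "B \<in> sets borel" for B
    proof -
      have "emeasure ?m1 B = (\<integral>\<^sup>+x. indicator A (fst x) * indicator (\<eta> -` B \<inter> space (N \<Otimes>\<^sub>M borel)) x \<partial>(distr M N z \<Otimes>\<^sub>M Q))"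
        by (subst emeasure_distr) (auto simp: space_pair_measure emeasure_density intro!: nn_integral_cong)
      also have "\<dots> = (\<integral>\<^sup>+x. indicator {x\<in>space (N \<Otimes>\<^sub>M borel). fst x \<in> A \<and> \<eta> x \<in> B} x \<partial>(distr M N z \<Otimes>\<^sub>M Q))"
        by (intro nn_integral_cong) (auto simp: indicator_def)
      finally show ?thesis by simp
    qed
    have m2: "emeasure ?m2 B = emeasure M {\<omega> \<in> space M. z \<omega> \<in> A \<and> r \<omega> \<in> B}"
      if [measurable]: "B \<in> sets borel" for B
    proof -
      have "emeasure ?m2 B = (\<integral>\<^sup>+\<omega>. indicator A (z \<omega>) * indicator (r -` B \<inter> space M) \<omega> \<partial>M)"
        by (subst emeasure_distr) (auto simp: emeasure_density)
      also have "\<dots> = (\<integral>\<^sup>+\<omega>. indicator {\<omega> \<in> space M. z \<omega> \<in> A \<and> r \<omega> \<in> B} \<omega> \<partial>M)"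
        by (intro nn_integral_cong) (auto simp: indicator_def)
      finally show ?thesis by simp
    qed
    have "?m1 = ?m2"
    proof (rule measure_eqI_lessThan)
      fix c :: real
      show "emeasure ?m1 {c<..} < \<infinity>"
        using emeasure_finite by (subst m1) (auto simp: less_top[symmetric])
      show "emeasure ?m1 {c<..} = emeasure ?m2 {c<..}"
        using key[OF A, of c] by (simp add: m1 m2)
    qed auto
    then show ?thesis using m1[OF B] m2[OF B] by simp
  qed
  show ?thesis
  proof (rule that)
    let ?E = "{A \<times> B | A B. A \<in> sets N \<and> B \<in> sets (borel :: real measure)}"
    show "distr (distr M N z \<Otimes>\<^sub>M Q) (N \<Otimes>\<^sub>M borel) (\<lambda>(n, q). (n, \<eta> (n, q))) =
      distr M (N \<Otimes>\<^sub>M borel) (\<lambda>\<omega>. (z \<omega>, r \<omega>))" (is "?l = ?r")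
    proof (rule measure_eqI_generator_eq[where E="?E" and \<Omega>="space N \<times> UNIV" and A="\<lambda>_. space N \<times> UNIV"])
      show "Int_stable ?E" by (rule Int_stable_pair_measure_generator)
      show "?E \<subseteq> Pow (space N \<times> UNIV)" using sets.sets_into_space by fastforce
      show "sets ?l = sigma_sets (space N \<times> UNIV) ?E" "sets ?r = sigma_sets (space N \<times> UNIV) ?E"
        by (simp_all add: sets_pair_measure)
      show "range (\<lambda>_::nat. space N \<times> (UNIV :: real set)) \<subseteq> ?E"
        by (intro image_subsetI CollectI exI[of _ "space N"] exI[of _ UNIV]) auto
      have "prob_space ?l" by (rule prob_space_distr) measurable
      then interpret l: prob_space ?l .
      show "emeasure ?l (space N \<times> UNIV) \<noteq> \<infinity>" by simp
      fix D assume "D \<in> ?E"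
      then obtain A B where D: "D = A \<times> B" and A[measurable]: "A \<in> sets N" and B[measurable]: "B \<in> sets borel" by auto
      have "emeasure ?l D = emeasure (distr M N z \<Otimes>\<^sub>M Q) {x\<in>space (N \<Otimes>\<^sub>M borel). fst x \<in> A \<and> \<eta> x \<in> B}"
        unfolding D by (subst emeasure_distr) (auto simp: space_pair_measure intro!: arg_cong[where f="emeasure _"])
      also have "\<dots> = emeasure ?r D"
        unfolding rect[OF A B] D by (subst emeasure_distr) (auto intro!: arg_cong[where f="emeasure _"])
      finally show "emeasure ?l D = emeasure ?r D" .
    qed (auto)
  qed measurable
qed

section \<open>Calculus on linear subspaces\<close>

lemma subspace_orthonormal_expansion:
  fixes S :: "'a::euclidean_space set"
  assumes "subspace S"
  obtains B where "finite B" "B \<subseteq> S" "\<And>y. y \<in> S \<Longrightarrow> (\<Sum>b\<in>B. (y \<bullet> b) *\<^sub>R b) = y"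
proof -
  obtain B where B: "B \<subseteq> S" "pairwise orthogonal B" "\<And>x. x \<in> B \<Longrightarrow> norm x = 1" "independent B" "span B = S"
    using orthonormal_basis_subspace[OF assms] by metis
  show ?thesis
  proof (rule that[of B])
    show "finite B" using B(4) by (rule independent_imp_finite)
    show "(\<Sum>b\<in>B. (y \<bullet> b) *\<^sub>R b) = y" if "y \<in> S" for y
      using orthonormal_basis_expand[OF B(2,3) _ \<open>finite B\<close>, of y] B(5) that by simp
  qed (rule B(1))
qed

text \<open>A derivative within a subspace is pinned down only along lines that stay in the
  subspace. On such a line it becomes an ordinary two-sided derivative at 0, to which uniqueness
  applies.\<close>

lemma has_derivative_imp_directional:
  assumes g: "(g has_derivative g') (at x within S)" and S: "\<And>t. x + t *\<^sub>R h \<in> S"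
  shows "((\<lambda>t. g (x + t *\<^sub>R h)) has_vector_derivative g' h) (at 0)"
proof -
  have "((\<lambda>t. x + t *\<^sub>R h) has_derivative (\<lambda>t. t *\<^sub>R h)) (at 0)"
    by (auto intro!: derivative_eq_intros)
  moreover have "(g has_derivative g') (at (x + 0 *\<^sub>R h) within range (\<lambda>t. x + t *\<^sub>R h))"
    using has_derivative_subset[OF g, of "range (\<lambda>t. x + t *\<^sub>R h)"] S by (simp add: image_subset_iff)
  ultimately have "((\<lambda>t. g (x + t *\<^sub>R h)) has_derivative (\<lambda>t. g' (t *\<^sub>R h))) (at 0)"
    by (rule has_derivative_in_compose[where f="\<lambda>t. x + t *\<^sub>R h"])
  moreover have "g' (t *\<^sub>R h) = t *\<^sub>R g' h" for t
    using has_derivative_linear[OF g] by (rule linear_cmul)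
  ultimately show ?thesis by (simp add: has_vector_derivative_def)
qed

lemma has_derivative_subspace_unique:
  assumes "(g has_derivative g1) (at x within S)" "(g has_derivative g2) (at x within S)"
    and "subspace S" "x \<in> S" "h \<in> S"
  shows "g1 h = g2 h"
proof -
  have "x + t *\<^sub>R h \<in> S" for t using assms by (intro subspace_add subspace_scale)
  then show ?thesis
    using has_derivative_imp_directional[OF assms(1)] has_derivative_imp_directional[OF assms(2)]
      vector_derivative_unique_at by metis
qed

text \<open>Let \<open>z\<close> be the component of \<open>d\<close> orthogonal to
  \<open>S\<close>. Its inner product with the curve is constantly 0, so differentiation gives
  \<open>z \<bullet> d = 0\<close>, which is the squared norm of \<open>z\<close>.\<close>

lemma has_vector_derivative_in_closed_subspace:
  fixes g :: "real \<Rightarrow> 'b::euclidean_space"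
  assumes g: "(g has_vector_derivative d) (at x)" and S: "subspace S" and im: "\<And>t. g t \<in> S"
  shows "d \<in> S"
proof -
  obtain y z where y: "y \<in> S" and z: "\<And>s. s \<in> S \<Longrightarrow> orthogonal z s" and d: "d = y + z"
    using orthogonal_subspace_decomp_exists[of S d] S span_eq_iff[of S] by metis
  have "((\<lambda>t. z \<bullet> g t) has_vector_derivative z \<bullet> d) (at x)"
    by (rule bounded_linear.has_vector_derivative[OF bounded_linear_inner_right g])
  moreover have "(\<lambda>t. z \<bullet> g t) = (\<lambda>_. 0)" using z im by (auto simp: orthogonal_def)
  ultimately have "z \<bullet> d = 0"
    using vector_derivative_unique_at[of "\<lambda>_. 0" "z \<bullet> d" x 0] by auto
  then have "z = 0" using z[OF y] by (simp add: d inner_add_right orthogonal_def)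
  then show ?thesis using y d by simp
qed

text \<open>Uniqueness of the Riesz representative: two candidates differ by a vector of
  \<open>S\<close> that is orthogonal to \<open>S\<close>. Although
  \<open>frechet_derivative\<close> picks some derivative, on \<open>S\<close> it agrees with the
  given \<open>g'\<close>.\<close>

lemma adj_deriv_eqI:
  assumes g: "(g has_derivative g') (at x within S)" and S: "subspace S" and x: "x \<in> S"
    and d: "d \<in> S" "\<And>h. h \<in> S \<Longrightarrow> d \<bullet> h = y \<bullet> g' h"
  shows "adj_deriv S g x y = d"
  unfolding adj_deriv_def
proof (rule the_equality)
  have fd: "frechet_derivative g (at x within S) h = g' h" if "h \<in> S" for h
  proof -
    have "g differentiable (at x within S)" using g unfolding differentiable_def by blast
    then have "(g has_derivative frechet_derivative g (at x within S)) (at x within S)"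
      by (simp only: frechet_derivative_works)
    from has_derivative_subspace_unique[OF this g S x that] show ?thesis .
  qed
  then show "d \<in> S \<and> (\<forall>h\<in>S. d \<bullet> h = y \<bullet> frechet_derivative g (at x within S) h)"
    using d by simp
  fix d' assume d': "d' \<in> S \<and> (\<forall>h\<in>S. d' \<bullet> h = y \<bullet> frechet_derivative g (at x within S) h)"
  then have "d' - d \<in> S" using d S by (auto intro: subspace_diff)
  then have "(d' - d) \<bullet> (d' - d) = 0" using d' d fd by (simp add: inner_diff_left)
  then show "d' = d" by simp
qed

text \<open>Riesz representation within \<open>S\<close>: in an orthonormal basis of
  \<open>S\<close> the coefficients of the representing vector are the values of the functional on
  that basis.\<close>

lemma adj_deriv_works:
  assumes g: "(g has_derivative g') (at x within S)" and S: "subspace S" and x: "x \<in> S"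
  shows "adj_deriv S g x y \<in> S" "h \<in> S \<Longrightarrow> adj_deriv S g x y \<bullet> h = y \<bullet> g' h"
proof -
  obtain B where B: "finite B" "B \<subseteq> S" "\<And>y. y \<in> S \<Longrightarrow> (\<Sum>b\<in>B. (y \<bullet> b) *\<^sub>R b) = y"
    using subspace_orthonormal_expansion[OF S] by blast
  define d where "d = (\<Sum>b\<in>B. (y \<bullet> g' b) *\<^sub>R b)"
  have dS: "d \<in> S" unfolding d_def using B(2) S by (intro subspace_sum subspace_scale) auto
  have dh: "d \<bullet> h = y \<bullet> g' h" if "h \<in> S" for h
  proof -
    have "g' h = (\<Sum>b\<in>B. (h \<bullet> b) *\<^sub>R g' b)"
      using has_derivative_linear[OF g] by (subst B(3)[OF that, symmetric]) (simp add: linear_sum linear_cmul)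
    then show ?thesis by (simp add: d_def inner_sum_left inner_sum_right inner_commute mult.commute)
  qed
  have "adj_deriv S g x y = d" by (rule adj_deriv_eqI[OF g S x dS dh])
  then show "adj_deriv S g x y \<in> S" "h \<in> S \<Longrightarrow> adj_deriv S g x y \<bullet> h = y \<bullet> g' h" using dS dh by auto
qed

lemma adj_deriv_linear:
  assumes g: "(g has_derivative g') (at x within S)" and S: "subspace S" and x: "x \<in> S"
  shows "adj_deriv S g x (\<Sum>b\<in>B. c b *\<^sub>R b) = (\<Sum>b\<in>B. c b *\<^sub>R adj_deriv S g x b)"
  by (rule adj_deriv_eqI[OF g S x])
     (auto intro!: subspace_sum[OF S] subspace_scale[OF S] adj_deriv_works[OF g S x]
       simp: inner_sum_left adj_deriv_works(2)[OF g S x])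

section \<open>Closure properties of continuously differentiable maps\<close>

lemma C1_on_derivative:
  assumes "C1_on S g" "p \<in> S"
  obtains g' where "(g has_derivative g') (at p within S)"
proof -
  from assms(1) obtain G :: "'a \<Rightarrow> 'a \<Rightarrow>\<^sub>L 'b" where "\<forall>p\<in>S. (g has_derivative blinfun_apply (G p)) (at p within S)"
    unfolding C1_on_def by (elim exE conjE)
  then show ?thesis using that assms(2) by (metis bspec)
qed

lemma C1_on_differentiable: "C1_on S g \<Longrightarrow> p \<in> S \<Longrightarrow> \<exists>g'. (g has_derivative g') (at p within S)"
  by (rule C1_on_derivative[of S g p]) (auto intro: exI)

lemma C1_on_const: "C1_on S (\<lambda>_. c)"
  unfolding C1_on_def by (rule exI[of _ "\<lambda>_. 0"]) (simp add: zero_blinfun.rep_eq)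

lemma C1_on_id: "C1_on S (\<lambda>p. p)"
  unfolding C1_on_def by (intro exI[of _ "\<lambda>_. id_blinfun"]) simp

lemma C1_on_add:
  assumes "C1_on S g" "C1_on S h" shows "C1_on S (\<lambda>p. g p + h p)"
proof -
  from assms(1) obtain g' where g: "\<And>p. p \<in> S \<Longrightarrow> (g has_derivative blinfun_apply (g' p)) (at p within S)" "continuous_on S g'"
    unfolding C1_on_def by blast
  from assms(2) obtain h' where h: "\<And>p. p \<in> S \<Longrightarrow> (h has_derivative blinfun_apply (h' p)) (at p within S)" "continuous_on S h'"
    unfolding C1_on_def by blast
  have "((\<lambda>p. g p + h p) has_derivative blinfun_apply (g' p + h' p)) (at p within S)" if "p \<in> S" for p
    using has_derivative_add[OF g(1)[OF that] h(1)[OF that]] by (simp add: plus_blinfun.rep_eq)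
  moreover have "continuous_on S (\<lambda>p. g' p + h' p)" by (intro continuous_on_add g(2) h(2))
  ultimately show ?thesis
    unfolding C1_on_def by (intro exI[of _ "\<lambda>p. g' p + h' p"]) simp
qed

lemma C1_on_sum:
  assumes "\<And>i. i \<in> I \<Longrightarrow> C1_on S (g i)" shows "C1_on S (\<lambda>p. \<Sum>i\<in>I. g i p)"
  using assms
proof (induction I rule: infinite_finite_induct)
  case (insert i I)
  then have "C1_on S (\<lambda>p. g i p + (\<Sum>i\<in>I. g i p))" by (intro C1_on_add) simp_all
  then show ?case using insert by simp
qed (simp_all add: C1_on_const)

lemma C1_on_Pair:
  assumes "C1_on S g" "C1_on S h" shows "C1_on S (\<lambda>p. (g p, h p))"
proof -
  from assms(1) obtain g' where g: "\<And>p. p \<in> S \<Longrightarrow> (g has_derivative blinfun_apply (g' p)) (at p within S)" "continuous_on S g'"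
    unfolding C1_on_def by blast
  from assms(2) obtain h' where h: "\<And>p. p \<in> S \<Longrightarrow> (h has_derivative blinfun_apply (h' p)) (at p within S)" "continuous_on S h'"
    unfolding C1_on_def by blast
  \<comment> \<open>With these fixed injections the derivative of the pair is a sum of compositions
    with constant operators, so its continuity in operator norm follows from that of the two given
    derivatives.\<close>
  define inl :: "'b \<Rightarrow>\<^sub>L ('b \<times> 'c)" where "inl = Blinfun (\<lambda>x. (x, 0))"
  define inr :: "'c \<Rightarrow>\<^sub>L ('b \<times> 'c)" where "inr = Blinfun (\<lambda>x. (0, x))"
  have [simp]: "blinfun_apply inl = (\<lambda>x. (x, 0))"
    unfolding inl_def
    by (intro bounded_linear_Blinfun_apply bounded_linear_Pair bounded_linear_ident bounded_linear_zero)
  have [simp]: "blinfun_apply inr = (\<lambda>x. (0, x))"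
    unfolding inr_def
    by (intro bounded_linear_Blinfun_apply bounded_linear_Pair bounded_linear_ident bounded_linear_zero)
  have "continuous_on S (\<lambda>p. (inl o\<^sub>L g' p) + (inr o\<^sub>L h' p))"
    using g(2) h(2)
    by (intro continuous_on_add bounded_bilinear.continuous_on[OF bounded_bilinear_blinfun_compose] continuous_on_const)
  moreover have "((\<lambda>p. (g p, h p)) has_derivative blinfun_apply ((inl o\<^sub>L g' p) + (inr o\<^sub>L h' p))) (at p within S)" if "p \<in> S" for p
    using has_derivative_Pair[OF g(1)[OF that] h(1)[OF that]] by (simp add: plus_blinfun.rep_eq)
  ultimately show ?thesis
    unfolding C1_on_def by (intro exI[of _ "\<lambda>p. (inl o\<^sub>L g' p) + (inr o\<^sub>L h' p)"]) blast
qed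

lemma C1_on_compose:
  assumes "C1_on S g" "C1_on R h" and im: "\<And>p. p \<in> S \<Longrightarrow> g p \<in> R"
  shows "C1_on S (\<lambda>p. h (g p))"
proof -
  from assms(1) obtain g' where g: "\<And>p. p \<in> S \<Longrightarrow> (g has_derivative blinfun_apply (g' p)) (at p within S)" "continuous_on S g'"
    unfolding C1_on_def by blast
  from assms(2) obtain h' where h: "\<And>p. p \<in> R \<Longrightarrow> (h has_derivative blinfun_apply (h' p)) (at p within R)" "continuous_on R h'"
    unfolding C1_on_def by blast
  have "continuous_on S g"
    using g(1) by (auto simp: continuous_on_eq_continuous_within intro: has_derivative_continuous)
  then have "continuous_on S (\<lambda>p. h' (g p))"
    using im by (intro continuous_on_compose2[OF h(2)]) auto
  then have "continuous_on S (\<lambda>p. h' (g p) o\<^sub>L g' p)"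
    using g(2) by (intro bounded_bilinear.continuous_on[OF bounded_bilinear_blinfun_compose])
  moreover have "((\<lambda>p. h (g p)) has_derivative blinfun_apply (h' (g p) o\<^sub>L g' p)) (at p within S)" if "p \<in> S" for p
    using has_derivative_in_compose[OF g(1)[OF that] has_derivative_subset[OF h(1)]] im that
    by (simp add: image_subset_iff blinfun_compose.rep_eq comp_def)
  ultimately show ?thesis
    unfolding C1_on_def by (intro exI[of _ "\<lambda>p. h' (g p) o\<^sub>L g' p"]) blast
qed

lemma has_vector_derivative_compose_within:
  assumes F: "(F has_derivative F') (at (p 0) within R)" and p: "(p has_vector_derivative \<pi>) (at 0)"
    and im: "\<And>t. p t \<in> R"
  shows "((\<lambda>t. F (p t)) has_vector_derivative F' \<pi>) (at (0::real))"
proof -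
  have "((\<lambda>t. F (p t)) has_derivative (\<lambda>t. F' (t *\<^sub>R \<pi>))) (at 0)"
  proof (rule has_derivative_in_compose[where f=p])
    show "(p has_derivative (\<lambda>t. t *\<^sub>R \<pi>)) (at 0)" using p by (simp add: has_vector_derivative_def)
    show "(F has_derivative F') (at (p 0) within range p)"
      by (rule has_derivative_subset[OF F]) (use im in auto)
  qed
  moreover have "F' (t *\<^sub>R \<pi>) = t *\<^sub>R F' \<pi>" for t
    using has_derivative_linear[OF F] by (rule linear_cmul)
  ultimately show ?thesis by (simp add: has_vector_derivative_def)
qed

section \<open>The deterministic problem and its co-state\<close>

lemma sum_lessThan_add:
  fixes g :: "nat \<Rightarrow> 'b::comm_monoid_add"
  shows "(\<Sum>s<t + d. g s) = (\<Sum>s<t. g s) + (\<Sum>k<d. g (t + k))"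
  by (induction d) (simp_all add: add.assoc)

text \<open>Restarting from an arbitrary state separates past and future: the past enters the tail
  cost through \<open>a\<close> alone. The step counter is relative to \<open>t\<close>, while
  controls and noise keep their absolute time.\<close>

primrec state_from :: "(nat \<Rightarrow> 'e \<Rightarrow> 'u \<Rightarrow> 'e \<Rightarrow> 'e) \<Rightarrow> nat \<Rightarrow> 'e \<Rightarrow> (nat \<Rightarrow> 'u) \<Rightarrow> (nat \<Rightarrow> 'e) \<Rightarrow> nat \<Rightarrow> 'e" where
  "state_from f t a u w 0 = a"
| "state_from f t a u w (Suc k) = f (t + k) (state_from f t a u w k) (u (t + k)) (w (Suc (t + k)))"

definition cost_from where
  "cost_from T f L K t a u w =
    (\<Sum>k<T - t. L (t + k) (state_from f t a u w k) (u (t + k)) (w (Suc (t + k)))) + K (state_from f t a u w (T - t))"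

lemma traj_add: "traj f u w (t + k) = state_from f t (traj f u w t) u w k"
  by (induction k) simp_all

lemma total_cost_split:
  assumes "t \<le> T"
  shows "total_cost T f L K u w =
    (\<Sum>s<t. L s (traj f u w s) (u s) (w (Suc s))) + cost_from T f L K t (traj f u w t) u w"
proof -
  have T: "T = t + (T - t)" using assms by simp
  have "total_cost T f L K u w = (\<Sum>s<t + (T - t). L s (traj f u w s) (u s) (w (Suc s))) + K (traj f u w (t + (T - t)))"
    using T by (simp add: total_cost_def)
  then show ?thesis unfolding sum_lessThan_add traj_add cost_from_def by simp
qed

lemma cost_from_cong:
  assumes "\<And>s. t \<le> s \<Longrightarrow> s < T \<Longrightarrow> u s = u' s" "\<And>s. t < s \<Longrightarrow> s \<le> T \<Longrightarrow> w s = w' s" and t: "t \<le> T"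
  shows "cost_from T f L K t a u w = cost_from T f L K t a u' w'"
proof -
  have "t + k \<le> T \<Longrightarrow> state_from f t a u w k = state_from f t a u' w' k" for k
    by (induction k) (simp_all add: assms)
  then show ?thesis using assms by (simp add: cost_from_def)
qed

lemma traj_cong: "(\<And>s. s < t \<Longrightarrow> u s = u' s) \<Longrightarrow> traj f u w t = traj f u' w t"
  by (induction t) simp_all

text \<open>The pathwise problem: the noise is a fixed parameter here, so all that follows in this
  locale is deterministic calculus.\<close>

locale control_problem =
  fixes T :: nat and X W :: "nat \<Rightarrow> 'e::euclidean_space set" and U :: "nat \<Rightarrow> 'u::euclidean_space set"
    and f :: "nat \<Rightarrow> 'e \<Rightarrow> 'u \<Rightarrow> 'e \<Rightarrow> 'e" and L :: "nat \<Rightarrow> 'e \<Rightarrow> 'u \<Rightarrow> 'e \<Rightarrow> real" and K :: "'e \<Rightarrow> real"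
  assumes subspace_X: "t \<le> T \<Longrightarrow> subspace (X t)" and subspace_U: "t < T \<Longrightarrow> subspace (U t)"
    and W_0: "W 0 = X 0"
    and f_in: "t < T \<Longrightarrow> a \<in> X t \<Longrightarrow> v \<in> U t \<Longrightarrow> b \<in> W (Suc t) \<Longrightarrow> f t a v b \<in> X (Suc t)"
    and f_C1: "t < T \<Longrightarrow> b \<in> W (Suc t) \<Longrightarrow> C1_on (X t \<times> U t) (\<lambda>(a, v). f t a v b)"
    and L_C1: "t < T \<Longrightarrow> b \<in> W (Suc t) \<Longrightarrow> C1_on (X t \<times> U t) (\<lambda>(a, v). L t a v b)"
    and K_C1: "C1_on (X T) K"
begin

lemma traj_in:
  assumes "\<And>s. s < T \<Longrightarrow> u s \<in> U s" "\<And>s. s \<le> T \<Longrightarrow> w s \<in> W s"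
  shows "t \<le> T \<Longrightarrow> traj f u w t \<in> X t"
  using assms W_0 by (induction t) (auto intro!: f_in)

lemma partial_derivatives:
  fixes g :: "'e \<Rightarrow> 'u \<Rightarrow> 'b::euclidean_space"
  assumes t: "t < T" and g: "((\<lambda>(a, v). g a v) has_derivative g') (at (a, v) within X t \<times> U t)"
    and a: "a \<in> X t" and v: "v \<in> U t"
  shows "((\<lambda>a. g a v) has_derivative (\<lambda>h. g' (h, 0))) (at a within X t)"
    "((\<lambda>v. g a v) has_derivative (\<lambda>k. g' (0, k))) (at v within U t)"
proof -
  have 1: "((\<lambda>a. (a, v)) has_derivative (\<lambda>h. (h, 0))) (at a within X t)"
    by (auto intro!: derivative_eq_intros)
  show "((\<lambda>a. g a v) has_derivative (\<lambda>h. g' (h, 0))) (at a within X t)"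
    using has_derivative_in_compose[OF 1 has_derivative_subset[OF g, of "(\<lambda>a. (a, v)) ` X t"]] v
    by (simp add: image_subset_iff)
  have 2: "((\<lambda>v. (a, v)) has_derivative (\<lambda>h. (0, h))) (at v within U t)"
    by (auto intro!: derivative_eq_intros)
  show "((\<lambda>v. g a v) has_derivative (\<lambda>k. g' (0, k))) (at v within U t)"
    using has_derivative_in_compose[OF 2 has_derivative_subset[OF g, of "(\<lambda>v. (a, v)) ` U t"]] a
    by (simp add: image_subset_iff)
qed

lemma L_derivative:
  assumes t: "t < T" and a: "a \<in> X t" and v: "v \<in> U t" and b: "b \<in> W (Suc t)"
  obtains L' where "((\<lambda>(a, v). L t a v b) has_derivative L') (at (a, v) within X t \<times> U t)"
    "dLx X L t a v b \<in> X t" "dLu U L t a v b \<in> U t"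
    "\<forall>h\<in>X t. \<forall>k\<in>U t. L' (h, k) = dLx X L t a v b \<bullet> h + dLu U L t a v b \<bullet> k"
proof -
  obtain L' where L': "((\<lambda>(a, v). L t a v b) has_derivative L') (at (a, v) within X t \<times> U t)"
    using C1_on_derivative[OF L_C1[OF t b], of "(a, v)"] a v by auto
  have sX: "subspace (X t)" and sU: "subspace (U t)" using t subspace_X subspace_U by auto
  note px = partial_derivatives(1)[OF t L' a v] and pu = partial_derivatives(2)[OF t L' a v]
  show ?thesis
  proof (rule that[OF L'])
    show "dLx X L t a v b \<in> X t" "dLu U L t a v b \<in> U t"
      unfolding dLx_def dLu_def grad_on_def
      using adj_deriv_works(1)[OF px sX a] adj_deriv_works(1)[OF pu sU v] by auto
    have "L' (h, k) = dLx X L t a v b \<bullet> h + dLu U L t a v b \<bullet> k" if "h \<in> X t" "k \<in> U t" for h k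
      unfolding dLx_def dLu_def grad_on_def
      using adj_deriv_works(2)[OF px sX a, of h 1] adj_deriv_works(2)[OF pu sU v, of k 1] that
        linear_add[OF has_derivative_linear[OF L'], of "(h, 0)" "(0, k)"] by simp
    then show "\<forall>h\<in>X t. \<forall>k\<in>U t. L' (h, k) = dLx X L t a v b \<bullet> h + dLu U L t a v b \<bullet> k" by blast
  qed
qed

lemma f_derivative:
  assumes t: "t < T" and a: "a \<in> X t" and v: "v \<in> U t" and b: "b \<in> W (Suc t)"
  obtains f' where "((\<lambda>(a, v). f t a v b) has_derivative f') (at (a, v) within X t \<times> U t)"
    "\<forall>y. dfx X f t a v b y \<in> X t" "\<forall>y. dfu U f t a v b y \<in> U t"
    "\<forall>y. \<forall>h\<in>X t. \<forall>k\<in>U t. y \<bullet> f' (h, k) = dfx X f t a v b y \<bullet> h + dfu U f t a v b y \<bullet> k"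
proof -
  obtain f' where f': "((\<lambda>(a, v). f t a v b) has_derivative f') (at (a, v) within X t \<times> U t)"
    using C1_on_derivative[OF f_C1[OF t b], of "(a, v)"] a v by auto
  have sX: "subspace (X t)" and sU: "subspace (U t)" using t subspace_X subspace_U by auto
  note px = partial_derivatives(1)[OF t f' a v] and pu = partial_derivatives(2)[OF t f' a v]
  show ?thesis
  proof (rule that[OF f'])
    show "\<forall>y. dfx X f t a v b y \<in> X t" "\<forall>y. dfu U f t a v b y \<in> U t"
      unfolding dfx_def dfu_def
      using adj_deriv_works(1)[OF px sX a] adj_deriv_works(1)[OF pu sU v] by auto
    have "y \<bullet> f' (h, k) = dfx X f t a v b y \<bullet> h + dfu U f t a v b y \<bullet> k" if "h \<in> X t" "k \<in> U t" for y h k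
      unfolding dfx_def dfu_def
      using adj_deriv_works(2)[OF px sX a, of h y] adj_deriv_works(2)[OF pu sU v, of k y] that
        linear_add[OF has_derivative_linear[OF f'], of "(h, 0)" "(0, k)"] by (simp add: inner_add_right)
    then show "\<forall>y. \<forall>h\<in>X t. \<forall>k\<in>U t. y \<bullet> f' (h, k) = dfx X f t a v b y \<bullet> h + dfu U f t a v b y \<bullet> k"
      by blast
  qed
qed

text \<open>Measurability and square integrability of the Jacobians are at hand for products with
  fixed vectors. Expanding a random co-state along a fixed basis reduces products with it to
  those.\<close>

lemma df_linear:
  assumes t: "t < T" and a: "a \<in> X t" and v: "v \<in> U t" and b: "b \<in> W (Suc t)"
  shows "dfx X f t a v b (\<Sum>i\<in>B. c i *\<^sub>R i) = (\<Sum>i\<in>B. c i *\<^sub>R dfx X f t a v b i)"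
    "dfu U f t a v b (\<Sum>i\<in>B. c i *\<^sub>R i) = (\<Sum>i\<in>B. c i *\<^sub>R dfu U f t a v b i)"
proof -
  obtain f' where f': "((\<lambda>(a, v). f t a v b) has_derivative f') (at (a, v) within X t \<times> U t)"
    using C1_on_derivative[OF f_C1[OF t b], of "(a, v)"] a v by auto
  have sX: "subspace (X t)" and sU: "subspace (U t)" using t subspace_X subspace_U by auto
  show "dfx X f t a v b (\<Sum>i\<in>B. c i *\<^sub>R i) = (\<Sum>i\<in>B. c i *\<^sub>R dfx X f t a v b i)"
    unfolding dfx_def by (rule adj_deriv_linear[OF partial_derivatives(1)[OF t f' a v] sX a])
  show "dfu U f t a v b (\<Sum>i\<in>B. c i *\<^sub>R i) = (\<Sum>i\<in>B. c i *\<^sub>R dfu U f t a v b i)"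
    unfolding dfu_def by (rule adj_deriv_linear[OF partial_derivatives(2)[OF t f' a v] sU v])
qed

lemma K_derivative:
  assumes "a \<in> X T"
  obtains K' where "(K has_derivative K') (at a within X T)" "grad_on (X T) K a \<in> X T"
    "\<forall>h\<in>X T. K' h = grad_on (X T) K a \<bullet> h"
proof -
  obtain K' where K': "(K has_derivative K') (at a within X T)"
    by (rule C1_on_derivative[OF K_C1 assms])
  show ?thesis
    using that[OF K'] adj_deriv_works[OF K' subspace_X[OF order_refl] assms, where y=1]
    by (auto simp: grad_on_def)
qed

lemma C1_on_traj:
  assumes u: "\<And>s. s < T \<Longrightarrow> u s \<in> U s" and w: "\<And>s. s \<le> T \<Longrightarrow> w s \<in> W s" and t: "t < T"
  shows "s \<le> T \<Longrightarrow> C1_on (U t) (\<lambda>v. traj f (u(t := v)) w s)"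
proof (induction s)
  case 0
  then show ?case by (simp add: C1_on_const)
next
  case (Suc s)
  have "C1_on (U t) (\<lambda>v. (u(t := v)) s)" by (cases "s = t") (simp_all add: C1_on_const C1_on_id)
  then have "C1_on (U t) (\<lambda>v. (traj f (u(t := v)) w s, (u(t := v)) s))"
    by (intro C1_on_Pair Suc.IH) (use Suc.prems in \<open>simp_all del: fun_upd_apply\<close>)
  then have "C1_on (U t) (\<lambda>v. (\<lambda>(a, v). f s a v (w (Suc s))) (traj f (u(t := v)) w s, (u(t := v)) s))"
  proof (rule C1_on_compose[OF _ f_C1])
    fix v assume "v \<in> U t"
    then have "\<And>s. s < T \<Longrightarrow> (u(t := v)) s \<in> U s" using u by simp
    then show "(traj f (u(t := v)) w s, (u(t := v)) s) \<in> X s \<times> U s"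
      using traj_in[of "u(t := v)" w s] w Suc(2) by simp
  qed (use Suc(2) w in auto)
  then show ?case by (simp del: fun_upd_apply)
qed

lemma C1_on_total_cost:
  assumes u: "\<And>s. s < T \<Longrightarrow> u s \<in> U s" and w: "\<And>s. s \<le> T \<Longrightarrow> w s \<in> W s" and t: "t < T"
  shows "C1_on (U t) (\<lambda>v. total_cost T f L K (u(t := v)) w)"
proof -
  have im: "(traj f (u(t := v)) w s, (u(t := v)) s) \<in> X s \<times> U s" if "v \<in> U t" "s < T" for v s
    using traj_in[of "u(t := v)" w s] w u that by simp
  have "C1_on (U t) (\<lambda>v. L s (traj f (u(t := v)) w s) ((u(t := v)) s) (w (Suc s)))" if s: "s < T" for s
  proof -
    have "C1_on (U t) (\<lambda>v. (u(t := v)) s)" by (cases "s = t") (simp_all add: C1_on_const C1_on_id)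
    then have "C1_on (U t) (\<lambda>v. (traj f (u(t := v)) w s, (u(t := v)) s))"
      using s by (intro C1_on_Pair C1_on_traj[OF u w t]) (simp_all del: fun_upd_apply)
    then have "C1_on (U t) (\<lambda>v. (\<lambda>(a, v). L s a v (w (Suc s))) (traj f (u(t := v)) w s, (u(t := v)) s))"
      by (rule C1_on_compose[OF _ L_C1]) (use im s w in auto)
    then show ?thesis by (simp del: fun_upd_apply)
  qed
  moreover have "C1_on (U t) (\<lambda>v. K (traj f (u(t := v)) w T))"
  proof (rule C1_on_compose[OF C1_on_traj K_C1])
    show "traj f (u(t := v)) w T \<in> X T" if "v \<in> U t" for v
      using u w that by (intro traj_in) auto
  qed (use u w t in auto)
  ultimately show ?thesis
    unfolding total_cost_def by (intro C1_on_add C1_on_sum) auto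
qed

lemma traj_fun_upd: "s \<le> t \<Longrightarrow> traj f (u(t := v)) w s = traj f u w s"
  by (induction s) auto

text \<open>The adjoint method. The perturbed trajectory has a sensitivity \<open>\<xi>\<close>, and
  its pairing with the co-state is the derivative of the remaining cost, by induction backwards in
  time. At \<open>t\<close> itself the sensitivity vanishes and only the direct effect of
  \<open>h\<close> is left.\<close>

lemma total_cost_directional:
  assumes u: "\<And>s. s < T \<Longrightarrow> u s \<in> U s" and w: "\<And>s. s \<le> T \<Longrightarrow> w s \<in> W s" and t: "t < T" and h: "h \<in> U t"
  shows "((\<lambda>\<sigma>. total_cost T f L K (u(t := u t + \<sigma> *\<^sub>R h)) w) has_vector_derivative
    (dLu U L t (traj f u w t) (u t) (w (Suc t)) +
     dfu U f t (traj f u w t) (u t) (w (Suc t)) (costate T X f L K u w (Suc t))) \<bullet> h) (at 0)"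
proof -
  define up where "up \<sigma> = u(t := u t + \<sigma> *\<^sub>R h)" for \<sigma>
  define p where "p s \<sigma> = traj f (up \<sigma>) w s" for s \<sigma>
  have seg: "u t + \<sigma> *\<^sub>R h \<in> U t" for \<sigma>
    using subspace_U[OF t] u[OF t] h by (intro subspace_add subspace_scale)
  have up_in: "up \<sigma> s \<in> U s" if "s < T" for s \<sigma> using that seg u by (auto simp: up_def)
  have up0: "up 0 = u" by (simp add: up_def)
  have p_in: "p s \<sigma> \<in> X s" if "s \<le> T" for s \<sigma>
    unfolding p_def using up_in w that by (intro traj_in)
  have p0: "p s 0 = traj f u w s" for s by (simp add: p_def up0)
  \<comment> \<open>Membership in \<open>X s\<close> matters because a transposed derivative
    represents the derivative on the subspace only.\<close>
  have "\<exists>\<xi>. (p s has_vector_derivative \<xi>) (at 0) \<and> \<xi> \<in> X s" if s: "s \<le> T" for s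
  proof -
    obtain D where "((\<lambda>v. traj f (u(t := v)) w s) has_derivative D) (at (u t) within U t)"
      by (rule C1_on_derivative[OF C1_on_traj[OF u w t s] u[OF t]])
    from has_derivative_imp_directional[OF this seg] have "(p s has_vector_derivative D h) (at 0)"
      by (simp add: p_def[abs_def] up_def)
    with has_vector_derivative_in_closed_subspace[OF this subspace_X[OF s] p_in[OF s]] show ?thesis by blast
  qed
  then obtain \<xi> where \<xi>: "\<And>s. s \<le> T \<Longrightarrow> (p s has_vector_derivative \<xi> s) (at 0)" "\<And>s. s \<le> T \<Longrightarrow> \<xi> s \<in> X s"
    by metis
  have p_const: "p s \<sigma> = traj f u w s" if "s \<le> t" for s \<sigma>
    using that by (simp add: p_def up_def traj_fun_upd)
  \<comment> \<open>The state at \<open>t\<close> is determined by the controls before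
    \<open>t\<close>, none of which moves.\<close>
  have \<xi>t: "\<xi> t = 0"
  proof (rule vector_derivative_unique_at)
    show "(p t has_vector_derivative \<xi> t) (at 0)" using \<xi> t by simp
    show "(p t has_vector_derivative 0) (at 0)" 
    proof -
      have "p t = (\<lambda>_. traj f u w t)" using p_const[OF order_refl] by (rule ext)
      then show ?thesis by simp
    qed
  qed
  define k where "k s = (if s = t then h else 0)" for s
  have upder: "((\<lambda>\<sigma>. up \<sigma> s) has_vector_derivative k s) (at 0)" for s
    by (auto simp: up_def k_def intro!: derivative_eq_intros)
  have k_in: "k s \<in> U s" if "s < T" for s
    using h subspace_0[OF subspace_U[OF that]] by (auto simp: k_def)
  have pair: "((\<lambda>\<sigma>. (p s \<sigma>, up \<sigma> s)) has_vector_derivative (\<xi> s, k s)) (at 0)" if "s < T" for s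
    using \<xi>(1)[of s] upder that by (intro has_vector_derivative_Pair) auto
  have im: "(p s \<sigma>, up \<sigma> s) \<in> X s \<times> U s" if "s < T" for s \<sigma>
    using p_in[of s] up_in that by auto
  let ?cs = "costate T X f L K u w"
  define C where "C s \<sigma> = (\<Sum>r\<in>{s..<T}. L r (p r \<sigma>) (up \<sigma> r) (w (Suc r))) + K (p T \<sigma>)" for s \<sigma>
  \<comment> \<open>One step of the adjoint recursion, in a form that covers both the perturbed time
    \<open>t\<close>, where \<open>\<xi> t = 0\<close> and \<open>k t = h\<close>, and the later
    times, where \<open>k s = 0\<close>.\<close>
  have step1: "(C s has_vector_derivative
       (dLx X L s (traj f u w s) (u s) (w (Suc s)) + dfx X f s (traj f u w s) (u s) (w (Suc s)) (?cs (Suc s))) \<bullet> \<xi> s +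
       (dLu U L s (traj f u w s) (u s) (w (Suc s)) + dfu U f s (traj f u w s) (u s) (w (Suc s)) (?cs (Suc s))) \<bullet> k s) (at 0)"
    if s: "s < T" and IH: "(C (Suc s) has_vector_derivative ?cs (Suc s) \<bullet> \<xi> (Suc s)) (at 0)" for s
  proof -
    let ?a = "traj f u w s" and ?b = "w (Suc s)"
    have a: "?a \<in> X s" and b: "?b \<in> W (Suc s)" using traj_in[OF u w, of s] w s by auto
    obtain L' where L': "((\<lambda>(a, v). L s a v ?b) has_derivative L') (at (?a, u s) within X s \<times> U s)"
      "dLx X L s ?a (u s) ?b \<in> X s" "dLu U L s ?a (u s) ?b \<in> U s"
      "\<forall>h\<in>X s. \<forall>k\<in>U s. L' (h, k) = dLx X L s ?a (u s) ?b \<bullet> h + dLu U L s ?a (u s) ?b \<bullet> k"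
      by (rule L_derivative[OF s a u[OF s] b], rule that)
    obtain f' where f': "((\<lambda>(a, v). f s a v ?b) has_derivative f') (at (?a, u s) within X s \<times> U s)"
      "\<forall>y. dfx X f s ?a (u s) ?b y \<in> X s" "\<forall>y. dfu U f s ?a (u s) ?b y \<in> U s"
      "\<forall>y. \<forall>h\<in>X s. \<forall>k\<in>U s. y \<bullet> f' (h, k) = dfx X f s ?a (u s) ?b y \<bullet> h + dfu U f s ?a (u s) ?b y \<bullet> k"
      by (rule f_derivative[OF s a u[OF s] b], rule that)
    have Lp: "((\<lambda>\<sigma>. L s (p s \<sigma>) (up \<sigma> s) ?b) has_vector_derivative L' (\<xi> s, k s)) (at 0)"
      using has_vector_derivative_compose_within[OF _ pair[OF s] im[OF s], of "\<lambda>(a, v). L s a v ?b" L'] L'(1)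
      by (simp add: p0 up0)
    have "((\<lambda>\<sigma>. f s (p s \<sigma>) (up \<sigma> s) ?b) has_vector_derivative f' (\<xi> s, k s)) (at 0)"
      using has_vector_derivative_compose_within[OF _ pair[OF s] im[OF s], of "\<lambda>(a, v). f s a v ?b" f'] f'(1)
      by (simp add: p0 up0)
    \<comment> \<open>The linearised dynamics: uniqueness of derivatives identifies the sensitivity
      that was obtained abstractly.\<close>
    then have "\<xi> (Suc s) = f' (\<xi> s, k s)"
      using vector_derivative_unique_at[OF \<xi>(1)[of "Suc s"]] s by (simp add: p_def[abs_def])
    moreover have "C s = (\<lambda>\<sigma>. L s (p s \<sigma>) (up \<sigma> s) ?b + C (Suc s) \<sigma>)"
      using s by (simp add: C_def fun_eq_iff sum.atLeast_Suc_lessThan)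
    ultimately show ?thesis
      using has_vector_derivative_add[OF Lp IH] L'(4) f'(4) \<xi>(2)[of s] k_in[OF s] s
      by (simp add: inner_add_left algebra_simps)
  qed
  \<comment> \<open>Strictly after \<open>t\<close> the controls are unperturbed, so the pairing
    with the co-state is the whole derivative. The induction stops there, and time \<open>t\<close>
    follows by one more use of \<open>step1\<close>.\<close>
  have C: "(C s has_vector_derivative ?cs s \<bullet> \<xi> s) (at 0)" if "t < s" "s \<le> T" for s
    using that(2,1)
  proof (induction s rule: inc_induct)
    case base
    have xT: "traj f u w T \<in> X T" using traj_in[OF u w order_refl] .
    obtain K' where K': "(K has_derivative K') (at (traj f u w T) within X T)"
      "grad_on (X T) K (traj f u w T) \<in> X T" "\<forall>h\<in>X T. K' h = grad_on (X T) K (traj f u w T) \<bullet> h"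
      by (rule K_derivative[OF xT], rule that)
    have "((\<lambda>\<sigma>. K (p T \<sigma>)) has_vector_derivative K' (\<xi> T)) (at 0)"
      using has_vector_derivative_compose_within[OF _ \<xi>(1)[OF order_refl] p_in[OF order_refl], of K K'] K'(1)
      by (simp add: p0)
    then show ?case using K'(3) \<xi>(2) by (simp add: C_def[abs_def] costate.simps)
  next
    case (step s)
    then show ?case
      using step1[of s] by (simp add: costate.simps[of _ _ _ _ _ _ _ s] k_def)
  qed
  have "(C t has_vector_derivative
     (dLu U L t (traj f u w t) (u t) (w (Suc t)) + dfu U f t (traj f u w t) (u t) (w (Suc t)) (?cs (Suc t))) \<bullet> h) (at 0)"
    using step1[OF t C] t by (simp add: \<xi>t k_def)
  moreover have "total_cost T f L K (up \<sigma>) w =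
      (\<Sum>s<t. L s (traj f u w s) (u s) (w (Suc s))) + C t \<sigma>" for \<sigma>
  proof -
    have "total_cost T f L K (up \<sigma>) w = (\<Sum>s<t. L s (p s \<sigma>) (up \<sigma> s) (w (Suc s))) + C t \<sigma>"
      using sum.atLeastLessThan_concat[of 0 t T "\<lambda>s. L s (p s \<sigma>) (up \<sigma> s) (w (Suc s))"] t
      by (simp add: total_cost_def C_def p_def atLeast0LessThan)
    moreover have "(\<Sum>s<t. L s (p s \<sigma>) (up \<sigma> s) (w (Suc s))) = (\<Sum>s<t. L s (traj f u w s) (u s) (w (Suc s)))"
      by (intro sum.cong) (auto simp: p_const up_def)
    ultimately show ?thesis by simp
  qed
  ultimately show ?thesis
    by (auto simp: up_def[symmetric] intro!: derivative_eq_intros)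
qed

lemma dju_works:
  assumes u: "\<And>s. s < T \<Longrightarrow> u s \<in> U s" and w: "\<And>s. s \<le> T \<Longrightarrow> w s \<in> W s" and t: "t < T"
    and D: "((\<lambda>v. total_cost T f L K (u(t := v)) w) has_derivative D) (at (u t) within U t)"
  shows "dju T U f L K u w t \<in> U t" "h \<in> U t \<Longrightarrow> dju T U f L K u w t \<bullet> h = D h"
  using adj_deriv_works[OF D subspace_U[OF t] u[OF t], where y=1] by (auto simp: dju_def grad_on_def)

text \<open>Both sides lie in \<open>U t\<close>, and a vector of \<open>U t\<close> is determined
  by its inner products with directions of \<open>U t\<close>, which are the directional derivatives
  of the cost.\<close>

lemma dju_eq:
  assumes u: "\<And>s. s < T \<Longrightarrow> u s \<in> U s" and w: "\<And>s. s \<le> T \<Longrightarrow> w s \<in> W s" and t: "t < T"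
  shows "dju T U f L K u w t =
    dLu U L t (traj f u w t) (u t) (w (Suc t)) +
    dfu U f t (traj f u w t) (u t) (w (Suc t)) (costate T X f L K u w (Suc t))" (is "_ = ?r")
proof -
  obtain D where D: "((\<lambda>v. total_cost T f L K (u(t := v)) w) has_derivative D) (at (u t) within U t)"
    by (rule C1_on_derivative[OF C1_on_total_cost[OF u w t] u[OF t]])
  have a: "traj f u w t \<in> X t" and b: "w (Suc t) \<in> W (Suc t)" using traj_in[OF u w, of t] w t by auto
  have "dLu U L t (traj f u w t) (u t) (w (Suc t)) \<in> U t"
    by (rule L_derivative[OF t a u[OF t] b])
  moreover have "dfu U f t (traj f u w t) (u t) (w (Suc t)) y \<in> U t" for y
    by (rule f_derivative[OF t a u[OF t] b]) blast
  ultimately have r: "?r \<in> U t" by (intro subspace_add subspace_U[OF t])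
  have "?r \<bullet> h = D h" if "h \<in> U t" for h
  proof (rule vector_derivative_unique_at[OF total_cost_directional[OF u w t that]])
    show "((\<lambda>\<sigma>. total_cost T f L K (u(t := u t + \<sigma> *\<^sub>R h)) w) has_vector_derivative D h) (at 0)"
      using subspace_U[OF t] u[OF t] that
      by (intro has_derivative_imp_directional[OF D] subspace_add subspace_scale)
  qed
  then show ?thesis
    unfolding dju_def grad_on_def
    by (intro adj_deriv_eqI[OF D subspace_U[OF t] u[OF t] r]) simp
qed

text \<open>The derivative is needed along the whole segment and not just at its start: the mean
  value theorem evaluates it at intermediate points, and continuity lets rational points control its
  supremum.\<close>

lemma total_cost_path:
  assumes u: "\<And>s. s < T \<Longrightarrow> u s \<in> U s" and w: "\<And>s. s \<le> T \<Longrightarrow> w s \<in> W s" and t: "t < T" and h: "h \<in> U t"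
  defines "g' \<equiv> \<lambda>\<sigma>. dju T U f L K (u(t := u t + \<sigma> *\<^sub>R h)) w t \<bullet> h"
  shows "((\<lambda>\<sigma>. total_cost T f L K (u(t := u t + \<sigma> *\<^sub>R h)) w) has_real_derivative g' \<sigma>) (at \<sigma>)"
    and "continuous_on UNIV g'"
proof -
  obtain G :: "'u \<Rightarrow> 'u \<Rightarrow>\<^sub>L real" where
    G: "\<And>v. v \<in> U t \<Longrightarrow> ((\<lambda>v. total_cost T f L K (u(t := v)) w) has_derivative blinfun_apply (G v)) (at v within U t)"
      "continuous_on (U t) G"
    using C1_on_total_cost[OF u w t] by (auto simp: C1_on_def)
  have seg: "u t + \<sigma> *\<^sub>R h \<in> U t" for \<sigma>
    using subspace_U[OF t] u[OF t] h by (intro subspace_add subspace_scale)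
  have dju: "g' \<sigma> = G (u t + \<sigma> *\<^sub>R h) h" for \<sigma>
  proof -
    let ?u = "u(t := u t + \<sigma> *\<^sub>R h)"
    have "((\<lambda>v. total_cost T f L K (?u(t := v)) w) has_derivative blinfun_apply (G (u t + \<sigma> *\<^sub>R h))) (at (?u t) within U t)"
      using G(1)[OF seg] by simp
    from dju_works(2)[OF _ w t this h] show ?thesis
      unfolding g'_def using u seg by simp
  qed
  have "continuous_on UNIV (\<lambda>\<sigma>. G (u t + \<sigma> *\<^sub>R h))"
    by (rule continuous_on_compose2[OF G(2)]) (use seg in \<open>auto intro!: continuous_intros\<close>)
  then show "continuous_on UNIV g'"
    unfolding dju by (intro bounded_bilinear.continuous_on[OF bounded_bilinear_blinfun_apply]) auto
  have "u t + \<sigma> *\<^sub>R h + \<tau> *\<^sub>R h \<in> U t" for \<tau> using seg[of "\<sigma> + \<tau>"] by (simp add: algebra_simps)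
  from has_derivative_imp_directional[OF G(1)[OF seg[of \<sigma>]] this]
  have "((\<lambda>\<tau>. total_cost T f L K (u(t := u t + \<sigma> *\<^sub>R h + \<tau> *\<^sub>R h)) w) has_real_derivative g' \<sigma>) (at 0)"
    by (simp add: dju has_real_derivative_iff_has_vector_derivative)
  then show "((\<lambda>\<sigma>. total_cost T f L K (u(t := u t + \<sigma> *\<^sub>R h)) w) has_real_derivative g' \<sigma>) (at \<sigma>)"
    using DERIV_shift[of "\<lambda>\<sigma>. total_cost T f L K (u(t := u t + \<sigma> *\<^sub>R h)) w" "g' \<sigma>" 0 \<sigma>]
    by (simp add: algebra_simps)
qed

end

section \<open>Square integrable variables and conditional expectations\<close>

text \<open>Each component along \<open>B\<close> is a limit of difference quotients with steps
  1/(n+1). Measurability of \<open>G\<close> is demanded after insertion of measurable arguments,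
  the form in which normal integrands provide it; the shifted argument is again measurable with
  values in \<open>S\<close>.\<close>

lemma borel_measurable_adj_deriv:
  fixes G :: "'c \<Rightarrow> 'a::euclidean_space \<Rightarrow> 'b::euclidean_space"
  assumes S: "subspace S"
    and a[measurable]: "a \<in> borel_measurable A" and aS: "\<And>\<alpha>. \<alpha> \<in> space A \<Longrightarrow> a \<alpha> \<in> S"
    and G: "\<And>\<alpha>. \<alpha> \<in> space A \<Longrightarrow> \<exists>G'. (G \<alpha> has_derivative G') (at (a \<alpha>) within S)"
    and meas: "\<And>a'. a' \<in> borel_measurable A \<Longrightarrow> (\<And>\<alpha>. \<alpha> \<in> space A \<Longrightarrow> a' \<alpha> \<in> S) \<Longrightarrow>
      (\<lambda>\<alpha>. G \<alpha> (a' \<alpha>)) \<in> borel_measurable A"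
  shows "(\<lambda>\<alpha>. adj_deriv S (G \<alpha>) (a \<alpha>) y) \<in> borel_measurable A"
proof -
  obtain B where B: "finite B" "B \<subseteq> S" "\<And>y. y \<in> S \<Longrightarrow> (\<Sum>b\<in>B. (y \<bullet> b) *\<^sub>R b) = y"
    using subspace_orthonormal_expansion[OF S] by blast
  have comp: "(\<lambda>\<alpha>. adj_deriv S (G \<alpha>) (a \<alpha>) y \<bullet> b) \<in> borel_measurable A" if b: "b \<in> B" for b
  proof (rule borel_measurable_LIMSEQ_real)
    have seg: "a \<alpha> + t *\<^sub>R b \<in> S" if "\<alpha> \<in> space A" for \<alpha> t
      using S aS[OF that] b B(2) by (intro subspace_add subspace_scale) auto
    fix \<alpha> assume \<alpha>: "\<alpha> \<in> space A"
    obtain G' where G': "(G \<alpha> has_derivative G') (at (a \<alpha>) within S)" using G[OF \<alpha>] by blast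
    have "((\<lambda>t. y \<bullet> G \<alpha> (a \<alpha> + t *\<^sub>R b)) has_vector_derivative y \<bullet> G' b) (at 0)"
      by (intro bounded_linear.has_vector_derivative[OF bounded_linear_inner_right]
          has_derivative_imp_directional[OF G' seg[OF \<alpha>]])
    then have "((\<lambda>t. y \<bullet> G \<alpha> (a \<alpha> + t *\<^sub>R b)) has_real_derivative y \<bullet> G' b) (at 0)"
      by (simp add: has_real_derivative_iff_has_vector_derivative)
    then have "((\<lambda>t. (y \<bullet> G \<alpha> (a \<alpha> + t *\<^sub>R b) - y \<bullet> G \<alpha> (a \<alpha>)) / t) \<longlongrightarrow> y \<bullet> G' b) (at 0)"
      by (simp add: DERIV_def)
    moreover have "filterlim (\<lambda>n. inverse (real (Suc n))) (at 0) sequentially"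
      using LIMSEQ_inverse_real_of_nat by (auto simp: filterlim_at)
    ultimately have "(\<lambda>n. (y \<bullet> G \<alpha> (a \<alpha> + inverse (real (Suc n)) *\<^sub>R b) - y \<bullet> G \<alpha> (a \<alpha>)) / inverse (real (Suc n)))
        \<longlonglongrightarrow> y \<bullet> G' b"
      by (rule filterlim_compose)
    moreover have "adj_deriv S (G \<alpha>) (a \<alpha>) y \<bullet> b = y \<bullet> G' b"
      using b B(2) by (intro adj_deriv_works(2)[OF G' S aS[OF \<alpha>]]) auto
    ultimately show "(\<lambda>n. (y \<bullet> G \<alpha> (a \<alpha> + inverse (real (Suc n)) *\<^sub>R b) - y \<bullet> G \<alpha> (a \<alpha>)) / inverse (real (Suc n)))
        \<longlonglongrightarrow> adj_deriv S (G \<alpha>) (a \<alpha>) y \<bullet> b"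
      by (simp only:)
  next
    fix n
    have "a \<alpha> + inverse (real (Suc n)) *\<^sub>R b \<in> S" if "\<alpha> \<in> space A" for \<alpha>
      using S aS[OF that] b B(2) by (intro subspace_add subspace_scale) auto
    then have "(\<lambda>\<alpha>. G \<alpha> (a \<alpha> + inverse (real (Suc n)) *\<^sub>R b)) \<in> borel_measurable A"
      by (intro meas) auto
    moreover have "(\<lambda>\<alpha>. G \<alpha> (a \<alpha>)) \<in> borel_measurable A" by (intro meas a aS)
    ultimately show "(\<lambda>\<alpha>. (y \<bullet> G \<alpha> (a \<alpha> + inverse (real (Suc n)) *\<^sub>R b) - y \<bullet> G \<alpha> (a \<alpha>)) / inverse (real (Suc n)))
        \<in> borel_measurable A"
      by measurable
  qed
  have "(\<lambda>\<alpha>. \<Sum>b\<in>B. (adj_deriv S (G \<alpha>) (a \<alpha>) y \<bullet> b) *\<^sub>R b) \<in> borel_measurable A"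
    using comp by (intro borel_measurable_sum borel_measurable_scaleR) auto
  moreover have "(\<Sum>b\<in>B. (adj_deriv S (G \<alpha>) (a \<alpha>) y \<bullet> b) *\<^sub>R b) = adj_deriv S (G \<alpha>) (a \<alpha>) y" if \<alpha>: "\<alpha> \<in> space A" for \<alpha>
  proof -
    obtain G' where G': "(G \<alpha> has_derivative G') (at (a \<alpha>) within S)" using G[OF \<alpha>] by blast
    show ?thesis by (rule B(3)[OF adj_deriv_works(1)[OF G' S aS[OF \<alpha>]]])
  qed
  ultimately show ?thesis by (rule measurable_cong[THEN iffD1, rotated]) auto
qed

section \<open>Square integrable random vectors\<close>

lemma L2_measurable: "g \<in> L2 M S \<Longrightarrow> g \<in> borel_measurable M"
  by (auto simp: L2_def RV_def)

lemma L2_in: "g \<in> L2 M S \<Longrightarrow> \<omega> \<in> space M \<Longrightarrow> g \<omega> \<in> S"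
  by (auto simp: L2_def RV_def)

lemma L2_integrable_inner:
  assumes "g \<in> L2 M S" "h \<in> L2 M R"
  shows "integrable M (\<lambda>\<omega>. g \<omega> \<bullet> h \<omega>)"
proof (rule Bochner_Integration.integrable_bound)
  show "integrable M (\<lambda>\<omega>. (norm (g \<omega>))\<^sup>2 + (norm (h \<omega>))\<^sup>2)"
    using assms by (auto simp: L2_def)
  have "\<bar>g \<omega> \<bullet> h \<omega>\<bar> \<le> (norm (g \<omega>))\<^sup>2 + (norm (h \<omega>))\<^sup>2" for \<omega>
    using Cauchy_Schwarz_ineq2[of "g \<omega>" "h \<omega>"] sum_squares_bound[of "norm (g \<omega>)" "norm (h \<omega>)"]
      mult_nonneg_nonneg[OF norm_ge_zero[of "g \<omega>"] norm_ge_zero[of "h \<omega>"]] by linarith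
  then show "AE \<omega> in M. norm (g \<omega> \<bullet> h \<omega>) \<le> norm ((norm (g \<omega>))\<^sup>2 + (norm (h \<omega>))\<^sup>2)" by simp
  show "(\<lambda>\<omega>. g \<omega> \<bullet> h \<omega>) \<in> borel_measurable M"
    using assms[THEN L2_measurable] by measurable
qed

lemma L2_inner_const:
  assumes "g \<in> L2 M S" shows "(\<lambda>\<omega>. g \<omega> \<bullet> b) \<in> L2 M UNIV"
proof -
  have [measurable]: "g \<in> borel_measurable M" using assms by (rule L2_measurable)
  have "integrable M (\<lambda>\<omega>. (norm (g \<omega> \<bullet> b))\<^sup>2)"
  proof (rule Bochner_Integration.integrable_bound)
    show "integrable M (\<lambda>\<omega>. (norm b)\<^sup>2 * (norm (g \<omega>))\<^sup>2)" using assms by (simp add: L2_def)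
    have "\<bar>g \<omega> \<bullet> b\<bar>\<^sup>2 \<le> (norm b)\<^sup>2 * (norm (g \<omega>))\<^sup>2" for \<omega>
      using power_mono[OF Cauchy_Schwarz_ineq2[of "g \<omega>" b], of 2] by (simp add: power_mult_distrib mult.commute)
    then show "AE \<omega> in M. norm ((norm (g \<omega> \<bullet> b))\<^sup>2) \<le> norm ((norm b)\<^sup>2 * (norm (g \<omega>))\<^sup>2)" by simp
  qed measurable
  then show ?thesis by (simp add: L2_def RV_def)
qed

text \<open>The scalar is a bounded random variable, so that a step length depending measurably on
  the outcome is allowed. Constant scalars give sums and differences.\<close>

lemma L2_add_scaleR:
  fixes g h :: "'a \<Rightarrow> 'b::euclidean_space"
  assumes S: "subspace S" and g: "g \<in> L2 M S" and h: "h \<in> L2 M S"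
    and \<theta>[measurable]: "\<theta> \<in> borel_measurable M" and bound: "\<And>\<omega>. \<bar>\<theta> \<omega>\<bar> \<le> 1"
  shows "(\<lambda>\<omega>. g \<omega> + \<theta> \<omega> *\<^sub>R h \<omega>) \<in> L2 M S"
proof -
  note [measurable] = g[THEN L2_measurable] h[THEN L2_measurable]
  have "integrable M (\<lambda>\<omega>. (norm (g \<omega> + \<theta> \<omega> *\<^sub>R h \<omega>))\<^sup>2)"
  proof (rule Bochner_Integration.integrable_bound)
    show "integrable M (\<lambda>\<omega>. 2 * (norm (g \<omega>))\<^sup>2 + 2 * (norm (h \<omega>))\<^sup>2)" using g h by (simp add: L2_def)
    have "(norm (g \<omega> + \<theta> \<omega> *\<^sub>R h \<omega>))\<^sup>2 \<le> 2 * (norm (g \<omega>))\<^sup>2 + 2 * (norm (h \<omega>))\<^sup>2" for \<omega>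
    proof -
      have "norm (\<theta> \<omega> *\<^sub>R h \<omega>) \<le> norm (h \<omega>)"
        using bound[of \<omega>] by (simp add: mult_left_le_one_le)
      then have "norm (g \<omega> + \<theta> \<omega> *\<^sub>R h \<omega>) \<le> norm (g \<omega>) + norm (h \<omega>)"
        using norm_triangle_ineq[of "g \<omega>" "\<theta> \<omega> *\<^sub>R h \<omega>"] by linarith
      then have "(norm (g \<omega> + \<theta> \<omega> *\<^sub>R h \<omega>))\<^sup>2 \<le> (norm (g \<omega>) + norm (h \<omega>))\<^sup>2"
        by (intro power_mono) auto
      also have "\<dots> \<le> 2 * (norm (g \<omega>))\<^sup>2 + 2 * (norm (h \<omega>))\<^sup>2"
        using sum_squares_bound[of "norm (g \<omega>)" "norm (h \<omega>)"] by (simp add: power2_sum)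
      finally show ?thesis .
    qed
    then show "AE \<omega> in M. norm ((norm (g \<omega> + \<theta> \<omega> *\<^sub>R h \<omega>))\<^sup>2) \<le> norm (2 * (norm (g \<omega>))\<^sup>2 + 2 * (norm (h \<omega>))\<^sup>2)" by simp
  qed measurable
  moreover have "g \<omega> + \<theta> \<omega> *\<^sub>R h \<omega> \<in> S" if "\<omega> \<in> space M" for \<omega>
    using S L2_in[OF g that] L2_in[OF h that] by (intro subspace_add subspace_scale)
  ultimately show ?thesis by (simp add: L2_def RV_def)
qed

lemma L2_diff:
  fixes g h :: "'a \<Rightarrow> 'b::euclidean_space"
  assumes "subspace S" "g \<in> L2 M S" "h \<in> L2 M S" shows "(\<lambda>\<omega>. g \<omega> - h \<omega>) \<in> L2 M S"
  using L2_add_scaleR[OF assms, of "\<lambda>_. -1"] by simp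

lemma L2_const: "finite_measure M \<Longrightarrow> c \<in> S \<Longrightarrow> (\<lambda>_. c) \<in> L2 M S"
  by (simp add: L2_def RV_def finite_measure.integrable_const)

lemma L2_dominated:
  assumes "g \<in> L2 M S" and h[measurable]: "h \<in> borel_measurable M" and "\<And>\<omega>. \<omega> \<in> space M \<Longrightarrow> h \<omega> \<in> R"
    and bound: "AE \<omega> in M. norm (h \<omega>) \<le> norm (g \<omega>)"
  shows "h \<in> L2 M R"
proof -
  have "integrable M (\<lambda>\<omega>. (norm (h \<omega>))\<^sup>2)"
  proof (rule Bochner_Integration.integrable_bound)
    show "integrable M (\<lambda>\<omega>. (norm (g \<omega>))\<^sup>2)" using assms by (simp add: L2_def)
    show "AE \<omega> in M. norm ((norm (h \<omega>))\<^sup>2) \<le> norm ((norm (g \<omega>))\<^sup>2)"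
      using bound by eventually_elim (auto intro: power_mono)
  qed measurable
  then show ?thesis using assms by (simp add: L2_def RV_def)
qed

lemma (in finite_measure) L2_integrable:
  assumes "g \<in> L2 M S" shows "integrable M g"
proof (rule Bochner_Integration.integrable_bound)
  show "integrable M (\<lambda>\<omega>. 1 + (norm (g \<omega>))\<^sup>2)" using assms by (simp add: L2_def)
  have "norm (g \<omega>) \<le> 1 + (norm (g \<omega>))\<^sup>2" for \<omega>
  proof -
    have "2 * norm (g \<omega>) \<le> 1 + (norm (g \<omega>))\<^sup>2" using sum_squares_bound[of 1 "norm (g \<omega>)"] by simp
    then show ?thesis using norm_ge_zero[of "g \<omega>"] by linarith
  qed
  then show "AE \<omega> in M. norm (g \<omega>) \<le> norm (1 + (norm (g \<omega>))\<^sup>2)" by (simp add: abs_of_nonneg)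
qed (use assms L2_measurable in auto)

text \<open>The projection is a Borel retraction onto the subspace. It upgrades almost sure
  membership to membership everywhere without leaving the almost sure class, and it extends maps
  from a subspace to the ambient space.\<close>

lemma closest_point_subspace:
  fixes S :: "'b::euclidean_space set"
  assumes "subspace S"
  shows "closest_point S y \<in> S" "y \<in> S \<Longrightarrow> closest_point S y = y" "closest_point S \<in> borel_measurable borel"
    "norm (closest_point S y) \<le> norm y"
proof -
  have S: "closed S" "convex S" "S \<noteq> {}" "0 \<in> S"
    using assms subspace_0[OF assms] by (auto simp: closed_subspace subspace_imp_convex)
  show "closest_point S y \<in> S" "y \<in> S \<Longrightarrow> closest_point S y = y"
    using S by (auto intro: closest_point_in_set closest_point_self)
  show "closest_point S \<in> borel_measurable borel"
    by (intro borel_measurable_continuous_onI continuous_on_closest_point S)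
  show "norm (closest_point S y) \<le> norm y"
    using closest_point_lipschitz[OF S(2,1,3), of y 0] closest_point_self[OF S(4)] by (simp add: dist_norm)
qed

lemma L2_closest_point:
  assumes S: "subspace S" and g: "g \<in> L2 M R"
  shows "(\<lambda>\<omega>. closest_point S (g \<omega>)) \<in> L2 M S"
proof (rule L2_dominated[OF g])
  show "(\<lambda>\<omega>. closest_point S (g \<omega>)) \<in> borel_measurable M"
    by (rule measurable_compose[OF L2_measurable[OF g] closest_point_subspace(3)[OF S]])
qed (auto intro: closest_point_subspace[OF S])

text \<open>The Markovian hypothesis identifies sigma-algebras, whereas a conditional expectation
  takes a measure as its argument; this bridges the two.\<close>

lemma cond_exp_vec_sets_cong:
  assumes "sets F = sets G"
  shows "cond_exp_vec M F = cond_exp_vec M G"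
proof -
  have "nn_cond_exp M F = nn_cond_exp M G"
    using assms sets_eq_imp_space_eq[OF assms]
    by (simp add: nn_cond_exp_def fun_eq_iff restr_to_subalg_def subalgebra_def)
  then have "real_cond_exp M F = real_cond_exp M G" by (simp add: fun_eq_iff real_cond_exp_def)
  then show ?thesis by (simp add: fun_eq_iff cond_exp_vec_def)
qed

section \<open>Conditional expectation of random vectors\<close>

context finite_measure_subalgebra begin

lemma cond_exp_vec_measurable[measurable]:
  "cond_exp_vec M F g \<in> borel_measurable F" "cond_exp_vec M F g \<in> borel_measurable M"
  unfolding cond_exp_vec_def by measurable

lemma cond_exp_vec_Basis: "i \<in> Basis \<Longrightarrow> cond_exp_vec M F g \<omega> \<bullet> i = real_cond_exp M F (\<lambda>\<omega>. g \<omega> \<bullet> i) \<omega>"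
  unfolding cond_exp_vec_def by (rule inner_sum_left_Basis)

lemma cond_exp_vec_eqI:
  assumes "\<And>i. i \<in> Basis \<Longrightarrow> AE \<omega> in M. real_cond_exp M F (\<lambda>\<omega>. g \<omega> \<bullet> i) \<omega> = h \<omega> \<bullet> i"
  shows "AE \<omega> in M. cond_exp_vec M F g \<omega> = h \<omega>"
proof -
  have "AE \<omega> in M. \<forall>i\<in>Basis. real_cond_exp M F (\<lambda>\<omega>. g \<omega> \<bullet> i) \<omega> = h \<omega> \<bullet> i"
    using assms by (intro AE_finite_allI) auto
  then show ?thesis
  proof eventually_elim
    case (elim \<omega>)
    show ?case by (rule euclidean_eqI) (use elim in \<open>simp add: cond_exp_vec_Basis\<close>)
  qed
qed

lemma cond_exp_vec_cong:
  assumes "AE \<omega> in M. g \<omega> = h \<omega>" and [measurable]: "g \<in> borel_measurable M" "h \<in> borel_measurable M"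
  shows "AE \<omega> in M. cond_exp_vec M F g \<omega> = cond_exp_vec M F h \<omega>"
proof (rule cond_exp_vec_eqI)
  fix i :: 'b assume i: "i \<in> Basis"
  have "AE \<omega> in M. real_cond_exp M F (\<lambda>\<omega>. g \<omega> \<bullet> i) \<omega> = real_cond_exp M F (\<lambda>\<omega>. h \<omega> \<bullet> i) \<omega>"
    using assms(1) by (intro real_cond_exp_cong) auto
  then show "AE \<omega> in M. real_cond_exp M F (\<lambda>\<omega>. g \<omega> \<bullet> i) \<omega> = cond_exp_vec M F h \<omega> \<bullet> i"
    using i by (simp add: cond_exp_vec_Basis)
qed

lemma cond_exp_vec_F_meas:
  assumes "integrable M g" "g \<in> borel_measurable F"
  shows "AE \<omega> in M. cond_exp_vec M F g \<omega> = g \<omega>"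
  using assms by (intro cond_exp_vec_eqI real_cond_exp_F_meas) auto

text \<open>Linearity carries the coordinate formula from the standard basis to arbitrary vectors;
  the expansion of a co-state uses a basis of its subspace, whose vectors are not standard ones in
  general.\<close>

lemma cond_exp_vec_inner:
  assumes g: "integrable M g"
  shows "AE \<omega> in M. cond_exp_vec M F g \<omega> \<bullet> b = real_cond_exp M F (\<lambda>\<omega>. g \<omega> \<bullet> b) \<omega>"
proof -
  have gi: "integrable M (\<lambda>\<omega>. g \<omega> \<bullet> i)" for i using g by simp
  have "AE \<omega> in M. real_cond_exp M F (\<lambda>\<omega>. \<Sum>i\<in>Basis. (b \<bullet> i) * (g \<omega> \<bullet> i)) \<omega> =
     (\<Sum>i\<in>Basis. real_cond_exp M F (\<lambda>\<omega>. (b \<bullet> i) * (g \<omega> \<bullet> i)) \<omega>)"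
    using gi by (intro real_cond_exp_sum) auto
  moreover have "AE \<omega> in M. \<forall>i\<in>Basis. real_cond_exp M F (\<lambda>\<omega>. (b \<bullet> i) * (g \<omega> \<bullet> i)) \<omega> = (b \<bullet> i) * real_cond_exp M F (\<lambda>\<omega>. g \<omega> \<bullet> i) \<omega>"
    using gi by (intro AE_finite_allI real_cond_exp_cmult) auto
  ultimately show ?thesis
  proof eventually_elim
    case (elim \<omega>)
    have "(\<lambda>\<omega>. g \<omega> \<bullet> b) = (\<lambda>\<omega>. \<Sum>i\<in>Basis. (b \<bullet> i) * (g \<omega> \<bullet> i))"
      by (auto simp: euclidean_inner[of "g _" b] mult.commute)
    then show ?case
      using elim by (simp add: euclidean_inner[of "cond_exp_vec M F g \<omega>" b] cond_exp_vec_Basis mult.commute)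
  qed
qed

lemma real_cond_exp_square:
  assumes "integrable M g" "integrable M (\<lambda>\<omega>. (g \<omega>)\<^sup>2)"
  shows "integrable M (\<lambda>\<omega>. (real_cond_exp M F g \<omega>)\<^sup>2)"
proof (rule Bochner_Integration.integrable_bound)
  show "integrable M (real_cond_exp M F (\<lambda>\<omega>. (g \<omega>)\<^sup>2))" by (rule real_cond_exp_int(1)[OF assms(2)])
  have "AE \<omega> in M. (real_cond_exp M F g \<omega>)\<^sup>2 \<le> real_cond_exp M F (\<lambda>\<omega>. (g \<omega>)\<^sup>2) \<omega>"
    using assms convex_power2 by (intro real_cond_exp_jensens_inequality(2)[where I=UNIV]) auto
  then show "AE \<omega> in M. norm ((real_cond_exp M F g \<omega>)\<^sup>2) \<le> norm (real_cond_exp M F (\<lambda>\<omega>. (g \<omega>)\<^sup>2) \<omega>)"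
    by eventually_elim auto
qed measurable

lemma cond_exp_vec_L2:
  assumes g: "g \<in> L2 M S" shows "cond_exp_vec M F g \<in> L2 M UNIV"
proof -
  have "integrable M (\<lambda>\<omega>. (real_cond_exp M F (\<lambda>\<omega>. g \<omega> \<bullet> i) \<omega>)\<^sup>2)" for i
    using L2_inner_const[OF g, of i] L2_integrable[OF L2_inner_const[OF g, of i]]
    by (intro real_cond_exp_square) (auto simp: L2_def)
  then have "integrable M (\<lambda>\<omega>. \<Sum>i\<in>Basis. (real_cond_exp M F (\<lambda>\<omega>. g \<omega> \<bullet> i) \<omega>)\<^sup>2)" by simp
  moreover have "(norm (cond_exp_vec M F g \<omega>))\<^sup>2 = (\<Sum>i\<in>Basis. (real_cond_exp M F (\<lambda>\<omega>. g \<omega> \<bullet> i) \<omega>)\<^sup>2)" for \<omega>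
    unfolding power2_norm_eq_inner euclidean_inner[of "cond_exp_vec M F g \<omega>" "cond_exp_vec M F g \<omega>"]
    by (simp add: cond_exp_vec_Basis power2_eq_square)
  ultimately show ?thesis by (simp add: L2_def RV_def)
qed

lemma integral_inner_cond_exp_vec:
  assumes a: "a \<in> L2 M S" "a \<in> borel_measurable F" and g: "g \<in> L2 M R"
  shows "(\<integral>\<omega>. a \<omega> \<bullet> cond_exp_vec M F g \<omega> \<partial>M) = (\<integral>\<omega>. a \<omega> \<bullet> g \<omega> \<partial>M)"
proof -
  note [measurable] = L2_measurable[OF g]
  have int: "integrable M (\<lambda>\<omega>. (a \<omega> \<bullet> i) * (g \<omega> \<bullet> i))" for i
    using L2_integrable_inner[OF L2_inner_const[OF a(1)] L2_inner_const[OF g], of i i] by simp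
  have *: "integrable M (\<lambda>\<omega>. (a \<omega> \<bullet> i) * real_cond_exp M F (\<lambda>\<omega>. g \<omega> \<bullet> i) \<omega>)"
    "(\<integral>\<omega>. (a \<omega> \<bullet> i) * real_cond_exp M F (\<lambda>\<omega>. g \<omega> \<bullet> i) \<omega> \<partial>M) = (\<integral>\<omega>. (a \<omega> \<bullet> i) * (g \<omega> \<bullet> i) \<partial>M)" for i
    using a(2) by (auto intro!: real_cond_exp_intg int)
  have "(\<integral>\<omega>. a \<omega> \<bullet> cond_exp_vec M F g \<omega> \<partial>M) = (\<integral>\<omega>. (\<Sum>i\<in>Basis. (a \<omega> \<bullet> i) * real_cond_exp M F (\<lambda>\<omega>. g \<omega> \<bullet> i) \<omega>) \<partial>M)"
    by (intro Bochner_Integration.integral_cong refl, subst euclidean_inner) (simp add: cond_exp_vec_Basis)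
  also have "\<dots> = (\<integral>\<omega>. (\<Sum>i\<in>Basis. (a \<omega> \<bullet> i) * (g \<omega> \<bullet> i)) \<partial>M)"
    using * int by (simp add: Bochner_Integration.integral_sum)
  also have "\<dots> = (\<integral>\<omega>. a \<omega> \<bullet> g \<omega> \<partial>M)"
    by (intro Bochner_Integration.integral_cong refl, subst (3) euclidean_inner) simp
  finally show ?thesis .
qed

text \<open>With \<open>P\<close> the projection of \<open>c = E(g | F)\<close> onto \<open>C\<close>, the inequality \<open>\<langle>c - P, g - P\<rangle> \<le> 0\<close>
  integrates to \<open>E \<bar>c - P\<bar>\<^sup>2 \<le> 0\<close>.\<close>

lemma cond_exp_vec_in_convex:
  assumes g: "g \<in> L2 M S" and C: "closed C" "convex C" and gC: "AE \<omega> in M. g \<omega> \<in> C"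
  shows "AE \<omega> in M. cond_exp_vec M F g \<omega> \<in> C"
proof (cases "C = {}")
  case True
  then show ?thesis using gC by simp
next
  case ne: False
  define c where "c = cond_exp_vec M F g"
  define P where "P \<omega> = closest_point C (c \<omega>)" for \<omega>
  have cp[measurable]: "closest_point C \<in> borel_measurable borel"
    by (intro borel_measurable_continuous_onI continuous_on_closest_point C ne)
  have c_F[measurable]: "c \<in> borel_measurable F" and [measurable]: "c \<in> borel_measurable M"
    by (simp_all add: c_def)
  have P_F[measurable]: "P \<in> borel_measurable F" "P \<in> borel_measurable M" unfolding P_def by measurable
  have cL2: "c \<in> L2 M UNIV" unfolding c_def by (rule cond_exp_vec_L2[OF g])
  \<comment> \<open>A reference point of \<open>C\<close>: since the projection is nonexpansive, the
    distance of \<open>P\<close> from \<open>z\<close> is at most the norm of \<open>c\<close>, and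
    so \<open>P\<close> inherits square integrability.\<close>
  define z where "z = closest_point C 0"
  have "norm (P \<omega> - z) \<le> norm (c \<omega>)" for \<omega>
    using closest_point_lipschitz[OF C(2,1) ne, of "c \<omega>" 0] by (simp add: P_def z_def dist_norm)
  then have "(\<lambda>\<omega>. P \<omega> - z) \<in> L2 M UNIV"
    by (intro L2_dominated[OF cL2]) auto
  from L2_add_scaleR[OF subspace_UNIV this L2_const[of M z UNIV], of "\<lambda>_. 1"]
  have PL2: "P \<in> L2 M UNIV" using finite_measure_axioms by simp
  have eL2: "(\<lambda>\<omega>. c \<omega> - P \<omega>) \<in> L2 M UNIV" by (intro L2_diff cL2 PL2) simp
  have eF: "(\<lambda>\<omega>. c \<omega> - P \<omega>) \<in> borel_measurable F" by measurable
  have "(\<integral>\<omega>. (c \<omega> - P \<omega>) \<bullet> (c \<omega> - P \<omega>) \<partial>M) = (\<integral>\<omega>. (c \<omega> - P \<omega>) \<bullet> c \<omega> \<partial>M) - (\<integral>\<omega>. (c \<omega> - P \<omega>) \<bullet> P \<omega> \<partial>M)"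
    using L2_integrable_inner[OF eL2 cL2] L2_integrable_inner[OF eL2 PL2]
    by (simp add: inner_diff_right[of "c _ - P _"] Bochner_Integration.integral_diff)
  \<comment> \<open>As \<open>c - P\<close> is measurable for \<open>F\<close>, the conditional
    expectation \<open>c\<close> may be traded for \<open>g\<close>, which lies in \<open>C\<close>
    almost surely.\<close>
  also have "(\<integral>\<omega>. (c \<omega> - P \<omega>) \<bullet> c \<omega> \<partial>M) = (\<integral>\<omega>. (c \<omega> - P \<omega>) \<bullet> g \<omega> \<partial>M)"
    using integral_inner_cond_exp_vec[OF eL2 eF g] by (simp add: c_def)
  also have "\<dots> - (\<integral>\<omega>. (c \<omega> - P \<omega>) \<bullet> P \<omega> \<partial>M) = (\<integral>\<omega>. (c \<omega> - P \<omega>) \<bullet> (g \<omega> - P \<omega>) \<partial>M)"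
    using L2_integrable_inner[OF eL2 g] L2_integrable_inner[OF eL2 PL2]
    by (simp add: inner_diff_right[of "c _ - P _" "g _"] Bochner_Integration.integral_diff)
  also have "\<dots> \<le> 0"
  proof -
    have "AE \<omega> in M. (c \<omega> - P \<omega>) \<bullet> (g \<omega> - P \<omega>) \<le> 0"
      using gC by eventually_elim (auto simp: P_def intro!: closest_point_dot C)
    then have "0 \<le> (\<integral>\<omega>. - ((c \<omega> - P \<omega>) \<bullet> (g \<omega> - P \<omega>)) \<partial>M)" by (intro integral_nonneg_AE) auto
    then show ?thesis by simp
  qed
  finally have "(\<integral>\<omega>. (c \<omega> - P \<omega>) \<bullet> (c \<omega> - P \<omega>) \<partial>M) = 0"
    by (intro antisym integral_nonneg_AE) auto
  then have "AE \<omega> in M. (c \<omega> - P \<omega>) \<bullet> (c \<omega> - P \<omega>) = 0"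
    using integral_nonneg_eq_0_iff_AE[OF L2_integrable_inner[OF eL2 eL2]] by auto
  then show ?thesis
  proof eventually_elim
    case (elim \<omega>)
    then have "c \<omega> = P \<omega>" by simp
    then show ?case using closest_point_in_set[OF C(1) ne, of "c \<omega>"] by (simp add: c_def P_def)
  qed
qed

lemma real_cond_exp_eqI:
  assumes "integrable M g" "integrable M h" and "\<And>A. A \<in> sets F \<Longrightarrow> (\<integral>\<omega>\<in>A. g \<omega> \<partial>M) = (\<integral>\<omega>\<in>A. h \<omega> \<partial>M)"
  shows "AE \<omega> in M. real_cond_exp M F g \<omega> = real_cond_exp M F h \<omega>"
  using assms by (intro real_cond_exp_charact) (auto simp: real_cond_exp_intA intro: real_cond_exp_int(1))

text \<open>The passage from the co-state to the multiplier. The factors \<open>d b\<close> are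
  known to the finer \<open>G\<close>, so \<open>l0\<close> may be replaced by its conditional
  expectation given \<open>G\<close> before the coarser conditioning on \<open>F\<close>. The
  factors are unbounded, so the integrability of each product has to be carried along.\<close>

lemma cond_exp_vec_tower_mult:
  fixes d :: "'i::euclidean_space \<Rightarrow> 'a \<Rightarrow> 'b::euclidean_space" and l0 L0 :: "'a \<Rightarrow> 'i"
  assumes G: "subalgebra M G" "sets F \<subseteq> sets G"
    and B: "finite B" and d: "\<And>b. b \<in> B \<Longrightarrow> d b \<in> L2 M S" "\<And>b. b \<in> B \<Longrightarrow> d b \<in> borel_measurable G"
    and l: "l0 \<in> L2 M R" and \<Lambda>: "L0 \<in> borel_measurable M" "AE \<omega> in M. L0 \<omega> = cond_exp_vec M G l0 \<omega>"
    and g: "integrable M g"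
  shows "integrable M (\<lambda>\<omega>. g \<omega> + (\<Sum>b\<in>B. (l0 \<omega> \<bullet> b) *\<^sub>R d b \<omega>))"
    and "integrable M (\<lambda>\<omega>. g \<omega> + (\<Sum>b\<in>B. (L0 \<omega> \<bullet> b) *\<^sub>R d b \<omega>))"
    and "AE \<omega> in M. cond_exp_vec M F (\<lambda>\<omega>. g \<omega> + (\<Sum>b\<in>B. (l0 \<omega> \<bullet> b) *\<^sub>R d b \<omega>)) \<omega> =
                    cond_exp_vec M F (\<lambda>\<omega>. g \<omega> + (\<Sum>b\<in>B. (L0 \<omega> \<bullet> b) *\<^sub>R d b \<omega>)) \<omega>"
proof -
  interpret G: finite_measure_subalgebra M G by unfold_locales (rule G(1))
  note [measurable] = L2_measurable[OF l] \<Lambda>(1) L2_measurable[OF d(1)]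
  have intl: "integrable M l0" using l by (rule L2_integrable)
  have \<Lambda>b: "AE \<omega> in M. L0 \<omega> \<bullet> b = real_cond_exp M G (\<lambda>\<omega>. l0 \<omega> \<bullet> b) \<omega>" for b
    using \<Lambda>(2) G.cond_exp_vec_inner[OF intl, of b] by eventually_elim simp
  \<comment> \<open>The bounded weight \<open>c\<close> is used twice: as the constant 1 for
    integrability, and as the indicator of a set of \<open>F\<close> for testing the conditional
    expectations.\<close>
  have step: "integrable M (\<lambda>\<omega>. (c \<omega> * (d b \<omega> \<bullet> i)) * (l0 \<omega> \<bullet> b))"
    "integrable M (\<lambda>\<omega>. (c \<omega> * (d b \<omega> \<bullet> i)) * (L0 \<omega> \<bullet> b))"
    "(\<integral>\<omega>. (c \<omega> * (d b \<omega> \<bullet> i)) * (l0 \<omega> \<bullet> b) \<partial>M) = (\<integral>\<omega>. (c \<omega> * (d b \<omega> \<bullet> i)) * (L0 \<omega> \<bullet> b) \<partial>M)"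
    if c[measurable]: "c \<in> borel_measurable G" and c1: "\<And>\<omega>. \<bar>c \<omega>\<bar> \<le> 1" and b: "b \<in> B" for c i b
  proof -
    have cM[measurable]: "c \<in> borel_measurable M" by (rule measurable_from_subalg[OF G(1) c])
    have "integrable M (\<lambda>\<omega>. (d b \<omega> \<bullet> i) * (l0 \<omega> \<bullet> b))"
      using L2_integrable_inner[OF L2_inner_const[OF d(1)[OF b], of i] L2_inner_const[OF l, of b]] by simp
    then show int: "integrable M (\<lambda>\<omega>. (c \<omega> * (d b \<omega> \<bullet> i)) * (l0 \<omega> \<bullet> b))"
      by (rule Bochner_Integration.integrable_bound)
         (use b c1 in \<open>auto simp: abs_mult mult.assoc intro!: mult_left_le_one_le\<close>)
    have F': "(\<lambda>\<omega>. c \<omega> * (d b \<omega> \<bullet> i)) \<in> borel_measurable G" using d(2)[OF b] by measurable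
    have AEb: "AE \<omega> in M. (c \<omega> * (d b \<omega> \<bullet> i)) * real_cond_exp M G (\<lambda>\<omega>. l0 \<omega> \<bullet> b) \<omega> = (c \<omega> * (d b \<omega> \<bullet> i)) * (L0 \<omega> \<bullet> b)"
      using \<Lambda>b[of b] by eventually_elim simp
    show "integrable M (\<lambda>\<omega>. (c \<omega> * (d b \<omega> \<bullet> i)) * (L0 \<omega> \<bullet> b))"
      using G.real_cond_exp_intg(1)[OF int F'] b by (subst integrable_cong_AE[OF _ _ AEb, symmetric]) auto
    show "(\<integral>\<omega>. (c \<omega> * (d b \<omega> \<bullet> i)) * (l0 \<omega> \<bullet> b) \<partial>M) = (\<integral>\<omega>. (c \<omega> * (d b \<omega> \<bullet> i)) * (L0 \<omega> \<bullet> b) \<partial>M)"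
      using G.real_cond_exp_intg(2)[OF int F'] integral_cong_AE[OF _ _ AEb] b by simp
  qed
  have int_i: "integrable M (\<lambda>\<omega>. (g \<omega> + (\<Sum>b\<in>B. (l0 \<omega> \<bullet> b) *\<^sub>R d b \<omega>)) \<bullet> i)"
    "integrable M (\<lambda>\<omega>. (g \<omega> + (\<Sum>b\<in>B. (L0 \<omega> \<bullet> b) *\<^sub>R d b \<omega>)) \<bullet> i)" for i
    using step(1)[of "\<lambda>_. 1" _ i] step(2)[of "\<lambda>_. 1" _ i] g
    by (auto simp: inner_add_left inner_sum_left mult.commute intro!: Bochner_Integration.integrable_add Bochner_Integration.integrable_sum)
  have vec: "integrable M h" if "\<And>i. integrable M (\<lambda>\<omega>. h \<omega> \<bullet> i)" for h :: "'a \<Rightarrow> 'b"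
  proof -
    have "integrable M (\<lambda>\<omega>. \<Sum>i\<in>Basis. (h \<omega> \<bullet> i) *\<^sub>R i)" using that by simp
    then show ?thesis by (simp add: euclidean_representation)
  qed
  show "integrable M (\<lambda>\<omega>. g \<omega> + (\<Sum>b\<in>B. (l0 \<omega> \<bullet> b) *\<^sub>R d b \<omega>))"
    "integrable M (\<lambda>\<omega>. g \<omega> + (\<Sum>b\<in>B. (L0 \<omega> \<bullet> b) *\<^sub>R d b \<omega>))" using int_i by (auto intro!: vec)
  show "AE \<omega> in M. cond_exp_vec M F (\<lambda>\<omega>. g \<omega> + (\<Sum>b\<in>B. (l0 \<omega> \<bullet> b) *\<^sub>R d b \<omega>)) \<omega> =
                   cond_exp_vec M F (\<lambda>\<omega>. g \<omega> + (\<Sum>b\<in>B. (L0 \<omega> \<bullet> b) *\<^sub>R d b \<omega>)) \<omega>"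
  proof (rule cond_exp_vec_eqI)
    fix i :: 'b assume i: "i \<in> Basis"
    have "AE \<omega> in M. real_cond_exp M F (\<lambda>\<omega>. (g \<omega> + (\<Sum>b\<in>B. (l0 \<omega> \<bullet> b) *\<^sub>R d b \<omega>)) \<bullet> i) \<omega> =
        real_cond_exp M F (\<lambda>\<omega>. (g \<omega> + (\<Sum>b\<in>B. (L0 \<omega> \<bullet> b) *\<^sub>R d b \<omega>)) \<bullet> i) \<omega>"
    proof (rule real_cond_exp_eqI[OF int_i])
      fix A assume A: "A \<in> sets F"
      then have AG[measurable]: "A \<in> sets G" using G(2) by auto
      then have AM[measurable]: "A \<in> sets M" using G(1) by (auto simp: subalgebra_def)
      have c: "indicat_real A \<in> borel_measurable G" "\<And>\<omega>. \<bar>indicat_real A \<omega>\<bar> \<le> 1" by (auto simp: indicator_def)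
      have gA: "integrable M (\<lambda>\<omega>. indicat_real A \<omega> * (g \<omega> \<bullet> i))"
        using integrable_mult_indicator[OF AM, of "\<lambda>\<omega>. g \<omega> \<bullet> i"] g by simp
      have ex: "(\<integral>\<omega>\<in>A. ((g \<omega> + (\<Sum>b\<in>B. (h \<omega> \<bullet> b) *\<^sub>R d b \<omega>)) \<bullet> i) \<partial>M) =
        (\<integral>\<omega>. indicat_real A \<omega> * (g \<omega> \<bullet> i) \<partial>M) + (\<Sum>b\<in>B. \<integral>\<omega>. (indicat_real A \<omega> * (d b \<omega> \<bullet> i)) * (h \<omega> \<bullet> b) \<partial>M)"
        if "\<And>b. b \<in> B \<Longrightarrow> integrable M (\<lambda>\<omega>. (indicat_real A \<omega> * (d b \<omega> \<bullet> i)) * (h \<omega> \<bullet> b))" for h :: "'a \<Rightarrow> 'i"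
      proof -
        have "(\<integral>\<omega>\<in>A. ((g \<omega> + (\<Sum>b\<in>B. (h \<omega> \<bullet> b) *\<^sub>R d b \<omega>)) \<bullet> i) \<partial>M) =
          (\<integral>\<omega>. indicat_real A \<omega> * (g \<omega> \<bullet> i) + (\<Sum>b\<in>B. (indicat_real A \<omega> * (d b \<omega> \<bullet> i)) * (h \<omega> \<bullet> b)) \<partial>M)"
          unfolding set_lebesgue_integral_def
          by (intro Bochner_Integration.integral_cong refl)
             (simp add: inner_add_left inner_sum_left sum_distrib_left distrib_left mult_ac)
        then show ?thesis
          using gA that by (simp add: Bochner_Integration.integral_add Bochner_Integration.integral_sum)
      qed
      show "(\<integral>\<omega>\<in>A. ((g \<omega> + (\<Sum>b\<in>B. (l0 \<omega> \<bullet> b) *\<^sub>R d b \<omega>)) \<bullet> i) \<partial>M) =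
        (\<integral>\<omega>\<in>A. ((g \<omega> + (\<Sum>b\<in>B. (L0 \<omega> \<bullet> b) *\<^sub>R d b \<omega>)) \<bullet> i) \<partial>M)"
        using step[OF c] by (simp add: ex)
    qed
    then show "AE \<omega> in M. real_cond_exp M F (\<lambda>\<omega>. (g \<omega> + (\<Sum>b\<in>B. (l0 \<omega> \<bullet> b) *\<^sub>R d b \<omega>)) \<bullet> i) \<omega> =
        cond_exp_vec M F (\<lambda>\<omega>. g \<omega> + (\<Sum>b\<in>B. (L0 \<omega> \<bullet> b) *\<^sub>R d b \<omega>)) \<omega> \<bullet> i"
      using i by (simp add: cond_exp_vec_Basis)
  qed
qed

end

text \<open>The freezing lemma: \<open>\<xi>\<close> is known and \<open>b\<close> is averaged out.
  The function \<open>\<phi>\<close> depends on \<open>\<Phi>\<close> and the law of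
  \<open>b\<close> but not on \<open>F\<close>, so two sigma-algebras that both know
  \<open>\<xi>\<close> and are independent of \<open>b\<close> lead to the same function.\<close>

lemma (in prob_space) cond_exp_vec_indep:
  fixes \<Phi> :: "'c \<times> 'd \<Rightarrow> 'b::euclidean_space"
  assumes F: "subalgebra M F" and \<xi>: "\<xi> \<in> F \<rightarrow>\<^sub>M N" and b[measurable]: "b \<in> M \<rightarrow>\<^sub>M N'"
    and indep: "\<And>A B. A \<in> sets F \<Longrightarrow> B \<in> sets N' \<Longrightarrow> prob (A \<inter> (b -` B \<inter> space M)) = prob A * prob (b -` B \<inter> space M)"
    and \<Phi>[measurable]: "\<Phi> \<in> borel_measurable (N \<Otimes>\<^sub>M N')"
    and g: "integrable M g" "AE \<omega> in M. g \<omega> = \<Phi> (\<xi> \<omega>, b \<omega>)"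
  defines "\<phi> \<equiv> \<lambda>a. \<Sum>i\<in>Basis. (\<integral>y. \<Phi> (a, y) \<bullet> i \<partial>distr M N' b) *\<^sub>R i"
  shows "\<phi> \<in> borel_measurable N" "AE \<omega> in M. cond_exp_vec M F g \<omega> = \<phi> (\<xi> \<omega>)"
proof -
  note emeasure_M = emeasure_eq_measure
  interpret F: finite_measure_subalgebra M F by unfold_locales (rule F)
  interpret b: prob_space "distr M N' b" by (rule prob_space_distr) measurable
  interpret R: prob_space "restr_to_subalg M F" by (rule prob_space_restr_to_subalg[OF F prob_space_axioms])
  interpret pair_prob_space "restr_to_subalg M F" "distr M N' b" ..
  have meas\<phi>: "(\<lambda>a. \<integral>y. \<Phi> (a, y) \<bullet> i \<partial>distr M N' b) \<in> borel_measurable N" for i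
    by (rule b.borel_measurable_lebesgue_integral) simp
  then show "\<phi> \<in> borel_measurable N" unfolding \<phi>_def by measurable
  have setsF: "sets (restr_to_subalg M F) = sets F" and spF: "space F = space M"
    using F by (simp_all add: sets_restr_to_subalg subalgebra_def)
  have idF: "(\<lambda>\<omega>. \<omega>) \<in> M \<rightarrow>\<^sub>M F" using F by (auto simp: subalgebra_def measurable_def)
  have \<xi>M[measurable]: "\<xi> \<in> M \<rightarrow>\<^sub>M N" by (rule measurable_from_subalg[OF F \<xi>])
  \<comment> \<open>The identity is viewed as a random element of the space with sigma-algebra
    \<open>F\<close>. Independence from all of \<open>F\<close> then makes its joint law with
    \<open>b\<close> a product, to which Fubini applies.\<close>
  have joint: "restr_to_subalg M F \<Otimes>\<^sub>M distr M N' b = distr M (F \<Otimes>\<^sub>M N') (\<lambda>\<omega>. (\<omega>, b \<omega>))" (is "?l = ?r")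
  proof (rule pair_measure_eqI)
    show "sigma_finite_measure (restr_to_subalg M F)" "sigma_finite_measure (distr M N' b)" ..
    show "sets ?l = sets ?r" by (simp add: setsF cong: sets_pair_measure_cong)
    fix A B assume "A \<in> sets (restr_to_subalg M F)" "B \<in> sets (distr M N' b)"
    then have A: "A \<in> sets F" and B: "B \<in> sets N'" by (auto simp: setsF)
    have AM: "A \<in> sets M" using A F by (auto simp: subalgebra_def)
    have "emeasure ?r (A \<times> B) = emeasure M ((\<lambda>\<omega>. (\<omega>, b \<omega>)) -` (A \<times> B) \<inter> space M)"
      using A B idF by (intro emeasure_distr) auto
    also have "(\<lambda>\<omega>. (\<omega>, b \<omega>)) -` (A \<times> B) \<inter> space M = A \<inter> (b -` B \<inter> space M)" by auto
    finally show "emeasure (restr_to_subalg M F) A * emeasure (distr M N' b) B = emeasure ?r (A \<times> B)"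
      using A B indep[OF A B]
      by (simp add: emeasure_restr_to_subalg[OF F] emeasure_distr emeasure_M ennreal_mult)
  qed
  have gM[measurable]: "g \<in> borel_measurable M" using g(1) by auto
  show "AE \<omega> in M. cond_exp_vec M F g \<omega> = \<phi> (\<xi> \<omega>)"
  proof (rule F.cond_exp_vec_eqI)
    fix i :: 'b assume i: "i \<in> Basis"
    define h where "h a = (\<integral>y. \<Phi> (a, y) \<bullet> i \<partial>distr M N' b)" for a
    have [measurable]: "h \<in> borel_measurable N" unfolding h_def by (rule meas\<phi>)
    have \<xi>R[measurable]: "\<xi> \<in> restr_to_subalg M F \<rightarrow>\<^sub>M N" using \<xi> setsF by (simp cong: measurable_cong_sets)
    have key: "integrable M (\<lambda>\<omega>. indicat_real A \<omega> * h (\<xi> \<omega>))"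
      "(\<integral>\<omega>. indicat_real A \<omega> * h (\<xi> \<omega>) \<partial>M) = (\<integral>\<omega>. indicat_real A \<omega> * (g \<omega> \<bullet> i) \<partial>M)" if A: "A \<in> sets F" for A
    proof -
      have AM[measurable]: "A \<in> sets M" using A F by (auto simp: subalgebra_def)
      have AR[measurable]: "A \<in> sets (restr_to_subalg M F)" using A setsF by simp
      define H where "H = (\<lambda>(\<omega>, y). indicat_real A \<omega> * (\<Phi> (\<xi> \<omega>, y) \<bullet> i))"
      have HF: "H \<in> borel_measurable (F \<Otimes>\<^sub>M N')"
      proof -
        have "(\<lambda>p. \<Phi> (\<xi> (fst p), snd p)) \<in> borel_measurable (F \<Otimes>\<^sub>M N')"
          by (rule measurable_compose[OF _ \<Phi>])
             (intro measurable_Pair measurable_compose[OF measurable_fst \<xi>] measurable_snd)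
        moreover have "(\<lambda>p. indicat_real A (fst p)) \<in> borel_measurable (F \<Otimes>\<^sub>M N')"
          by (rule measurable_compose[OF measurable_fst borel_measurable_indicator[OF A]])
        ultimately show ?thesis
          unfolding H_def case_prod_beta by (intro borel_measurable_times borel_measurable_inner borel_measurable_const)
      qed
      have pairm: "(\<lambda>\<omega>. (\<omega>, b \<omega>)) \<in> M \<rightarrow>\<^sub>M F \<Otimes>\<^sub>M N'" using idF by measurable
      have gA: "integrable M (\<lambda>\<omega>. indicat_real A \<omega> * (g \<omega> \<bullet> i))"
        using integrable_mult_indicator[OF AM, of "\<lambda>\<omega>. g \<omega> \<bullet> i"] g by simp
      have AEH: "AE \<omega> in M. indicat_real A \<omega> * (g \<omega> \<bullet> i) = H (\<omega>, b \<omega>)"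
        using g(2) by eventually_elim (simp add: H_def)
      have HM: "(\<lambda>\<omega>. H (\<omega>, b \<omega>)) \<in> borel_measurable M" unfolding H_def by measurable
      have "integrable M (\<lambda>\<omega>. H (\<omega>, b \<omega>))"
        using gA HM by (subst integrable_cong_AE[OF _ _ AEH, symmetric]) auto
      then have intH: "integrable (restr_to_subalg M F \<Otimes>\<^sub>M distr M N' b) (\<lambda>(\<omega>, y). H (\<omega>, y))"
        unfolding joint using HF by (subst integrable_distr_eq[OF pairm]) auto
      have Hy: "(\<integral>y. H (\<omega>, y) \<partial>distr M N' b) = indicat_real A \<omega> * h (\<xi> \<omega>)" for \<omega>
        by (simp add: H_def h_def)
      have 1: "integrable (restr_to_subalg M F) (\<lambda>\<omega>. indicat_real A \<omega> * h (\<xi> \<omega>))"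
        using integrable_fst'[OF intH[unfolded case_prod_eta]] by (simp add: Hy)
      have hF: "(\<lambda>\<omega>. indicat_real A \<omega> * h (\<xi> \<omega>)) \<in> borel_measurable F" using A \<xi> by measurable
      show "integrable M (\<lambda>\<omega>. indicat_real A \<omega> * h (\<xi> \<omega>))" by (rule integrable_from_subalg[OF F 1])
      have "(\<integral>\<omega>. indicat_real A \<omega> * h (\<xi> \<omega>) \<partial>M) = (\<integral>\<omega>. indicat_real A \<omega> * h (\<xi> \<omega>) \<partial>restr_to_subalg M F)"
        by (rule integral_subalgebra2[OF F hF, symmetric])
      also have "\<dots> = (\<integral>p. H p \<partial>(restr_to_subalg M F \<Otimes>\<^sub>M distr M N' b))"
        using integral_fst'[OF intH[unfolded case_prod_eta]] by (simp add: Hy)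
      also have "\<dots> = (\<integral>\<omega>. H (\<omega>, b \<omega>) \<partial>M)"
        unfolding joint by (rule integral_distr[OF pairm HF])
      also have "\<dots> = (\<integral>\<omega>. indicat_real A \<omega> * (g \<omega> \<bullet> i) \<partial>M)"
        using AEH by (intro integral_cong_AE HM) auto
      finally show "(\<integral>\<omega>. indicat_real A \<omega> * h (\<xi> \<omega>) \<partial>M) = (\<integral>\<omega>. indicat_real A \<omega> * (g \<omega> \<bullet> i) \<partial>M)" .
    qed
    have "AE \<omega> in M. real_cond_exp M F (\<lambda>\<omega>. g \<omega> \<bullet> i) \<omega> = h (\<xi> \<omega>)"
    proof (rule F.real_cond_exp_charact)
      show "integrable M (\<lambda>\<omega>. g \<omega> \<bullet> i)" using g by simp
      have "space M \<in> sets F" using spF sets.top[of F] by simp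
      note key(1)[OF this]
      also have "integrable M (\<lambda>\<omega>. indicat_real (space M) \<omega> * h (\<xi> \<omega>)) = integrable M (\<lambda>\<omega>. h (\<xi> \<omega>))"
        by (intro Bochner_Integration.integrable_cong refl) simp
      finally show "integrable M (\<lambda>\<omega>. h (\<xi> \<omega>))" .
      show "(\<lambda>\<omega>. h (\<xi> \<omega>)) \<in> borel_measurable F" using \<xi> by measurable
      show "(\<integral>\<omega>\<in>A. g \<omega> \<bullet> i \<partial>M) = (\<integral>\<omega>\<in>A. h (\<xi> \<omega>) \<partial>M)" if "A \<in> sets F" for A
        using key(2)[OF that] by (simp add: set_lebesgue_integral_def)
    qed
    then show "AE \<omega> in M. real_cond_exp M F (\<lambda>\<omega>. g \<omega> \<bullet> i) \<omega> = \<phi> (\<xi> \<omega>) \<bullet> i"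
      using i by (simp add: \<phi>_def h_def inner_sum_left_Basis)
  qed
qed

section \<open>The stochastic problem\<close>

lemma U_as_cong:
  assumes "AE \<omega> in M. \<Gamma> \<omega> = \<Gamma>' \<omega>" shows "U_as M S \<Gamma> = U_as M S \<Gamma>'"
proof -
  have "(AE \<omega> in M. u \<omega> \<in> \<Gamma> \<omega>) \<longleftrightarrow> (AE \<omega> in M. u \<omega> \<in> \<Gamma>' \<omega>)" for u
    using assms by (auto elim: eventually_elim2)
  then show ?thesis by (simp add: U_as_def)
qed

text \<open>Already specialised to the noise filtration and to constant constraint sets
  \<open>\<Gamma>0\<close>; observation algebras and random constraint sets are reduced to these
  when solutions are translated.\<close>

locale stochastic_control_problem = prob_space M + control_problem T X W U f L K
  for M :: "'a measure" and T :: nat and X W :: "nat \<Rightarrow> 'e::euclidean_space set"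
    and U :: "nat \<Rightarrow> 'u::euclidean_space set" and f L and K :: "'e \<Rightarrow> real" +
  fixes w :: "nat \<Rightarrow> 'a \<Rightarrow> 'e" and \<Gamma>0 :: "nat \<Rightarrow> 'u set"
  assumes subspace_W: "t \<le> T \<Longrightarrow> subspace (W t)"
    and w_RV: "t \<le> T \<Longrightarrow> w t \<in> RV M (W t)"
    and \<Gamma>0: "t < T \<Longrightarrow> closed (\<Gamma>0 t)" "t < T \<Longrightarrow> convex (\<Gamma>0 t)"
    and L_normal: "t < T \<Longrightarrow> normal_integrand (restrict_space borel (W (Suc t))) (X t \<times> U t)
                          (\<lambda>b (a, v). ereal (L t a v b))"
    and f_normal: "t < T \<Longrightarrow> i \<in> Basis \<Longrightarrow>
           normal_integrand (restrict_space borel (W (Suc t))) (X t \<times> U t)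
             (\<lambda>b (a, v). ereal (f t a v b \<bullet> i))"
    and square_integrable: "derivatives_square_integrable M T X U f L K w"
    and indep_w: "indep_vars (\<lambda>_. borel) w {..T}"
begin

section \<open>The noise filtration and measurability along trajectories\<close>

lemma w_measurable[measurable]: "t \<le> T \<Longrightarrow> w t \<in> borel_measurable M"
  using w_RV[of t] by (simp add: RV_def)

lemma w_in: "t \<le> T \<Longrightarrow> \<omega> \<in> space M \<Longrightarrow> w t \<omega> \<in> W t"
  using w_RV[of t] by (simp add: RV_def)

abbreviation F where "F \<equiv> noise_algebra M w"

lemma space_F[simp]: "space (F t) = space M"
  by (simp add: noise_algebra_def)

lemma noise_in_space: "(\<lambda>\<omega>. \<lambda>s\<in>I. w s \<omega>) \<in> space M \<rightarrow> space (PiM I (\<lambda>_. borel))"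
  by (auto simp: space_PiM)

lemma w_F:
  assumes "s \<le> t" shows "w s \<in> borel_measurable (F t)"
proof -
  have "(\<lambda>\<omega>. \<lambda>s\<in>{..t}. w s \<omega>) \<in> F t \<rightarrow>\<^sub>M PiM {..t} (\<lambda>_. borel)"
    unfolding noise_algebra_def by (rule measurable_vimage_algebra1[OF noise_in_space])
  from measurable_compose[OF this measurable_component_singleton[of s]] assms show ?thesis by simp
qed

lemma subalgebra_F:
  assumes "t \<le> T"
  shows "subalgebra M (F t)"
proof -
  have "(\<lambda>\<omega>. \<lambda>s\<in>{..t}. w s \<omega>) \<in> M \<rightarrow>\<^sub>M PiM {..t} (\<lambda>_. borel)"
    using assms by (intro measurable_restrict) auto
  from measurable_sets[OF this] show ?thesis
    by (auto simp: subalgebra_def noise_algebra_def sets_vimage_algebra2[OF noise_in_space])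
qed

lemma measurable_noise_restrict:
  assumes "I \<subseteq> {..t}"
  shows "(\<lambda>\<omega>. \<lambda>s\<in>I. w s \<omega>) \<in> F t \<rightarrow>\<^sub>M PiM I (\<lambda>_. borel)"
  using assms by (intro measurable_restrict w_F) auto

lemma sets_F_mono:
  assumes "s \<le> t" shows "sets (F s) \<subseteq> sets (F t)"
  using measurable_sets[OF measurable_noise_restrict[of "{..s}" t]] assms
  by (auto simp: noise_algebra_def[of M w s] sets_vimage_algebra2[OF noise_in_space])

lemma measurable_F_mono: "g \<in> F s \<rightarrow>\<^sub>M N \<Longrightarrow> s \<le> t \<Longrightarrow> g \<in> F t \<rightarrow>\<^sub>M N"
  using sets_F_mono[of s t] by (auto simp: measurable_def)

lemma measurable_F_M: "g \<in> F t \<rightarrow>\<^sub>M N \<Longrightarrow> t \<le> T \<Longrightarrow> g \<in> M \<rightarrow>\<^sub>M N"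
  by (rule measurable_from_subalg[OF subalgebra_F])

text \<open>The arguments live on an arbitrary measurable space \<open>A\<close>, because the
  statement is applied on the probability space, on its noise sigma-algebras and on product spaces
  that carry joint laws.\<close>

lemma measurable_L:
  assumes t: "t < T" and [measurable]: "a \<in> borel_measurable A" "v \<in> borel_measurable A" "b \<in> borel_measurable A"
    and "\<And>\<alpha>. \<alpha> \<in> space A \<Longrightarrow> a \<alpha> \<in> X t" "\<And>\<alpha>. \<alpha> \<in> space A \<Longrightarrow> v \<alpha> \<in> U t" "\<And>\<alpha>. \<alpha> \<in> space A \<Longrightarrow> b \<alpha> \<in> W (Suc t)"
  shows "(\<lambda>\<alpha>. L t (a \<alpha>) (v \<alpha>) (b \<alpha>)) \<in> borel_measurable A"
proof -
  have "normal_integrand (restrict_space borel (W (Suc t))) (X t \<times> U t) (\<lambda>b p. ereal (case p of (a, v) \<Rightarrow> L t a v b))"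
    using L_normal[OF t] by (simp add: case_prod_beta')
  from measurable_normal_integrand[OF this, of b A "\<lambda>\<alpha>. (a \<alpha>, v \<alpha>)"] assms show ?thesis
    by (simp add: measurable_restrict_space2)
qed

lemma measurable_f:
  assumes t: "t < T" and [measurable]: "a \<in> borel_measurable A" "v \<in> borel_measurable A" "b \<in> borel_measurable A"
    and "\<And>\<alpha>. \<alpha> \<in> space A \<Longrightarrow> a \<alpha> \<in> X t" "\<And>\<alpha>. \<alpha> \<in> space A \<Longrightarrow> v \<alpha> \<in> U t" "\<And>\<alpha>. \<alpha> \<in> space A \<Longrightarrow> b \<alpha> \<in> W (Suc t)"
  shows "(\<lambda>\<alpha>. f t (a \<alpha>) (v \<alpha>) (b \<alpha>)) \<in> borel_measurable A"
proof (rule borel_measurable_euclidean_space[THEN iffD2], rule ballI)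
  fix i :: 'e assume i: "i \<in> Basis"
  have "normal_integrand (restrict_space borel (W (Suc t))) (X t \<times> U t) (\<lambda>b p. ereal (case p of (a, v) \<Rightarrow> f t a v b \<bullet> i))"
    using f_normal[OF t i] by (simp add: case_prod_beta')
  from measurable_normal_integrand[OF this, of b A "\<lambda>\<alpha>. (a \<alpha>, v \<alpha>)"] assms
  show "(\<lambda>\<alpha>. f t (a \<alpha>) (v \<alpha>) (b \<alpha>) \<bullet> i) \<in> borel_measurable A"
    by (simp add: measurable_restrict_space2)
qed

lemma measurable_derivatives:
  assumes t: "t < T" and a: "a \<in> borel_measurable A" and v: "v \<in> borel_measurable A" and b: "b \<in> borel_measurable A"
    and aX: "\<And>\<alpha>. \<alpha> \<in> space A \<Longrightarrow> a \<alpha> \<in> X t" and vU: "\<And>\<alpha>. \<alpha> \<in> space A \<Longrightarrow> v \<alpha> \<in> U t"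
    and bW: "\<And>\<alpha>. \<alpha> \<in> space A \<Longrightarrow> b \<alpha> \<in> W (Suc t)"
  shows "(\<lambda>\<alpha>. dLx X L t (a \<alpha>) (v \<alpha>) (b \<alpha>)) \<in> borel_measurable A"
    "(\<lambda>\<alpha>. dLu U L t (a \<alpha>) (v \<alpha>) (b \<alpha>)) \<in> borel_measurable A"
    "(\<lambda>\<alpha>. dfx X f t (a \<alpha>) (v \<alpha>) (b \<alpha>) y) \<in> borel_measurable A"
    "(\<lambda>\<alpha>. dfu U f t (a \<alpha>) (v \<alpha>) (b \<alpha>) y) \<in> borel_measurable A"
proof -
  have sX: "subspace (X t)" and sU: "subspace (U t)" using t subspace_X subspace_U by auto
  have L': "\<exists>L'. ((\<lambda>(a, v). L t a v (b \<alpha>)) has_derivative L') (at (a \<alpha>, v \<alpha>) within X t \<times> U t)"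
    if "\<alpha> \<in> space A" for \<alpha>
    using aX[OF that] vU[OF that] by (intro C1_on_differentiable L_C1[OF t bW[OF that]]) simp
  have f': "\<exists>f'. ((\<lambda>(a, v). f t a v (b \<alpha>)) has_derivative f') (at (a \<alpha>, v \<alpha>) within X t \<times> U t)"
    if "\<alpha> \<in> space A" for \<alpha>
    using aX[OF that] vU[OF that] by (intro C1_on_differentiable f_C1[OF t bW[OF that]]) simp
  show "(\<lambda>\<alpha>. dLx X L t (a \<alpha>) (v \<alpha>) (b \<alpha>)) \<in> borel_measurable A"
    unfolding dLx_def grad_on_def
  proof (rule borel_measurable_adj_deriv[OF sX a aX])
    show "\<exists>G'. ((\<lambda>a. L t a (v \<alpha>) (b \<alpha>)) has_derivative G') (at (a \<alpha>) within X t)" if "\<alpha> \<in> space A" for \<alpha>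
      using L'[OF that] by (elim exE) (rule exI, erule partial_derivatives(1)[OF t _ aX[OF that] vU[OF that]])
  qed (use measurable_L[OF t _ v b _ vU bW] in auto)
  show "(\<lambda>\<alpha>. dLu U L t (a \<alpha>) (v \<alpha>) (b \<alpha>)) \<in> borel_measurable A"
    unfolding dLu_def grad_on_def
  proof (rule borel_measurable_adj_deriv[OF sU v vU])
    show "\<exists>G'. ((\<lambda>v. L t (a \<alpha>) v (b \<alpha>)) has_derivative G') (at (v \<alpha>) within U t)" if "\<alpha> \<in> space A" for \<alpha>
      using L'[OF that] by (elim exE) (rule exI, erule partial_derivatives(2)[OF t _ aX[OF that] vU[OF that]])
  qed (use measurable_L[OF t a _ b aX _ bW] in auto)
  show "(\<lambda>\<alpha>. dfx X f t (a \<alpha>) (v \<alpha>) (b \<alpha>) y) \<in> borel_measurable A"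
    unfolding dfx_def
  proof (rule borel_measurable_adj_deriv[OF sX a aX])
    show "\<exists>G'. ((\<lambda>a. f t a (v \<alpha>) (b \<alpha>)) has_derivative G') (at (a \<alpha>) within X t)" if "\<alpha> \<in> space A" for \<alpha>
      using f'[OF that] by (elim exE) (rule exI, erule partial_derivatives(1)[OF t _ aX[OF that] vU[OF that]])
  qed (use measurable_f[OF t _ v b _ vU bW] in auto)
  show "(\<lambda>\<alpha>. dfu U f t (a \<alpha>) (v \<alpha>) (b \<alpha>) y) \<in> borel_measurable A"
    unfolding dfu_def
  proof (rule borel_measurable_adj_deriv[OF sU v vU])
    show "\<exists>G'. ((\<lambda>v. f t (a \<alpha>) v (b \<alpha>)) has_derivative G') (at (v \<alpha>) within U t)" if "\<alpha> \<in> space A" for \<alpha>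
      using f'[OF that] by (elim exE) (rule exI, erule partial_derivatives(2)[OF t _ aX[OF that] vU[OF that]])
  qed (use measurable_f[OF t a _ b aX _ bW] in auto)
qed

lemma measurable_traj:
  fixes A :: "'c measure"
  assumes "\<And>s. s < t \<Longrightarrow> (\<lambda>\<alpha>. v \<alpha> s) \<in> borel_measurable A" "\<And>s. s \<le> t \<Longrightarrow> (\<lambda>\<alpha>. b \<alpha> s) \<in> borel_measurable A"
    and v: "\<And>\<alpha> s. \<alpha> \<in> space A \<Longrightarrow> s < T \<Longrightarrow> v \<alpha> s \<in> U s" and b: "\<And>\<alpha> s. \<alpha> \<in> space A \<Longrightarrow> s \<le> T \<Longrightarrow> b \<alpha> s \<in> W s"
    and "t \<le> T"
  shows "(\<lambda>\<alpha>. traj f (v \<alpha>) (b \<alpha>) t) \<in> borel_measurable A"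
  using assms(1,2,5)
proof (induction t)
  case (Suc t)
  have "(\<lambda>\<alpha>. f t (traj f (v \<alpha>) (b \<alpha>) t) (v \<alpha> t) (b \<alpha> (Suc t))) \<in> borel_measurable A"
    using Suc v b traj_in[of "v _" "b _" t] by (intro measurable_f) auto
  then show ?case by simp
qed simp

lemma continuous_K: "continuous_on (X T) K"
  unfolding continuous_on_eq_continuous_within
  using C1_on_differentiable[OF K_C1] has_derivative_continuous by blast

lemma measurable_K:
  assumes "a \<in> borel_measurable A" and "\<And>\<alpha>. \<alpha> \<in> space A \<Longrightarrow> a \<alpha> \<in> X T"
  shows "(\<lambda>\<alpha>. K (a \<alpha>)) \<in> borel_measurable A"
proof -
  have "a \<in> A \<rightarrow>\<^sub>M restrict_space borel (X T)" using assms by (simp add: measurable_restrict_space2)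
  from measurable_compose[OF this borel_measurable_continuous_on_restrict[OF continuous_K]] show ?thesis .
qed

lemma measurable_grad_K:
  assumes a: "a \<in> borel_measurable A" and aX: "\<And>\<alpha>. \<alpha> \<in> space A \<Longrightarrow> a \<alpha> \<in> X T"
  shows "(\<lambda>\<alpha>. grad_on (X T) K (a \<alpha>)) \<in> borel_measurable A"
  unfolding grad_on_def
proof (rule borel_measurable_adj_deriv[OF subspace_X[OF order_refl] a aX])
  show "\<exists>G'. (K has_derivative G') (at (a \<alpha>) within X T)" if "\<alpha> \<in> space A" for \<alpha>
    by (rule C1_on_differentiable[OF K_C1 aX[OF that]])
qed (auto intro: measurable_K)

section \<open>The problem after elimination of the state, and its first variation\<close>

definition cost :: "(nat \<Rightarrow> 'a \<Rightarrow> 'u) \<Rightarrow> real" where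
  "cost u = (\<integral>\<omega>. total_cost T f L K (\<lambda>s. u s \<omega>) (\<lambda>s. w s \<omega>) \<partial>M)"

definition admissible :: "(nat \<Rightarrow> 'a \<Rightarrow> 'u) \<Rightarrow> bool" where
  "admissible u \<longleftrightarrow> (\<forall>t<T. u t \<in> L2 M (U t) \<and> u t \<in> borel_measurable (F t) \<and> (AE \<omega> in M. u t \<omega> \<in> \<Gamma>0 t))"

definition optimal :: "(nat \<Rightarrow> 'a \<Rightarrow> 'u) \<Rightarrow> bool" where
  "optimal u \<longleftrightarrow> admissible u \<and> (\<forall>v. admissible v \<longrightarrow> cost u \<le> cost v)"

lemma admissible_controls: "admissible u \<Longrightarrow> u \<in> controls M T U"
  by (simp add: admissible_def controls_def)

lemma controls_in: "u \<in> controls M T U \<Longrightarrow> s < T \<Longrightarrow> \<omega> \<in> space M \<Longrightarrow> u s \<omega> \<in> U s"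
  by (auto simp: controls_def L2_def RV_def)

lemma controls_measurable: "u \<in> controls M T U \<Longrightarrow> s < T \<Longrightarrow> u s \<in> borel_measurable M"
  by (auto simp: controls_def L2_def RV_def)

lemma controls_upd: "u \<in> controls M T U \<Longrightarrow> v \<in> L2 M (U t) \<Longrightarrow> u(t := v) \<in> controls M T U"
  by (auto simp: controls_def)

abbreviation state :: "(nat \<Rightarrow> 'a \<Rightarrow> 'u) \<Rightarrow> nat \<Rightarrow> 'a \<Rightarrow> 'e" where
  "state u t \<omega> \<equiv> traj f (\<lambda>s. u s \<omega>) (\<lambda>s. w s \<omega>) t"

abbreviation costates :: "(nat \<Rightarrow> 'a \<Rightarrow> 'u) \<Rightarrow> nat \<Rightarrow> 'a \<Rightarrow> 'e" where
  "costates u t \<omega> \<equiv> costate T X f L K (\<lambda>s. u s \<omega>) (\<lambda>s. w s \<omega>) t"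

abbreviation djus :: "(nat \<Rightarrow> 'a \<Rightarrow> 'u) \<Rightarrow> nat \<Rightarrow> 'a \<Rightarrow> 'u" where
  "djus u t \<omega> \<equiv> dju T U f L K (\<lambda>s. u s \<omega>) (\<lambda>s. w s \<omega>) t"

lemma integrable_total_cost:
  "u \<in> controls M T U \<Longrightarrow> integrable M (\<lambda>\<omega>. total_cost T f L K (\<lambda>s. u s \<omega>) (\<lambda>s. w s \<omega>))"
  using square_integrable by (auto simp: derivatives_square_integrable_def Let_def)

lemma L2_derivatives:
  assumes "u \<in> controls M T U" "t < T"
  shows "(\<lambda>\<omega>. dLx X L t (state u t \<omega>) (u t \<omega>) (w (Suc t) \<omega>)) \<in> L2 M (X t)"
    "(\<lambda>\<omega>. dLu U L t (state u t \<omega>) (u t \<omega>) (w (Suc t) \<omega>)) \<in> L2 M (U t)"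
    "y \<in> X (Suc t) \<Longrightarrow> (\<lambda>\<omega>. dfx X f t (state u t \<omega>) (u t \<omega>) (w (Suc t) \<omega>) y) \<in> L2 M (X t)"
    "y \<in> X (Suc t) \<Longrightarrow> (\<lambda>\<omega>. dfu U f t (state u t \<omega>) (u t \<omega>) (w (Suc t) \<omega>) y) \<in> L2 M (U t)"
    "djus u t \<in> L2 M (U t)"
  using square_integrable assms by (auto simp: derivatives_square_integrable_def Let_def)

lemma L2_costates: "u \<in> controls M T U \<Longrightarrow> t \<le> T \<Longrightarrow> costates u t \<in> L2 M (X t)"
  using square_integrable by (auto simp: derivatives_square_integrable_def Let_def)

lemma state_in:
  assumes "u \<in> controls M T U" "t \<le> T" "\<omega> \<in> space M" shows "state u t \<omega> \<in> X t"
  using assms by (intro traj_in) (auto simp: controls_in w_in)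

lemma state_F:
  assumes u: "u \<in> controls M T U" "\<And>s. s < t \<Longrightarrow> u s \<in> borel_measurable (F s)" and t: "t \<le> T"
  shows "state u t \<in> borel_measurable (F t)"
proof (rule measurable_traj[OF _ _ _ _ t])
  show "u s \<in> borel_measurable (F t)" if "s < t" for s
    using measurable_F_mono[OF u(2)[OF that]] that by simp
qed (use u(1) in \<open>auto intro: w_F controls_in w_in\<close>)

lemma state_M:
  assumes u: "u \<in> controls M T U" and t: "t \<le> T"
  shows "state u t \<in> borel_measurable M"
  using assms by (intro measurable_traj) (auto intro: controls_measurable controls_in w_in)

text \<open>The perturbation \<open>\<theta>\<close> is a measurable selection nearly maximising the derivative along the segment.  As
  \<open>u + \<theta> (v - u)\<close> is again square integrable, the derivative there is integrable, so it dominates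
  the difference quotients.\<close>

lemma path_derivative_dominated:
  assumes u: "u \<in> controls M T U" and t: "t < T" and h: "h \<in> L2 M (U t)"
  obtains D where "integrable M D"
    "\<And>\<omega> \<sigma>. \<omega> \<in> space M \<Longrightarrow> 0 < \<sigma> \<Longrightarrow> \<sigma> < 1 \<Longrightarrow>
      \<bar>djus (u(t := \<lambda>\<omega>. u t \<omega> + \<sigma> *\<^sub>R h \<omega>)) t \<omega> \<bullet> h \<omega>\<bar> \<le> D \<omega>"
proof -
  define g' where "g' \<omega> \<sigma> = dju T U f L K ((\<lambda>s. u s \<omega>)(t := u t \<omega> + \<sigma> *\<^sub>R h \<omega>)) (\<lambda>s. w s \<omega>) t \<bullet> h \<omega>" for \<omega> \<sigma>
  have upd: "(\<lambda>s. (u(t := \<lambda>\<omega>. u t \<omega> + \<theta> \<omega> *\<^sub>R h \<omega>)) s \<omega>) = (\<lambda>s. u s \<omega>)(t := u t \<omega> + \<theta> \<omega> *\<^sub>R h \<omega>)" for \<theta> \<omega>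
    by auto
  have cont: "continuous_on UNIV (g' \<omega>)" if "\<omega> \<in> space M" for \<omega>
    unfolding g'_def using controls_in[OF u _ that] w_in[OF _ that] L2_in[OF h that]
    by (intro total_cost_path(2) t)
  have ut: "u t \<in> L2 M (U t)" using u t by (simp add: controls_def)
  have g'int: "integrable M (\<lambda>\<omega>. g' \<omega> (\<theta> \<omega>))"
    if [measurable]: "\<theta> \<in> borel_measurable M" and "\<And>\<omega>. \<bar>\<theta> \<omega>\<bar> \<le> 1" for \<theta>
  proof -
    have "u(t := \<lambda>\<omega>. u t \<omega> + \<theta> \<omega> *\<^sub>R h \<omega>) \<in> controls M T U"
      by (intro controls_upd u L2_add_scaleR subspace_U t ut h that)
    from L2_integrable_inner[OF L2_derivatives(5)[OF this t] h] show ?thesis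
      by (simp add: g'_def upd del: fun_upd_apply)
  qed
  define q where "q = from_nat_into (\<rat> \<inter> {0<..<1::real})"
  have neQ: "\<rat> \<inter> {0<..<1::real} \<noteq> {}" using Rats_dense_in_real[of 0 1] by auto
  have countQ: "countable (\<rat> \<inter> {0<..<1::real})" by (rule countable_subset[OF _ countable_rat]) auto
  have q: "q n \<in> {0<..<1}" for n using from_nat_into[OF neQ, of n] by (simp add: q_def)
  have g'q[measurable]: "(\<lambda>\<omega>. g' \<omega> (q n)) \<in> borel_measurable M" for n
    using g'int[of "\<lambda>_. q n"] q[of n] by auto
  \<comment> \<open>The supremum over the rational points is finite, the derivative being continuous
    on a compact segment, but need not be attained; the slack 1 guarantees an index. Taking the
    least one makes the choice measurable.\<close>
  define N where "N \<omega> = (LEAST n. \<forall>m. \<bar>g' \<omega> (q m)\<bar> \<le> \<bar>g' \<omega> (q n)\<bar> + 1)" for \<omega>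
  have [measurable]: "N \<in> M \<rightarrow>\<^sub>M count_space UNIV" unfolding N_def by measurable
  define \<theta> where "\<theta> \<omega> = q (N \<omega>)" for \<omega>
  have [measurable]: "\<theta> \<in> borel_measurable M" unfolding \<theta>_def by measurable
  have N: "\<bar>g' \<omega> (q m)\<bar> \<le> \<bar>g' \<omega> (\<theta> \<omega>)\<bar> + 1" if \<omega>: "\<omega> \<in> space M" for \<omega> m
  proof -
    have "compact (g' \<omega> ` {0..1})"
      by (intro compact_continuous_image continuous_on_subset[OF cont[OF \<omega>]]) auto
    then obtain C where "\<forall>y\<in>g' \<omega> ` {0..1}. norm y \<le> C"
      using compact_imp_bounded bounded_iff by metis
    then have C: "\<bar>g' \<omega> \<sigma>\<bar> \<le> C" if "\<sigma> \<in> {0..1}" for \<sigma> using that by simp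
    have bdd: "bdd_above (range (\<lambda>m. \<bar>g' \<omega> (q m)\<bar>))"
      by (intro bdd_aboveI2[where M=C] C) (use q in \<open>auto simp: less_imp_le\<close>)
    have "(SUP m. \<bar>g' \<omega> (q m)\<bar>) - 1 < (SUP m. \<bar>g' \<omega> (q m)\<bar>)" by simp
    then obtain n where "(SUP m. \<bar>g' \<omega> (q m)\<bar>) - 1 < \<bar>g' \<omega> (q n)\<bar>"
      using less_cSUP_iff[OF _ bdd] by auto
    moreover have "\<bar>g' \<omega> (q m)\<bar> \<le> (SUP m. \<bar>g' \<omega> (q m)\<bar>)" for m by (rule cSUP_upper[OF _ bdd]) simp
    ultimately have "\<forall>m. \<bar>g' \<omega> (q m)\<bar> \<le> \<bar>g' \<omega> (q n)\<bar> + 1" by (meson add.commute diff_less_eq less_imp_le order_trans)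
    then show ?thesis
      unfolding \<theta>_def N_def by (rule LeastI2[where Q="\<lambda>n. \<bar>g' \<omega> (q m)\<bar> \<le> \<bar>g' \<omega> (q n)\<bar> + 1"]) blast
  qed
  show ?thesis
  proof (rule that)
    show "integrable M (\<lambda>\<omega>. \<bar>g' \<omega> (\<theta> \<omega>)\<bar> + 1)"
    proof (intro Bochner_Integration.integrable_add integrable_abs g'int)
      show "\<bar>\<theta> \<omega>\<bar> \<le> 1" for \<omega> using q[of "N \<omega>"] by (simp add: \<theta>_def)
    qed auto
    fix \<omega> \<sigma> assume \<omega>: "\<omega> \<in> space M" and \<sigma>: "0 < \<sigma>" "\<sigma> < (1::real)"
    have "\<bar>g' \<omega> \<sigma>\<bar> \<le> \<bar>g' \<omega> (\<theta> \<omega>)\<bar> + 1"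
    proof (rule ccontr)
      assume not: "\<not> \<bar>g' \<omega> \<sigma>\<bar> \<le> \<bar>g' \<omega> (\<theta> \<omega>)\<bar> + 1"
      \<comment> \<open>So far the bound is known at rational points. By continuity the set where it
        fails is open, so it would contain a rational point.\<close>
      define V where "V = {\<sigma>. \<bar>g' \<omega> (\<theta> \<omega>)\<bar> + 1 < \<bar>g' \<omega> \<sigma>\<bar>} \<inter> {0<..<1}"
      have "open V"
        unfolding V_def using cont[OF \<omega>] by (intro open_Int open_Collect_less continuous_intros) auto
      moreover have "\<sigma> \<in> V" using not \<sigma> by (simp add: V_def)
      ultimately obtain e where e: "0 < e" "ball \<sigma> e \<subseteq> V" using open_contains_ball by blast
      obtain r where r: "r \<in> \<rat>" "\<sigma> < r" "r < \<sigma> + e" using Rats_dense_in_real[of \<sigma> "\<sigma> + e"] e(1) by auto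
      then have "r \<in> V" using e(2) by (auto simp: dist_real_def)
      then have "r \<in> \<rat> \<inter> {0<..<1}" using r by (auto simp: V_def)
      then obtain m where "q m = r" using from_nat_into_surj[OF countQ] unfolding q_def by blast
      then show False using N[OF \<omega>, of m] \<open>r \<in> V\<close> by (simp add: V_def)
    qed
    then show "\<bar>djus (u(t := \<lambda>\<omega>. u t \<omega> + \<sigma> *\<^sub>R h \<omega>)) t \<omega> \<bullet> h \<omega>\<bar> \<le> \<bar>g' \<omega> (\<theta> \<omega>)\<bar> + 1"
      using upd[of "\<lambda>_. \<sigma>"] by (simp add: g'_def del: fun_upd_apply)
  qed
qed

text \<open>Optimality makes the difference quotients of the cost nonnegative along the segment
  towards \<open>v\<close>. The mean value theorem bounds them by the dominating function, so the
  limit may be taken under the integral.\<close>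

lemma first_variation:
  assumes u: "optimal u" and t: "t < T"
    and v: "v \<in> L2 M (U t)" "v \<in> borel_measurable (F t)" "AE \<omega> in M. v \<omega> \<in> \<Gamma>0 t"
  shows "0 \<le> (\<integral>\<omega>. djus u t \<omega> \<bullet> (v \<omega> - u t \<omega>) \<partial>M)"
proof -
  have adm: "admissible u" using u by (simp add: optimal_def)
  then have uc: "u \<in> controls M T U" by (rule admissible_controls)
  have ut: "u t \<in> L2 M (U t)" "u t \<in> borel_measurable (F t)" "AE \<omega> in M. u t \<omega> \<in> \<Gamma>0 t"
    using adm t by (auto simp: admissible_def)
  define h where "h \<omega> = v \<omega> - u t \<omega>" for \<omega>
  have h: "h \<in> L2 M (U t)" unfolding h_def by (intro L2_diff subspace_U t v ut)
  have hF: "h \<in> borel_measurable (F t)" unfolding h_def using v(2) ut(2) by measurable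
  define j where "j \<omega> \<sigma> = total_cost T f L K ((\<lambda>s. u s \<omega>)(t := u t \<omega> + \<sigma> *\<^sub>R h \<omega>)) (\<lambda>s. w s \<omega>)" for \<omega> \<sigma>
  define g' where "g' \<omega> \<sigma> = dju T U f L K ((\<lambda>s. u s \<omega>)(t := u t \<omega> + \<sigma> *\<^sub>R h \<omega>)) (\<lambda>s. w s \<omega>) t \<bullet> h \<omega>" for \<omega> \<sigma>
  have upd: "(\<lambda>s. (u(t := \<lambda>\<omega>. u t \<omega> + \<sigma> *\<^sub>R h \<omega>)) s \<omega>) = (\<lambda>s. u s \<omega>)(t := u t \<omega> + \<sigma> *\<^sub>R h \<omega>)" for \<sigma> \<omega>
    by auto
  have upd0: "(\<lambda>s. u s \<omega>)(t := u t \<omega>) = (\<lambda>s. u s \<omega>)" for \<omega> by auto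
  have deriv: "(j \<omega> has_real_derivative g' \<omega> \<sigma>) (at \<sigma>)" if "\<omega> \<in> space M" for \<omega> \<sigma>
    unfolding j_def g'_def using controls_in[OF uc _ that] w_in[OF _ that] L2_in[OF h that]
    by (intro total_cost_path(1) t)
  obtain D where D: "integrable M D"
    "\<And>\<omega> \<sigma>. \<omega> \<in> space M \<Longrightarrow> 0 < \<sigma> \<Longrightarrow> \<sigma> < 1 \<Longrightarrow> \<bar>g' \<omega> \<sigma>\<bar> \<le> D \<omega>"
    using path_derivative_dominated[OF uc t h] unfolding upd g'_def[symmetric] by metis
  \<comment> \<open>The steps 1/(n+2) stay strictly below 1, within the open interval on which the
    dominating function is valid.\<close>
  define r where "r n = inverse (real (Suc (Suc n)))" for n
  have r: "0 < r n" "r n < 1" for n by (auto simp: r_def field_simps)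
  \<comment> \<open>The later controls are kept as functions of the noise and not of the state, so
    they remain adapted although the perturbation moves the trajectory.\<close>
  have adm_n: "admissible (u(t := \<lambda>\<omega>. u t \<omega> + r n *\<^sub>R h \<omega>))" for n
  proof -
    have "AE \<omega> in M. u t \<omega> + r n *\<^sub>R h \<omega> \<in> \<Gamma>0 t"
      using v(3) ut(3)
    proof eventually_elim
      case (elim \<omega>)
      have "(1 - r n) *\<^sub>R u t \<omega> + r n *\<^sub>R v \<omega> \<in> \<Gamma>0 t"
        using \<Gamma>0(2)[OF t] elim r[of n] by (intro convexD) auto
      then show ?case by (simp add: h_def algebra_simps)
    qed
    moreover have "(\<lambda>\<omega>. u t \<omega> + r n *\<^sub>R h \<omega>) \<in> borel_measurable (F t)" using ut(2) hF by measurable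
    moreover have "(\<lambda>\<omega>. u t \<omega> + r n *\<^sub>R h \<omega>) \<in> L2 M (U t)"
      using r[of n] by (intro L2_add_scaleR subspace_U t ut h) auto
    ultimately show ?thesis using adm by (auto simp: admissible_def)
  qed
  have intj: "integrable M (\<lambda>\<omega>. j \<omega> (r n))" for n
    using integrable_total_cost[OF admissible_controls[OF adm_n[of n]]] by (simp add: j_def upd del: fun_upd_apply)
  have j0: "j \<omega> 0 = total_cost T f L K (\<lambda>s. u s \<omega>) (\<lambda>s. w s \<omega>)" for \<omega> by (simp add: j_def upd0)
  have intj0: "integrable M (\<lambda>\<omega>. j \<omega> 0)"
    using integrable_total_cost[OF uc] by (simp add: j0)
  have opt: "(\<integral>\<omega>. j \<omega> 0 \<partial>M) \<le> (\<integral>\<omega>. j \<omega> (r n) \<partial>M)" for n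
  proof -
    have "cost u \<le> cost (u(t := \<lambda>\<omega>. u t \<omega> + r n *\<^sub>R h \<omega>))" using u adm_n[of n] by (simp add: optimal_def)
    then show ?thesis by (simp add: cost_def upd j0 del: fun_upd_apply) (simp add: j_def)
  qed
  have lim: "(\<lambda>n. \<integral>\<omega>. (j \<omega> (r n) - j \<omega> 0) / r n \<partial>M) \<longlonglongrightarrow> (\<integral>\<omega>. g' \<omega> 0 \<partial>M)"
  proof (rule integral_dominated_convergence)
    have "g' \<omega> 0 = djus u t \<omega> \<bullet> h \<omega>" for \<omega> by (simp add: g'_def upd0)
    then show "(\<lambda>\<omega>. g' \<omega> 0) \<in> borel_measurable M"
      using L2_integrable_inner[OF L2_derivatives(5)[OF uc t] h] by (simp only: borel_measurable_integrable)
    show "(\<lambda>\<omega>. (j \<omega> (r n) - j \<omega> 0) / r n) \<in> borel_measurable M" for n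
      using intj intj0 by measurable
    show "integrable M D" by fact
    show "AE \<omega> in M. (\<lambda>n. (j \<omega> (r n) - j \<omega> 0) / r n) \<longlonglongrightarrow> g' \<omega> 0"
    proof (rule AE_I2)
      fix \<omega> assume "\<omega> \<in> space M"
      from deriv[OF this, of 0] have "((\<lambda>h. (j \<omega> h - j \<omega> 0) / h) \<longlongrightarrow> g' \<omega> 0) (at 0)"
        by (simp add: DERIV_def)
      moreover have "r \<longlonglongrightarrow> 0" unfolding r_def
        by (rule LIMSEQ_Suc[OF LIMSEQ_inverse_real_of_nat])
      then have "filterlim r (at 0) sequentially" using r(1) by (auto simp: filterlim_at intro!: always_eventually less_imp_neq[symmetric])
      ultimately show "(\<lambda>n. (j \<omega> (r n) - j \<omega> 0) / r n) \<longlonglongrightarrow> g' \<omega> 0" by (rule filterlim_compose)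
    qed
    show "AE \<omega> in M. norm ((j \<omega> (r n) - j \<omega> 0) / r n) \<le> D \<omega>" for n
    proof (rule AE_I2)
      fix \<omega> assume \<omega>: "\<omega> \<in> space M"
      obtain z where z: "0 < z" "z < r n" "j \<omega> (r n) - j \<omega> 0 = (r n - 0) * g' \<omega> z"
        using MVT2[OF r(1)[of n], of "j \<omega>" "g' \<omega>"] deriv[OF \<omega>] by blast
      then have "(j \<omega> (r n) - j \<omega> 0) / r n = g' \<omega> z" using r(1)[of n] by simp
      then show "norm ((j \<omega> (r n) - j \<omega> 0) / r n) \<le> D \<omega>" using D(2)[OF \<omega> z(1)] z(2) r(2)[of n] by simp
    qed
  qed
  have "0 \<le> (\<integral>\<omega>. (j \<omega> (r n) - j \<omega> 0) / r n \<partial>M)" for n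
    using opt[of n] intj intj0 r(1)[of n] by simp
  then have "0 \<le> (\<integral>\<omega>. g' \<omega> 0 \<partial>M)" by (intro LIMSEQ_le_const[OF lim]) auto
  then show ?thesis by (simp add: g'_def h_def upd0)
qed

section \<open>First-order optimality conditions\<close>

lemma finite_measure_subalgebra_F: "t \<le> T \<Longrightarrow> finite_measure_subalgebra M (F t)"
  using subalgebra_F finite_measure_axioms
  by (simp add: finite_measure_subalgebra_def finite_measure_subalgebra_axioms_def)

lemma indep_future:
  assumes t: "t \<le> T" and A: "A \<in> sets (F t)" and B: "B \<in> sets (PiM {Suc t..T} (\<lambda>_. borel))"
  shows "prob (A \<inter> ((\<lambda>\<omega>. \<lambda>s\<in>{Suc t..T}. w s \<omega>) -` B \<inter> space M)) =
    prob A * prob ((\<lambda>\<omega>. \<lambda>s\<in>{Suc t..T}. w s \<omega>) -` B \<inter> space M)"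
proof -
  obtain A' where A': "A' \<in> sets (PiM {..t} (\<lambda>_. borel))" "A = (\<lambda>\<omega>. \<lambda>s\<in>{..t}. w s \<omega>) -` A' \<inter> space M"
    using A by (auto simp: noise_algebra_def sets_vimage_algebra2[OF noise_in_space])
  have "indep_var (PiM {..t} (\<lambda>_. borel)) (\<lambda>\<omega>. \<lambda>s\<in>{..t}. w s \<omega>) (PiM {Suc t..T} (\<lambda>_. borel)) (\<lambda>\<omega>. \<lambda>s\<in>{Suc t..T}. w s \<omega>)"
    using t by (intro indep_var_restrict[OF indep_w]) auto
  from indep_varD[OF this A'(1) B] show ?thesis
    unfolding A'(2)
    by (simp add: vimage_def Int_def conj_ac)
qed

lemma indep_next:
  assumes t: "t < T" and A: "A \<in> sets (F t)" and B: "B \<in> sets borel"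
  shows "prob (A \<inter> (w (Suc t) -` B \<inter> space M)) = prob A * prob (w (Suc t) -` B \<inter> space M)"
proof -
  let ?P = "PiM {Suc t..T} (\<lambda>_. borel) :: (nat \<Rightarrow> 'e) measure"
  have m: "(\<lambda>y. y (Suc t)) \<in> ?P \<rightarrow>\<^sub>M borel" using t by (intro measurable_component_singleton) auto
  have "(\<lambda>\<omega>. \<lambda>s\<in>{Suc t..T}. w s \<omega>) -` ((\<lambda>y. y (Suc t)) -` B \<inter> space ?P) \<inter> space M = w (Suc t) -` B \<inter> space M"
    using t by (auto simp: space_PiM)
  then show ?thesis using indep_future[OF _ A measurable_sets[OF m B]] t by simp
qed

lemma measurable_gradients:
  assumes t: "t < T" and a: "a \<in> borel_measurable A" and v: "v \<in> borel_measurable A" and b: "b \<in> borel_measurable A"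
    and l: "l \<in> borel_measurable A"
    and aX: "\<And>\<alpha>. \<alpha> \<in> space A \<Longrightarrow> a \<alpha> \<in> X t" and vU: "\<And>\<alpha>. \<alpha> \<in> space A \<Longrightarrow> v \<alpha> \<in> U t"
    and bW: "\<And>\<alpha>. \<alpha> \<in> space A \<Longrightarrow> b \<alpha> \<in> W (Suc t)" and lX: "\<And>\<alpha>. \<alpha> \<in> space A \<Longrightarrow> l \<alpha> \<in> X (Suc t)"
  shows "(\<lambda>\<alpha>. dLx X L t (a \<alpha>) (v \<alpha>) (b \<alpha>) + dfx X f t (a \<alpha>) (v \<alpha>) (b \<alpha>) (l \<alpha>)) \<in> borel_measurable A"
    "(\<lambda>\<alpha>. dLu U L t (a \<alpha>) (v \<alpha>) (b \<alpha>) + dfu U f t (a \<alpha>) (v \<alpha>) (b \<alpha>) (l \<alpha>)) \<in> borel_measurable A"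
proof -
  obtain B where B: "finite B" "B \<subseteq> X (Suc t)" "\<And>y. y \<in> X (Suc t) \<Longrightarrow> (\<Sum>b\<in>B. (y \<bullet> b) *\<^sub>R b) = y"
    using subspace_orthonormal_expansion[OF subspace_X[of "Suc t"]] t by (metis Suc_leI)
  note D = measurable_derivatives[OF t a v b aX vU bW]
  have ex: "dfx X f t (a \<alpha>) (v \<alpha>) (b \<alpha>) (l \<alpha>) = (\<Sum>i\<in>B. (l \<alpha> \<bullet> i) *\<^sub>R dfx X f t (a \<alpha>) (v \<alpha>) (b \<alpha>) i)"
    "dfu U f t (a \<alpha>) (v \<alpha>) (b \<alpha>) (l \<alpha>) = (\<Sum>i\<in>B. (l \<alpha> \<bullet> i) *\<^sub>R dfu U f t (a \<alpha>) (v \<alpha>) (b \<alpha>) i)"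
    if "\<alpha> \<in> space A" for \<alpha>
    using df_linear[OF t aX[OF that] vU[OF that] bW[OF that], of "\<lambda>i. l \<alpha> \<bullet> i" B] B(3)[OF lX[OF that]] by simp_all
  have "(\<lambda>\<alpha>. dLx X L t (a \<alpha>) (v \<alpha>) (b \<alpha>) + (\<Sum>i\<in>B. (l \<alpha> \<bullet> i) *\<^sub>R dfx X f t (a \<alpha>) (v \<alpha>) (b \<alpha>) i)) \<in> borel_measurable A"
    "(\<lambda>\<alpha>. dLu U L t (a \<alpha>) (v \<alpha>) (b \<alpha>) + (\<Sum>i\<in>B. (l \<alpha> \<bullet> i) *\<^sub>R dfu U f t (a \<alpha>) (v \<alpha>) (b \<alpha>) i)) \<in> borel_measurable A"
    using l by (auto intro!: borel_measurable_add borel_measurable_sum borel_measurable_scaleR D)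
  then show "(\<lambda>\<alpha>. dLx X L t (a \<alpha>) (v \<alpha>) (b \<alpha>) + dfx X f t (a \<alpha>) (v \<alpha>) (b \<alpha>) (l \<alpha>)) \<in> borel_measurable A"
    "(\<lambda>\<alpha>. dLu U L t (a \<alpha>) (v \<alpha>) (b \<alpha>) + dfu U f t (a \<alpha>) (v \<alpha>) (b \<alpha>) (l \<alpha>)) \<in> borel_measurable A"
    using ex by (simp_all cong: measurable_cong)
qed

lemma costates_Suc:
  "t < T \<Longrightarrow> costates u t \<omega> = dLx X L t (state u t \<omega>) (u t \<omega>) (w (Suc t) \<omega>) +
     dfx X f t (state u t \<omega>) (u t \<omega>) (w (Suc t) \<omega>) (costates u (Suc t) \<omega>)"
  by (subst costate.simps) simp

lemma costates_T: "costates u T \<omega> = grad_on (X T) K (state u T \<omega>)"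
  by (subst costate.simps) simp

lemma djus_eq:
  assumes "u \<in> controls M T U" "t < T" "\<omega> \<in> space M"
  shows "djus u t \<omega> = dLu U L t (state u t \<omega>) (u t \<omega>) (w (Suc t) \<omega>) +
     dfu U f t (state u t \<omega>) (u t \<omega>) (w (Suc t) \<omega>) (costates u (Suc t) \<omega>)"
  using assms by (intro dju_eq) (auto simp: controls_in w_in)

text \<open>Pointwise co-states obey the adjoint recursion; conditioning turns it into one for the
  multipliers. \<open>\<Lambda>\<close> is required at the single time \<open>Suc t\<close>, which
  lets the lemma serve inside the backward construction of the multipliers.\<close>

lemma gradient_cond_exp:
  assumes u: "u \<in> controls M T U" "\<And>s. s < T \<Longrightarrow> u s \<in> borel_measurable (F s)"
    and x: "\<And>s. s \<le> T \<Longrightarrow> x s \<in> RV M (X s)" "\<And>s. s \<le> T \<Longrightarrow> AE \<omega> in M. x s \<omega> = state u s \<omega>"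
    and t: "t < T" and \<Lambda>: "\<Lambda> (Suc t) \<in> RV M (X (Suc t))"
      "AE \<omega> in M. \<Lambda> (Suc t) \<omega> = cond_exp_vec M (F (Suc t)) (costates u (Suc t)) \<omega>"
  shows "integrable M (x_gradient X f L w u x \<Lambda> t)" "integrable M (u_gradient U f L w u x \<Lambda> t)"
    "AE \<omega> in M. cond_exp_vec M (F t) (costates u t) \<omega> = cond_exp_vec M (F t) (x_gradient X f L w u x \<Lambda> t) \<omega>"
    "AE \<omega> in M. cond_exp_vec M (F t) (djus u t) \<omega> = cond_exp_vec M (F t) (u_gradient U f L w u x \<Lambda> t) \<omega>"
proof -
  interpret Ft: finite_measure_subalgebra M "F t" using t by (intro finite_measure_subalgebra_F) simp
  have St: "Suc t \<le> T" using t by simp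
  obtain B where B: "finite B" "B \<subseteq> X (Suc t)" "\<And>y. y \<in> X (Suc t) \<Longrightarrow> (\<Sum>b\<in>B. (y \<bullet> b) *\<^sub>R b) = y"
    using subspace_orthonormal_expansion[OF subspace_X[OF St]] by metis
  have xs: "state u t \<in> borel_measurable (F t)"
    using t by (intro state_F u) auto
  have m: "state u t \<in> borel_measurable (F (Suc t))" "u t \<in> borel_measurable (F (Suc t))" "w (Suc t) \<in> borel_measurable (F (Suc t))"
    using measurable_F_mono[OF xs, of "Suc t"] measurable_F_mono[OF u(2)[OF t], of "Suc t"] w_F by auto
  have inn: "state u t \<omega> \<in> X t" "u t \<omega> \<in> U t" "w (Suc t) \<omega> \<in> W (Suc t)" if "\<omega> \<in> space M" for \<omega>
    using state_in[OF u(1) _ that] controls_in[OF u(1) t that] w_in[OF St that] t by auto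
  \<comment> \<open>Along the trajectory the derivatives depend on the noise up to
    \<open>Suc t\<close>, so they act as constants when conditioning on
    \<open>F (Suc t)\<close>.\<close>
  note D = measurable_derivatives[OF t m, unfolded space_F, OF inn, simplified]
  have BX: "b \<in> X (Suc t)" if "b \<in> B" for b using B(2) that by auto
  have sub: "sets (F t) \<subseteq> sets (F (Suc t))" by (rule sets_F_mono) simp
  have lX: "\<Lambda> (Suc t) \<omega> \<in> X (Suc t)" if "\<omega> \<in> space M" for \<omega> using \<Lambda>(1) that by (simp add: RV_def)
  have cX: "costates u (Suc t) \<omega> \<in> X (Suc t)" if "\<omega> \<in> space M" for \<omega>
    using L2_in[OF L2_costates[OF u(1) St] that] .
  have ex: "dfx X f t (state u t \<omega>) (u t \<omega>) (w (Suc t) \<omega>) l = (\<Sum>i\<in>B. (l \<bullet> i) *\<^sub>R dfx X f t (state u t \<omega>) (u t \<omega>) (w (Suc t) \<omega>) i)"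
    "dfu U f t (state u t \<omega>) (u t \<omega>) (w (Suc t) \<omega>) l = (\<Sum>i\<in>B. (l \<bullet> i) *\<^sub>R dfu U f t (state u t \<omega>) (u t \<omega>) (w (Suc t) \<omega>) i)"
    if "l \<in> X (Suc t)" "\<omega> \<in> space M" for l \<omega>
    using df_linear[OF t inn[OF that(2)], of "\<lambda>i. l \<bullet> i" B] B(3)[OF that(1)] by simp_all
  have \<Lambda>m: "\<Lambda> (Suc t) \<in> borel_measurable M" using \<Lambda>(1) by (simp add: RV_def)
  note towx = Ft.cond_exp_vec_tower_mult[OF subalgebra_F[OF St] sub B(1), of "\<lambda>i \<omega>. dfx X f t (state u t \<omega>) (u t \<omega>) (w (Suc t) \<omega>) i" "X t",
      OF L2_derivatives(3)[OF u(1) t BX] D(3) L2_costates[OF u(1) St] \<Lambda>m \<Lambda>(2) L2_integrable[OF L2_derivatives(1)[OF u(1) t]], simplified]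
  note towu = Ft.cond_exp_vec_tower_mult[OF subalgebra_F[OF St] sub B(1), of "\<lambda>i \<omega>. dfu U f t (state u t \<omega>) (u t \<omega>) (w (Suc t) \<omega>) i" "U t",
      OF L2_derivatives(4)[OF u(1) t BX] D(4) L2_costates[OF u(1) St] \<Lambda>m \<Lambda>(2) L2_integrable[OF L2_derivatives(2)[OF u(1) t]], simplified]
  have x': "x t \<in> borel_measurable M" "\<And>\<omega>. \<omega> \<in> space M \<Longrightarrow> x t \<omega> \<in> X t"
    using x(1)[of t] t by (simp_all add: RV_def)
  have u': "u t \<in> borel_measurable M" by (rule controls_measurable[OF u(1) t])
  have w': "w (Suc t) \<in> borel_measurable M" by (rule w_measurable[OF St])
  have gm: "x_gradient X f L w u x \<Lambda> t \<in> borel_measurable M" "u_gradient U f L w u x \<Lambda> t \<in> borel_measurable M"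
    unfolding x_gradient_def u_gradient_def
    using measurable_gradients[OF t x'(1) u' w' \<Lambda>m x'(2) inn(2,3) lX] by simp_all
  have xt: "AE \<omega> in M. x t \<omega> = state u t \<omega>" using x(2)[of t] t by simp
  \<comment> \<open>The tower argument runs along the exact trajectory; here it is exchanged for
    \<open>x\<close>, which agrees with it almost surely.\<close>
  have gx: "AE \<omega> in M. (dLx X L t (state u t \<omega>) (u t \<omega>) (w (Suc t) \<omega>) +
      (\<Sum>i\<in>B. (\<Lambda> (Suc t) \<omega> \<bullet> i) *\<^sub>R dfx X f t (state u t \<omega>) (u t \<omega>) (w (Suc t) \<omega>) i)) = x_gradient X f L w u x \<Lambda> t \<omega>"
    using xt AE_space by eventually_elim (simp add: x_gradient_def ex lX)
  have gu: "AE \<omega> in M. (dLu U L t (state u t \<omega>) (u t \<omega>) (w (Suc t) \<omega>) +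
      (\<Sum>i\<in>B. (\<Lambda> (Suc t) \<omega> \<bullet> i) *\<^sub>R dfu U f t (state u t \<omega>) (u t \<omega>) (w (Suc t) \<omega>) i)) = u_gradient U f L w u x \<Lambda> t \<omega>"
    using xt AE_space by eventually_elim (simp add: u_gradient_def ex lX)
  show "integrable M (x_gradient X f L w u x \<Lambda> t)" "integrable M (u_gradient U f L w u x \<Lambda> t)"
    using towx(2) towu(2) gx gu gm by (auto intro: integrable_cong_AE_imp)
  have "AE \<omega> in M. cond_exp_vec M (F t) (costates u t) \<omega> =
    cond_exp_vec M (F t) (\<lambda>\<omega>. dLx X L t (state u t \<omega>) (u t \<omega>) (w (Suc t) \<omega>) +
      (\<Sum>i\<in>B. (costates u (Suc t) \<omega> \<bullet> i) *\<^sub>R dfx X f t (state u t \<omega>) (u t \<omega>) (w (Suc t) \<omega>) i)) \<omega>"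
  proof (rule Ft.cond_exp_vec_cong)
    show "AE \<omega> in M. costates u t \<omega> = dLx X L t (state u t \<omega>) (u t \<omega>) (w (Suc t) \<omega>) +
      (\<Sum>i\<in>B. (costates u (Suc t) \<omega> \<bullet> i) *\<^sub>R dfx X f t (state u t \<omega>) (u t \<omega>) (w (Suc t) \<omega>) i)"
      using AE_space by eventually_elim (simp add: costates_Suc[OF t] ex cX)
    show "costates u t \<in> borel_measurable M" using L2_measurable[OF L2_costates[OF u(1)]] t by simp
  qed (use towx(1) in auto)
  moreover note towx(3)
  moreover have "AE \<omega> in M. cond_exp_vec M (F t) (\<lambda>\<omega>. dLx X L t (state u t \<omega>) (u t \<omega>) (w (Suc t) \<omega>) +
      (\<Sum>i\<in>B. (\<Lambda> (Suc t) \<omega> \<bullet> i) *\<^sub>R dfx X f t (state u t \<omega>) (u t \<omega>) (w (Suc t) \<omega>) i)) \<omega> =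
    cond_exp_vec M (F t) (x_gradient X f L w u x \<Lambda> t) \<omega>"
    using towx(2) by (intro Ft.cond_exp_vec_cong gx gm) auto
  ultimately show "AE \<omega> in M. cond_exp_vec M (F t) (costates u t) \<omega> = cond_exp_vec M (F t) (x_gradient X f L w u x \<Lambda> t) \<omega>"
    by eventually_elim simp
  have "AE \<omega> in M. cond_exp_vec M (F t) (djus u t) \<omega> =
    cond_exp_vec M (F t) (\<lambda>\<omega>. dLu U L t (state u t \<omega>) (u t \<omega>) (w (Suc t) \<omega>) +
      (\<Sum>i\<in>B. (costates u (Suc t) \<omega> \<bullet> i) *\<^sub>R dfu U f t (state u t \<omega>) (u t \<omega>) (w (Suc t) \<omega>) i)) \<omega>"
  proof (rule Ft.cond_exp_vec_cong)
    show "AE \<omega> in M. djus u t \<omega> = dLu U L t (state u t \<omega>) (u t \<omega>) (w (Suc t) \<omega>) +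
      (\<Sum>i\<in>B. (costates u (Suc t) \<omega> \<bullet> i) *\<^sub>R dfu U f t (state u t \<omega>) (u t \<omega>) (w (Suc t) \<omega>) i)"
      using AE_space by eventually_elim (simp add: djus_eq[OF u(1) t] ex cX)
    show "djus u t \<in> borel_measurable M" by (rule L2_measurable[OF L2_derivatives(5)[OF u(1) t]])
  qed (use towu(1) in auto)
  moreover note towu(3)
  moreover have "AE \<omega> in M. cond_exp_vec M (F t) (\<lambda>\<omega>. dLu U L t (state u t \<omega>) (u t \<omega>) (w (Suc t) \<omega>) +
      (\<Sum>i\<in>B. (\<Lambda> (Suc t) \<omega> \<bullet> i) *\<^sub>R dfu U f t (state u t \<omega>) (u t \<omega>) (w (Suc t) \<omega>) i)) \<omega> =
    cond_exp_vec M (F t) (u_gradient U f L w u x \<Lambda> t) \<omega>"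
    using towu(2) by (intro Ft.cond_exp_vec_cong gu gm) auto
  ultimately show "AE \<omega> in M. cond_exp_vec M (F t) (djus u t) \<omega> = cond_exp_vec M (F t) (u_gradient U f L w u x \<Lambda> t) \<omega>"
    by eventually_elim simp
qed

text \<open>The normal cone is tested by all of \<open>U_as\<close>, the first variation only by
  competitors measurable for \<open>F t\<close>. Conditioning a competitor on \<open>F t\<close>
  closes the gap: the constant closed convex set keeps it admissible, and the inner product with an
  \<open>F t\<close>-measurable vector is unchanged.\<close>

lemma cond_exp_normal_cone:
  assumes u: "optimal u" and t: "t < T"
  shows "\<exists>r\<in>subdiff_indicator M (U t) (U_as M (U t) (\<lambda>_. \<Gamma>0 t)) (u t).
    AE \<omega> in M. cond_exp_vec M (F t) (djus u t) \<omega> = - r \<omega>"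
proof -
  interpret Ft: finite_measure_subalgebra M "F t" using t by (intro finite_measure_subalgebra_F) simp
  have adm: "admissible u" using u by (simp add: optimal_def)
  then have uc: "u \<in> controls M T U" by (rule admissible_controls)
  have ut: "u t \<in> L2 M (U t)" "u t \<in> borel_measurable (F t)" "AE \<omega> in M. u t \<omega> \<in> \<Gamma>0 t"
    using adm t by (auto simp: admissible_def)
  have sU: "subspace (U t)" by (rule subspace_U[OF t])
  have clU: "closed (U t)" "convex (U t)" using sU by (auto simp: closed_subspace subspace_imp_convex)
  note cp = closest_point_subspace[OF sU]
  have dj: "djus u t \<in> L2 M (U t)" by (rule L2_derivatives(5)[OF uc t])
  \<comment> \<open>The projection alters the conditional expectation on a null set at most and
    makes it \<open>U t\<close>-valued at every point, as membership in \<open>L2 M (U t)\<close>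
    demands.\<close>
  define c where "c \<omega> = closest_point (U t) (cond_exp_vec M (F t) (djus u t) \<omega>)" for \<omega>
  have cL2: "c \<in> L2 M (U t)" unfolding c_def by (rule L2_closest_point[OF sU Ft.cond_exp_vec_L2[OF dj]])
  have c_eq: "AE \<omega> in M. c \<omega> = cond_exp_vec M (F t) (djus u t) \<omega>"
    using Ft.cond_exp_vec_in_convex[OF dj clU] L2_in[OF dj] unfolding c_def
    by (auto intro: cp(2) elim!: eventually_mono)
  have cF: "c \<in> borel_measurable (F t)" unfolding c_def by (rule measurable_compose[OF _ cp(3)]) simp
  have key: "0 \<le> (\<integral>\<omega>. c \<omega> \<bullet> (v \<omega> - u t \<omega>) \<partial>M)" if v: "v \<in> L2 M (U t)" "AE \<omega> in M. v \<omega> \<in> \<Gamma>0 t" for v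
  proof -
    define v' where "v' \<omega> = closest_point (U t) (cond_exp_vec M (F t) v \<omega>)" for \<omega>
    have v'L2: "v' \<in> L2 M (U t)" unfolding v'_def by (rule L2_closest_point[OF sU Ft.cond_exp_vec_L2[OF v(1)]])
    have v'F: "v' \<in> borel_measurable (F t)" unfolding v'_def by (rule measurable_compose[OF _ cp(3)]) simp
    have v'_eq: "AE \<omega> in M. v' \<omega> = cond_exp_vec M (F t) v \<omega>"
      using Ft.cond_exp_vec_in_convex[OF v(1) clU] L2_in[OF v(1)] unfolding v'_def
      by (auto intro: cp(2) elim!: eventually_mono)
    have v'\<Gamma>: "AE \<omega> in M. v' \<omega> \<in> \<Gamma>0 t"
      using Ft.cond_exp_vec_in_convex[OF v(1) \<Gamma>0[OF t] v(2)] v'_eq by eventually_elim simp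
    have dL2: "(\<lambda>\<omega>. v' \<omega> - u t \<omega>) \<in> L2 M (U t)" by (intro L2_diff sU v'L2 ut)
    have dF: "(\<lambda>\<omega>. v' \<omega> - u t \<omega>) \<in> borel_measurable (F t)" using v'F ut(2) by measurable
    have "(\<integral>\<omega>. c \<omega> \<bullet> v \<omega> \<partial>M) = (\<integral>\<omega>. c \<omega> \<bullet> v' \<omega> \<partial>M)"
      unfolding Ft.integral_inner_cond_exp_vec[OF cL2 cF v(1), symmetric]
      using v'_eq L2_measurable[OF cL2] L2_measurable[OF v'L2] by (intro integral_cong_AE) auto
    then have "(\<integral>\<omega>. c \<omega> \<bullet> (v \<omega> - u t \<omega>) \<partial>M) = (\<integral>\<omega>. c \<omega> \<bullet> (v' \<omega> - u t \<omega>) \<partial>M)"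
      using L2_integrable_inner[OF cL2 v(1)] L2_integrable_inner[OF cL2 v'L2] L2_integrable_inner[OF cL2 ut(1)]
      by (simp add: inner_diff_right)
    also have "\<dots> = (\<integral>\<omega>. (v' \<omega> - u t \<omega>) \<bullet> cond_exp_vec M (F t) (djus u t) \<omega> \<partial>M)"
      using c_eq L2_measurable[OF cL2] L2_measurable[OF dL2]
      by (intro integral_cong_AE) (auto simp: inner_commute elim!: eventually_mono)
    also have "\<dots> = (\<integral>\<omega>. (v' \<omega> - u t \<omega>) \<bullet> djus u t \<omega> \<partial>M)"
      by (rule Ft.integral_inner_cond_exp_vec[OF dL2 dF dj])
    also have "\<dots> \<ge> 0"
      using first_variation[OF u t v'L2 v'F v'\<Gamma>] by (simp add: inner_commute)
    finally show ?thesis .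
  qed
  show ?thesis
  proof (rule bexI)
    show "AE \<omega> in M. cond_exp_vec M (F t) (djus u t) \<omega> = - (- c \<omega>)" using c_eq by eventually_elim simp
    have "(\<lambda>\<omega>. - c \<omega>) \<in> L2 M (U t)"
      using L2_diff[OF sU L2_const[OF finite_measure_axioms subspace_0[OF sU]] cL2] by simp
    then show "(\<lambda>\<omega>. - c \<omega>) \<in> subdiff_indicator M (U t) (U_as M (U t) (\<lambda>_. \<Gamma>0 t)) (u t)"
      using key by (auto simp: subdiff_indicator_def U_as_def)
  qed
qed

text \<open>The freezing lemma asks for a Borel function on the full product space, while
  \<open>f\<close> and \<open>L\<close> are controlled on subspaces only. Projecting every argument
  first yields such a function, and the projections are invisible at the relevant points.\<close>

lemma gradient_factors:
  assumes t: "t < T" and \<phi>: "\<phi> \<in> borel_measurable borel" and \<psi>: "\<psi> \<in> borel_measurable borel"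
  shows "\<exists>\<Phi>\<in>borel_measurable (borel \<Otimes>\<^sub>M borel). \<exists>\<Psi>\<in>borel_measurable (borel \<Otimes>\<^sub>M borel).
    \<forall>a\<in>X t. \<forall>b\<in>W (Suc t). \<phi> a \<in> U t \<longrightarrow> \<psi> (f t a (\<phi> a) b) \<in> X (Suc t) \<longrightarrow>
      \<Phi> (a, b) = dLx X L t a (\<phi> a) b + dfx X f t a (\<phi> a) b (\<psi> (f t a (\<phi> a) b)) \<and>
      \<Psi> (a, b) = dLu U L t a (\<phi> a) b + dfu U f t a (\<phi> a) b (\<psi> (f t a (\<phi> a) b))"
proof -
  have S: "subspace (X t)" "subspace (X (Suc t))" "subspace (U t)" "subspace (W (Suc t))"
    using t subspace_X subspace_U subspace_W by auto
  note cpX = closest_point_subspace[OF S(1)] and cpX' = closest_point_subspace[OF S(2)]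
    and cpU = closest_point_subspace[OF S(3)] and cpW = closest_point_subspace[OF S(4)]
  define a' where "a' p = closest_point (X t) (fst p)" for p :: "'e \<times> 'e"
  define v' where "v' p = closest_point (U t) (\<phi> (fst p))" for p :: "'e \<times> 'e"
  define b' where "b' p = closest_point (W (Suc t)) (snd p)" for p :: "'e \<times> 'e"
  define l' where "l' p = closest_point (X (Suc t)) (\<psi> (f t (a' p) (v' p) (b' p)))" for p
  have m: "a' \<in> borel_measurable (borel \<Otimes>\<^sub>M borel)" "v' \<in> borel_measurable (borel \<Otimes>\<^sub>M borel)" "b' \<in> borel_measurable (borel \<Otimes>\<^sub>M borel)"
    unfolding a'_def v'_def b'_def
    by (intro measurable_compose[OF _ cpX(3)] measurable_compose[OF _ cpU(3)] measurable_compose[OF _ cpW(3)]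
        measurable_compose[OF _ \<phi>] measurable_fst measurable_snd)+
  have inn: "a' p \<in> X t" "v' p \<in> U t" "b' p \<in> W (Suc t)" "l' p \<in> X (Suc t)" for p
    by (simp_all add: a'_def v'_def b'_def l'_def cpX cpX' cpU cpW)
  have l'm: "l' \<in> borel_measurable (borel \<Otimes>\<^sub>M borel)"
    unfolding l'_def using inn
    by (intro measurable_compose[OF _ cpX'(3)] measurable_compose[OF _ \<psi>] measurable_f t m)
  show ?thesis
  proof (intro bexI ballI impI)
    fix a b assume "a \<in> X t" "b \<in> W (Suc t)" "\<phi> a \<in> U t" "\<psi> (f t a (\<phi> a) b) \<in> X (Suc t)"
    then show "(\<lambda>p. dLx X L t (a' p) (v' p) (b' p) + dfx X f t (a' p) (v' p) (b' p) (l' p)) (a, b) =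
        dLx X L t a (\<phi> a) b + dfx X f t a (\<phi> a) b (\<psi> (f t a (\<phi> a) b)) \<and>
      (\<lambda>p. dLu U L t (a' p) (v' p) (b' p) + dfu U f t (a' p) (v' p) (b' p) (l' p)) (a, b) =
        dLu U L t a (\<phi> a) b + dfu U f t a (\<phi> a) b (\<psi> (f t a (\<phi> a) b))"
      by (simp add: a'_def v'_def b'_def l'_def cpX cpX' cpU cpW)
  qed (rule measurable_gradients[OF t m l'm inn])+
qed

text \<open>The freezing lemma is applied once given the past noise and once given
  \<open>x t\<close>. Both times the resulting function of the state is built from
  \<open>\<Phi>\<close> and the law of the next noise alone, so it is the same.\<close>

lemma markov_cond_exp:
  assumes u: "u \<in> controls M T U" "\<And>s. s < T \<Longrightarrow> u s \<in> borel_measurable (F s)"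
    and x: "x t \<in> borel_measurable M" "AE \<omega> in M. x t \<omega> = state u t \<omega>" and t: "t < T"
    and \<Phi>: "\<Phi> \<in> borel_measurable (borel \<Otimes>\<^sub>M borel)"
    and g: "integrable M g" "AE \<omega> in M. g \<omega> = \<Phi> (x t \<omega>, w (Suc t) \<omega>)"
  shows "\<exists>\<phi>\<in>borel_measurable borel. (AE \<omega> in M. cond_exp_vec M (F t) g \<omega> = \<phi> (x t \<omega>)) \<and>
    (AE \<omega> in M. cond_exp_vec M (sigma_rv M (x t)) g \<omega> = \<phi> (x t \<omega>))"
proof -
  have xF: "state u t \<in> borel_measurable (F t)" using t by (intro state_F u) auto
  have w': "w (Suc t) \<in> borel_measurable M" using t by (intro w_measurable) simp
  have xsp: "x t \<in> space M \<rightarrow> space borel" by simp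
  have sub: "subalgebra M (sigma_rv M (x t))"
    using measurable_sets[OF x(1)] by (auto simp: subalgebra_def sigma_rv_def sets_vimage_algebra2[OF xsp])
  have xs: "x t \<in> borel_measurable (sigma_rv M (x t))"
    unfolding sigma_rv_def by (rule measurable_vimage_algebra1[OF xsp])
  \<comment> \<open>\<open>x t\<close> equals the trajectory almost surely only, so its
    sigma-algebra need not lie in \<open>F t\<close>; independence of the next noise is transferred
    event by event, up to null sets.\<close>
  have ind: "prob (A \<inter> (w (Suc t) -` B \<inter> space M)) = prob A * prob (w (Suc t) -` B \<inter> space M)"
    if A: "A \<in> sets (sigma_rv M (x t))" and B: "B \<in> sets borel" for A B
  proof -
    obtain A' where A': "A' \<in> sets borel" "A = x t -` A' \<inter> space M"
      using A by (auto simp: sigma_rv_def sets_vimage_algebra2[OF xsp])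
    have AF: "state u t -` A' \<inter> space M \<in> sets (F t)" using measurable_sets[OF xF A'(1)] by simp
    have AM: "A \<in> sets M" using A sub by (auto simp: subalgebra_def)
    have AFM: "state u t -` A' \<inter> space M \<in> sets M" using AF subalgebra_F[of t] t by (auto simp: subalgebra_def)
    have BM: "w (Suc t) -` B \<inter> space M \<in> sets M" using measurable_sets[OF w' B] .
    have iff: "AE \<omega> in M. \<omega> \<in> A \<longleftrightarrow> \<omega> \<in> state u t -` A' \<inter> space M"
      using x(2) by eventually_elim (simp add: A'(2))
    have "prob A = prob (state u t -` A' \<inter> space M)"
      "prob (A \<inter> (w (Suc t) -` B \<inter> space M)) = prob ((state u t -` A' \<inter> space M) \<inter> (w (Suc t) -` B \<inter> space M))"
      using AM AFM BM iff by (intro measure_eq_AE; auto elim: eventually_mono)+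
    then show ?thesis using indep_next[OF t AF B] by simp
  qed
  have gF: "AE \<omega> in M. g \<omega> = \<Phi> (state u t \<omega>, w (Suc t) \<omega>)" using g(2) x(2) by eventually_elim simp
  define \<phi> where "\<phi> a = (\<Sum>i\<in>Basis. (\<integral>y. \<Phi> (a, y) \<bullet> i \<partial>distr M borel (w (Suc t))) *\<^sub>R i)" for a
  have "\<phi> \<in> borel_measurable borel"
    unfolding \<phi>_def by (rule cond_exp_vec_indep(1)[OF sub xs w' _ \<Phi> g]) (rule ind)
  moreover have "AE \<omega> in M. cond_exp_vec M (F t) g \<omega> = \<phi> (state u t \<omega>)"
    unfolding \<phi>_def
    by (rule cond_exp_vec_indep(2)[OF subalgebra_F[OF less_imp_le[OF t]] xF w' _ \<Phi> g(1) gF]) (rule indep_next[OF t])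
  then have "AE \<omega> in M. cond_exp_vec M (F t) g \<omega> = \<phi> (x t \<omega>)" using x(2) by eventually_elim simp
  moreover have "AE \<omega> in M. cond_exp_vec M (sigma_rv M (x t)) g \<omega> = \<phi> (x t \<omega>)"
    unfolding \<phi>_def by (rule cond_exp_vec_indep(2)[OF sub xs w' _ \<Phi> g]) (rule ind)
  ultimately show ?thesis by blast
qed

text \<open>The next multiplier is a function of the next state, which the dynamics express through
  the state, the feedback control and the next noise. The gradients thus acquire the form that the
  freezing lemma requires.\<close>

lemma markov_gradients:
  assumes u: "u \<in> controls M T U"
    and x: "\<And>s. s \<le> T \<Longrightarrow> x s \<in> RV M (X s)" "\<And>s. s \<le> T \<Longrightarrow> AE \<omega> in M. x s \<omega> = state u s \<omega>"
    and t: "t < T" and markov: "rv_preceq M (u t) (x t)"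
    and \<psi>: "\<psi> \<in> borel_measurable borel" "\<And>a. \<psi> a \<in> X (Suc t)"
    and \<Lambda>: "\<And>\<omega>. \<omega> \<in> space M \<Longrightarrow> \<Lambda> (Suc t) \<omega> = \<psi> (x (Suc t) \<omega>)"
  shows "\<exists>\<Phi>\<in>borel_measurable (borel \<Otimes>\<^sub>M borel). \<exists>\<Psi>\<in>borel_measurable (borel \<Otimes>\<^sub>M borel).
    (AE \<omega> in M. x_gradient X f L w u x \<Lambda> t \<omega> = \<Phi> (x t \<omega>, w (Suc t) \<omega>)) \<and>
    (AE \<omega> in M. u_gradient U f L w u x \<Lambda> t \<omega> = \<Psi> (x t \<omega>, w (Suc t) \<omega>))"
proof -
  have "u t \<in> borel_measurable (sigma_rv M (u t))"
    unfolding sigma_rv_def by (rule measurable_vimage_algebra1) simp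
  then have uS: "u t \<in> borel_measurable (vimage_algebra (space M) (x t) borel)"
    using markov by (auto simp: rv_preceq_def sigma_rv_def measurable_def)
  obtain \<phi> where \<phi>: "\<phi> \<in> borel_measurable borel" "\<And>\<omega>. \<omega> \<in> space M \<Longrightarrow> u t \<omega> = \<phi> (x t \<omega>)"
    by (rule doob_dynkin[OF _ uS]) simp_all
  obtain \<Phi> \<Psi> where \<Phi>: "\<Phi> \<in> borel_measurable (borel \<Otimes>\<^sub>M borel)"
    and \<Psi>: "\<Psi> \<in> borel_measurable (borel \<Otimes>\<^sub>M borel)"
    and eq: "\<forall>a\<in>X t. \<forall>b\<in>W (Suc t). \<phi> a \<in> U t \<longrightarrow> \<psi> (f t a (\<phi> a) b) \<in> X (Suc t) \<longrightarrow>
      \<Phi> (a, b) = dLx X L t a (\<phi> a) b + dfx X f t a (\<phi> a) b (\<psi> (f t a (\<phi> a) b)) \<and>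
      \<Psi> (a, b) = dLu U L t a (\<phi> a) b + dfu U f t a (\<phi> a) b (\<psi> (f t a (\<phi> a) b))"
    using gradient_factors[OF t \<phi>(1) \<psi>(1)] by (elim bexE)
  have AEs: "AE \<omega> in M. x t \<omega> \<in> X t \<and> w (Suc t) \<omega> \<in> W (Suc t) \<and> u t \<omega> = \<phi> (x t \<omega>) \<and> \<phi> (x t \<omega>) \<in> U t \<and>
      \<Lambda> (Suc t) \<omega> = \<psi> (f t (x t \<omega>) (\<phi> (x t \<omega>)) (w (Suc t) \<omega>))"
    using x(2)[OF less_imp_le[OF t]] x(2)[OF Suc_leI[OF t]] AE_space
  proof eventually_elim
    case (elim \<omega>)
    have "x t \<omega> \<in> X t" using x(1)[OF less_imp_le[OF t]] elim(3) by (simp add: RV_def)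
    with elim show ?case
      using w_in[OF Suc_leI[OF t] elim(3)] \<phi>(2)[OF elim(3)] controls_in[OF u t elim(3)] \<Lambda>[OF elim(3)]
      by simp
  qed
  show ?thesis
  proof (intro bexI[OF _ \<Phi>] bexI[OF _ \<Psi>] conjI)
    show "AE \<omega> in M. x_gradient X f L w u x \<Lambda> t \<omega> = \<Phi> (x t \<omega>, w (Suc t) \<omega>)"
      using AEs by eventually_elim (simp add: x_gradient_def eq \<psi>(2))
    show "AE \<omega> in M. u_gradient U f L w u x \<Lambda> t \<omega> = \<Psi> (x t \<omega>, w (Suc t) \<omega>)"
      using AEs by eventually_elim (simp add: u_gradient_def eq \<psi>(2))
  qed
qed

lemma RV_comp:
  "\<psi> \<in> borel_measurable borel \<Longrightarrow> (\<And>a. \<psi> a \<in> S) \<Longrightarrow> g \<in> RV M R \<Longrightarrow> (\<lambda>\<omega>. \<psi> (g \<omega>)) \<in> RV M S"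
  by (auto simp: RV_def intro: measurable_compose)

text \<open>The multiplier is sought as a function of the state with values in \<open>X t\<close> at
  every point. It is then an \<open>X t\<close>-valued random variable itself and can be inserted
  into the gradients one step earlier.\<close>

lemma markov_costates:
  assumes u: "u \<in> controls M T U" "\<And>s. s < T \<Longrightarrow> u s \<in> borel_measurable (F s)"
    and x: "\<And>s. s \<le> T \<Longrightarrow> x s \<in> RV M (X s)" "\<And>s. s \<le> T \<Longrightarrow> AE \<omega> in M. x s \<omega> = state u s \<omega>"
    and markov: "\<And>s. s < T \<Longrightarrow> rv_preceq M (u s) (x s)"
    and t: "t \<le> T"
  shows "\<exists>\<psi>\<in>borel_measurable borel. (\<forall>a. \<psi> a \<in> X t) \<and>
    (AE \<omega> in M. \<psi> (x t \<omega>) = cond_exp_vec M (F t) (costates u t) \<omega>)"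
  using t
proof (induction t rule: inc_induct)
  case base
  interpret FT: finite_measure_subalgebra M "F T" by (intro finite_measure_subalgebra_F) simp
  note cp = closest_point_subspace[OF subspace_X[OF order_refl]]
  define \<psi> where "\<psi> a = grad_on (X T) K (closest_point (X T) a)" for a
  have "\<psi> \<in> borel_measurable borel" unfolding \<psi>_def by (intro measurable_grad_K cp)
  moreover have "\<psi> a \<in> X T" for a
    unfolding \<psi>_def by (rule K_derivative[OF cp(1)])
  moreover have "costates u T \<in> borel_measurable (F T)"
    unfolding costates_T using u state_in[OF u(1)] by (intro measurable_grad_K state_F) auto
  then have "AE \<omega> in M. cond_exp_vec M (F T) (costates u T) \<omega> = costates u T \<omega>"
    using L2_integrable[OF L2_costates[OF u(1) order_refl]] by (intro FT.cond_exp_vec_F_meas)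
  then have "AE \<omega> in M. \<psi> (x T \<omega>) = cond_exp_vec M (F T) (costates u T) \<omega>"
    using x(2)[OF order_refl] AE_space
    by eventually_elim (simp add: \<psi>_def costates_T cp(2) state_in[OF u(1) order_refl])
  ultimately show ?case by (intro bexI[of _ \<psi>]) auto
next
  case (step t)
  have t: "t < T" using step by simp
  interpret Ft: finite_measure_subalgebra M "F t" using t by (intro finite_measure_subalgebra_F) simp
  obtain \<psi>' where \<psi>': "\<psi>' \<in> borel_measurable borel" "\<And>a. \<psi>' a \<in> X (Suc t)"
    "AE \<omega> in M. \<psi>' (x (Suc t) \<omega>) = cond_exp_vec M (F (Suc t)) (costates u (Suc t)) \<omega>"
    using step.IH by blast
  define \<Lambda> where "\<Lambda> = (\<lambda>s \<omega>. \<psi>' (x s \<omega>))"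
  have \<Lambda>RV: "\<Lambda> (Suc t) \<in> RV M (X (Suc t))"
    unfolding \<Lambda>_def using x(1)[of "Suc t"] t by (intro RV_comp[OF \<psi>'(1,2)]) auto
  have \<Lambda>AE: "AE \<omega> in M. \<Lambda> (Suc t) \<omega> = cond_exp_vec M (F (Suc t)) (costates u (Suc t)) \<omega>"
    using \<psi>'(3) by (simp add: \<Lambda>_def)
  have gint: "integrable M (x_gradient X f L w u x \<Lambda> t)"
    by (rule gradient_cond_exp(1)[where \<Lambda>=\<Lambda> and t=t and u=u and x=x, OF u x t \<Lambda>RV \<Lambda>AE])
  have geq: "AE \<omega> in M. cond_exp_vec M (F t) (costates u t) \<omega> = cond_exp_vec M (F t) (x_gradient X f L w u x \<Lambda> t) \<omega>"
    by (rule gradient_cond_exp(3)[where \<Lambda>=\<Lambda> and t=t and u=u and x=x, OF u x t \<Lambda>RV \<Lambda>AE])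
  have "\<exists>\<Phi>\<in>borel_measurable (borel \<Otimes>\<^sub>M borel). \<exists>\<Psi>\<in>borel_measurable (borel \<Otimes>\<^sub>M borel).
    (AE \<omega> in M. x_gradient X f L w u x \<Lambda> t \<omega> = \<Phi> (x t \<omega>, w (Suc t) \<omega>)) \<and>
    (AE \<omega> in M. u_gradient U f L w u x \<Lambda> t \<omega> = \<Psi> (x t \<omega>, w (Suc t) \<omega>))"
    by (rule markov_gradients[OF u(1) x t markov[OF t] \<psi>'(1,2)]) (simp_all add: \<Lambda>_def)
  then obtain \<Phi> where \<Phi>: "\<Phi> \<in> borel_measurable (borel \<Otimes>\<^sub>M borel)"
    "AE \<omega> in M. x_gradient X f L w u x \<Lambda> t \<omega> = \<Phi> (x t \<omega>, w (Suc t) \<omega>)"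
    by (elim bexE conjE)
  have xM: "x t \<in> borel_measurable M" using x(1)[of t] t by (simp add: RV_def)
  have "\<exists>\<phi>\<in>borel_measurable borel.
    (AE \<omega> in M. cond_exp_vec M (F t) (x_gradient X f L w u x \<Lambda> t) \<omega> = \<phi> (x t \<omega>)) \<and>
    (AE \<omega> in M. cond_exp_vec M (sigma_rv M (x t)) (x_gradient X f L w u x \<Lambda> t) \<omega> = \<phi> (x t \<omega>))"
    by (rule markov_cond_exp[where x=x and t=t and u=u, OF u xM x(2)[OF less_imp_le[OF t]] t \<Phi>(1) gint \<Phi>(2)])
  then obtain \<phi> where \<phi>: "\<phi> \<in> borel_measurable borel"
    "AE \<omega> in M. cond_exp_vec M (F t) (x_gradient X f L w u x \<Lambda> t) \<omega> = \<phi> (x t \<omega>)"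
    by blast
  have sX: "subspace (X t)" using subspace_X t by simp
  note cp = closest_point_subspace[OF sX]
  have cs: "costates u t \<in> L2 M (X t)" using L2_costates[OF u(1)] t by simp
  have "AE \<omega> in M. cond_exp_vec M (F t) (costates u t) \<omega> \<in> X t"
    using sX L2_in[OF cs] by (intro Ft.cond_exp_vec_in_convex[OF cs]) (auto simp: closed_subspace subspace_imp_convex)
  then have "AE \<omega> in M. closest_point (X t) (\<phi> (x t \<omega>)) = cond_exp_vec M (F t) (costates u t) \<omega>"
    using \<phi>(2) geq by eventually_elim (simp add: cp(2))
  then show ?case
    using cp measurable_compose[OF \<phi>(1) cp(3)] by (intro bexI[of _ "\<lambda>a. closest_point (X t) (\<phi> a)"]) auto
qed

lemma optimality_conditions:
  assumes u: "optimal u"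
    and x: "\<And>s. s \<le> T \<Longrightarrow> x s \<in> RV M (X s)" "\<And>s. s \<le> T \<Longrightarrow> AE \<omega> in M. x s \<omega> = state u s \<omega>"
  shows "\<exists>\<Lambda>. (\<forall>t\<le>T. \<Lambda> t \<in> RV M (X t)) \<and> (AE \<omega> in M. \<Lambda> T \<omega> = grad_on (X T) K (x T \<omega>)) \<and>
    (\<forall>t<T. (AE \<omega> in M. \<Lambda> t \<omega> = cond_exp_vec M (F t) (x_gradient X f L w u x \<Lambda> t) \<omega>) \<and>
      (\<exists>r\<in>subdiff_indicator M (U t) (U_as M (U t) (\<lambda>_. \<Gamma>0 t)) (u t).
        AE \<omega> in M. cond_exp_vec M (F t) (u_gradient U f L w u x \<Lambda> t) \<omega> = - r \<omega>)) \<and>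
    ((\<forall>t<T. rv_preceq M (u t) (x t)) \<longrightarrow> (\<forall>t<T. rv_preceq M (\<Lambda> (Suc t)) (x (Suc t)) \<and>
      (AE \<omega> in M. cond_exp_vec M (F t) (u_gradient U f L w u x \<Lambda> t) \<omega> =
        cond_exp_vec M (sigma_rv M (x t)) (u_gradient U f L w u x \<Lambda> t) \<omega>)))"
proof -
  have adm: "admissible u" using u by (simp add: optimal_def)
  then have uc: "u \<in> controls M T U" by (rule admissible_controls)
  have uF: "u s \<in> borel_measurable (F s)" if "s < T" for s using adm that by (auto simp: admissible_def)
  let ?markov = "\<forall>t<T. rv_preceq M (u t) (x t)"
  \<comment> \<open>In the feedback case the version is fixed as an exact function of
    \<open>x t\<close>, because \<open>rv_preceq\<close> does not tolerate null sets. Building this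
    into the choice lets one process \<open>\<Lambda>\<close> serve with and without
    feedback.\<close>
  define P where "P t l \<longleftrightarrow> l \<in> RV M (X t) \<and> (AE \<omega> in M. l \<omega> = cond_exp_vec M (F t) (costates u t) \<omega>) \<and>
      (?markov \<longrightarrow> (\<exists>\<psi>\<in>borel_measurable borel. (\<forall>a. \<psi> a \<in> X t) \<and> l = (\<lambda>\<omega>. \<psi> (x t \<omega>))))" for t l
  have "\<exists>l. P t l" if t: "t \<le> T" for t
  proof (cases ?markov)
    case True
    then have "\<exists>\<psi>\<in>borel_measurable borel. (\<forall>a. \<psi> a \<in> X t) \<and>
        (AE \<omega> in M. \<psi> (x t \<omega>) = cond_exp_vec M (F t) (costates u t) \<omega>)"
      by (intro markov_costates[where u=u and x=x and t=t, OF uc uF x _ t]) blast+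
    then obtain \<psi> where \<psi>: "\<psi> \<in> borel_measurable borel" "\<forall>a. \<psi> a \<in> X t"
      "AE \<omega> in M. \<psi> (x t \<omega>) = cond_exp_vec M (F t) (costates u t) \<omega>"
      by (elim bexE conjE)
    have "(\<lambda>\<omega>. \<psi> (x t \<omega>)) \<in> RV M (X t)"
      using \<psi>(2) by (intro RV_comp[OF \<psi>(1) _ x(1)[OF t]]) blast
    then have "P t (\<lambda>\<omega>. \<psi> (x t \<omega>))"
      unfolding P_def by (intro conjI impI bexI[of _ \<psi>] \<psi> refl)
    then show ?thesis by (rule exI[of _ "\<lambda>\<omega>. \<psi> (x t \<omega>)"])
  next
    case False
    interpret Ft: finite_measure_subalgebra M "F t" by (rule finite_measure_subalgebra_F[OF t])
    have sX: "subspace (X t)" using subspace_X t by simp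
    note cp = closest_point_subspace[OF sX]
    have cs: "costates u t \<in> L2 M (X t)" by (rule L2_costates[OF uc t])
    have "AE \<omega> in M. cond_exp_vec M (F t) (costates u t) \<omega> \<in> X t"
      using sX L2_in[OF cs] by (intro Ft.cond_exp_vec_in_convex[OF cs]) (auto simp: closed_subspace subspace_imp_convex)
    then have "AE \<omega> in M. closest_point (X t) (cond_exp_vec M (F t) (costates u t) \<omega>) = cond_exp_vec M (F t) (costates u t) \<omega>"
      by eventually_elim (simp add: cp(2))
    moreover have "(\<lambda>\<omega>. closest_point (X t) (cond_exp_vec M (F t) (costates u t) \<omega>)) \<in> RV M (X t)"
      using cp(1) measurable_compose[OF Ft.cond_exp_vec_measurable(2) cp(3)] by (simp add: RV_def)
    ultimately have "P t (\<lambda>\<omega>. closest_point (X t) (cond_exp_vec M (F t) (costates u t) \<omega>))"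
      unfolding P_def using False by blast
    then show ?thesis by (rule exI[of _ "\<lambda>\<omega>. closest_point (X t) (cond_exp_vec M (F t) (costates u t) \<omega>)"])
  qed
  then have "\<forall>t\<in>{..T}. \<exists>l. P t l" by simp
  from bchoice[OF this] obtain \<Lambda> where P: "\<forall>t\<in>{..T}. P t (\<Lambda> t)" ..
  have \<Lambda>: "\<Lambda> t \<in> RV M (X t)" "AE \<omega> in M. \<Lambda> t \<omega> = cond_exp_vec M (F t) (costates u t) \<omega>"
    and \<Lambda>m: "?markov \<Longrightarrow> \<exists>\<psi>\<in>borel_measurable borel. (\<forall>a. \<psi> a \<in> X t) \<and> \<Lambda> t = (\<lambda>\<omega>. \<psi> (x t \<omega>))"
    if "t \<le> T" for t
    using P that by (simp_all add: P_def)
  have grad: "integrable M (u_gradient U f L w u x \<Lambda> t)"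
    "AE \<omega> in M. cond_exp_vec M (F t) (costates u t) \<omega> = cond_exp_vec M (F t) (x_gradient X f L w u x \<Lambda> t) \<omega>"
    "AE \<omega> in M. cond_exp_vec M (F t) (djus u t) \<omega> = cond_exp_vec M (F t) (u_gradient U f L w u x \<Lambda> t) \<omega>" if t: "t < T" for t
    using gradient_cond_exp(2-4)[where u=u and x=x and \<Lambda>=\<Lambda> and t=t, OF uc uF x t \<Lambda>[OF Suc_leI[OF t]]]
    by blast+
  have "AE \<omega> in M. \<Lambda> T \<omega> = grad_on (X T) K (x T \<omega>)"
  proof -
    interpret FT: finite_measure_subalgebra M "F T" by (intro finite_measure_subalgebra_F) simp
    have "costates u T \<in> borel_measurable (F T)"
      unfolding costates_T using uF uc state_in[OF uc] by (intro measurable_grad_K state_F) auto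
    then have "AE \<omega> in M. cond_exp_vec M (F T) (costates u T) \<omega> = costates u T \<omega>"
      using L2_integrable[OF L2_costates[OF uc order_refl]] by (intro FT.cond_exp_vec_F_meas)
    then show ?thesis using \<Lambda>(2)[OF order_refl] x(2)[OF order_refl] by eventually_elim (simp add: costates_T)
  qed
  moreover have "AE \<omega> in M. \<Lambda> t \<omega> = cond_exp_vec M (F t) (x_gradient X f L w u x \<Lambda> t) \<omega>" if t: "t < T" for t
    using \<Lambda>(2)[OF less_imp_le[OF t]] grad(2)[OF t] by eventually_elim simp
  moreover have "\<exists>r\<in>subdiff_indicator M (U t) (U_as M (U t) (\<lambda>_. \<Gamma>0 t)) (u t).
        AE \<omega> in M. cond_exp_vec M (F t) (u_gradient U f L w u x \<Lambda> t) \<omega> = - r \<omega>" if t: "t < T" for t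
  proof -
    obtain r where r: "r \<in> subdiff_indicator M (U t) (U_as M (U t) (\<lambda>_. \<Gamma>0 t)) (u t)"
      "AE \<omega> in M. cond_exp_vec M (F t) (djus u t) \<omega> = - r \<omega>"
      using cond_exp_normal_cone[OF u t] by blast
    have "AE \<omega> in M. cond_exp_vec M (F t) (u_gradient U f L w u x \<Lambda> t) \<omega> = - r \<omega>"
      using r(2) grad(3)[OF t] by eventually_elim simp
    then show ?thesis using r(1) by blast
  qed
  moreover have "rv_preceq M (\<Lambda> (Suc t)) (x (Suc t)) \<and>
      (AE \<omega> in M. cond_exp_vec M (F t) (u_gradient U f L w u x \<Lambda> t) \<omega> =
        cond_exp_vec M (sigma_rv M (x t)) (u_gradient U f L w u x \<Lambda> t) \<omega>)" if markov: ?markov and t: "t < T" for t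
  proof -
    obtain \<psi> where \<psi>: "\<psi> \<in> borel_measurable borel" "\<And>a. \<psi> a \<in> X (Suc t)" "\<Lambda> (Suc t) = (\<lambda>\<omega>. \<psi> (x (Suc t) \<omega>))"
      using \<Lambda>m[OF Suc_leI[OF t] markov] by blast
    have "\<Lambda> (Suc t) \<in> borel_measurable (sigma_rv M (x (Suc t)))"
      unfolding \<psi>(3) sigma_rv_def by (rule measurable_compose[OF measurable_vimage_algebra1 \<psi>(1)]) simp
    from measurable_sets[OF this] have "rv_preceq M (\<Lambda> (Suc t)) (x (Suc t))"
      by (auto simp: rv_preceq_def sigma_rv_def sets_vimage_algebra2)
    moreover have "\<exists>\<Phi>\<in>borel_measurable (borel \<Otimes>\<^sub>M borel). \<exists>\<Psi>\<in>borel_measurable (borel \<Otimes>\<^sub>M borel).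
      (AE \<omega> in M. x_gradient X f L w u x \<Lambda> t \<omega> = \<Phi> (x t \<omega>, w (Suc t) \<omega>)) \<and>
      (AE \<omega> in M. u_gradient U f L w u x \<Lambda> t \<omega> = \<Psi> (x t \<omega>, w (Suc t) \<omega>))"
      by (rule markov_gradients[OF uc x t _ \<psi>(1,2)]) (use markov t in \<open>simp_all add: \<psi>(3)\<close>)
    then obtain \<Psi> where \<Psi>: "\<Psi> \<in> borel_measurable (borel \<Otimes>\<^sub>M borel)"
      "AE \<omega> in M. u_gradient U f L w u x \<Lambda> t \<omega> = \<Psi> (x t \<omega>, w (Suc t) \<omega>)"
      by (elim bexE conjE)
    have xM: "x t \<in> borel_measurable M" using x(1)[of t] t by (simp add: RV_def)
    have "\<exists>\<phi>\<in>borel_measurable borel.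
      (AE \<omega> in M. cond_exp_vec M (F t) (u_gradient U f L w u x \<Lambda> t) \<omega> = \<phi> (x t \<omega>)) \<and>
      (AE \<omega> in M. cond_exp_vec M (sigma_rv M (x t)) (u_gradient U f L w u x \<Lambda> t) \<omega> = \<phi> (x t \<omega>))"
      by (rule markov_cond_exp[where x=x and t=t and u=u, OF uc uF xM x(2)[OF less_imp_le[OF t]] t \<Psi>(1) grad(1)[OF t] \<Psi>(2)])
    then obtain \<phi> where "AE \<omega> in M. cond_exp_vec M (F t) (u_gradient U f L w u x \<Lambda> t) \<omega> = \<phi> (x t \<omega>)"
      "AE \<omega> in M. cond_exp_vec M (sigma_rv M (x t)) (u_gradient U f L w u x \<Lambda> t) \<omega> = \<phi> (x t \<omega>)" by blast
    then have "AE \<omega> in M. cond_exp_vec M (F t) (u_gradient U f L w u x \<Lambda> t) \<omega> =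
        cond_exp_vec M (sigma_rv M (x t)) (u_gradient U f L w u x \<Lambda> t) \<omega>"
      by eventually_elim simp
    ultimately show ?thesis by blast
  qed
  ultimately show ?thesis using \<Lambda>(1) by (intro exI[of _ \<Lambda>]) blast
qed

section \<open>Markov controls\<close>

lemma measurable_cost_from:
  fixes A :: "'c measure"
  assumes t: "t \<le> T" and a: "a \<in> borel_measurable A" "\<And>\<alpha>. a \<alpha> \<in> X t"
    and v: "\<And>s. t \<le> s \<Longrightarrow> s < T \<Longrightarrow> (\<lambda>\<alpha>. v \<alpha> s) \<in> borel_measurable A" "\<And>\<alpha> s. t \<le> s \<Longrightarrow> s < T \<Longrightarrow> v \<alpha> s \<in> U s"
    and b: "\<And>s. t < s \<Longrightarrow> s \<le> T \<Longrightarrow> (\<lambda>\<alpha>. b \<alpha> s) \<in> borel_measurable A" "\<And>\<alpha> s. t < s \<Longrightarrow> s \<le> T \<Longrightarrow> b \<alpha> s \<in> W s"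
  shows "(\<lambda>\<alpha>. cost_from T f L K t (a \<alpha>) (v \<alpha>) (b \<alpha>)) \<in> borel_measurable A"
proof -
  have st: "(\<lambda>\<alpha>. state_from f t (a \<alpha>) (v \<alpha>) (b \<alpha>) k) \<in> borel_measurable A \<and> (\<forall>\<alpha>. state_from f t (a \<alpha>) (v \<alpha>) (b \<alpha>) k \<in> X (t + k))"
    if "t + k \<le> T" for k
    using that
  proof (induction k)
    case (Suc k)
    then have "(\<lambda>\<alpha>. f (t + k) (state_from f t (a \<alpha>) (v \<alpha>) (b \<alpha>) k) (v \<alpha> (t + k)) (b \<alpha> (Suc (t + k)))) \<in> borel_measurable A"
      using v b by (intro measurable_f) auto
    moreover have "f (t + k) (state_from f t (a \<alpha>) (v \<alpha>) (b \<alpha>) k) (v \<alpha> (t + k)) (b \<alpha> (Suc (t + k))) \<in> X (Suc (t + k))" for \<alpha>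
      using Suc v b by (intro f_in) auto
    ultimately show ?case by simp
  qed (use a in simp)
  have Tt: "t + (T - t) = T" using t by simp
  show ?thesis
    unfolding cost_from_def
  proof (intro borel_measurable_add borel_measurable_sum)
    show "(\<lambda>\<alpha>. L (t + k) (state_from f t (a \<alpha>) (v \<alpha>) (b \<alpha>) k) (v \<alpha> (t + k)) (b \<alpha> (Suc (t + k)))) \<in> borel_measurable A"
      if "k \<in> {..<T - t}" for k
      using that st[of k] v b by (intro measurable_L) auto
    show "(\<lambda>\<alpha>. K (state_from f t (a \<alpha>) (v \<alpha>) (b \<alpha>) (T - t))) \<in> borel_measurable A"
      using st[of "T - t"] by (intro measurable_K) (auto simp: Tt)
  qed
qed

lemma joint_law_future:
  assumes t: "t \<le> T" and y: "y \<in> F t \<rightarrow>\<^sub>M N"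
  shows "distr M N y \<Otimes>\<^sub>M distr M (PiM {Suc t..T} (\<lambda>_. borel)) (\<lambda>\<omega>. \<lambda>s\<in>{Suc t..T}. w s \<omega>) =
    distr M (N \<Otimes>\<^sub>M PiM {Suc t..T} (\<lambda>_. borel)) (\<lambda>\<omega>. (y \<omega>, \<lambda>s\<in>{Suc t..T}. w s \<omega>))"
    (is "distr M N y \<Otimes>\<^sub>M distr M ?P ?W = ?r")
proof (rule pair_measure_eqI)
  have yM[measurable]: "y \<in> M \<rightarrow>\<^sub>M N" by (rule measurable_F_M[OF y t])
  have W[measurable]: "?W \<in> M \<rightarrow>\<^sub>M ?P" by (intro measurable_restrict) auto
  show "sigma_finite_measure (distr M N y)" "sigma_finite_measure (distr M ?P ?W)"
    by (intro finite_measure.axioms prob_space.finite_measure prob_space_distr yM W)+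
  show "sets (distr M N y \<Otimes>\<^sub>M distr M ?P ?W) = sets ?r" by simp
  fix A B assume "A \<in> sets (distr M N y)" "B \<in> sets (distr M ?P ?W)"
  then have A[measurable]: "A \<in> sets N" and B[measurable]: "B \<in> sets ?P" by auto
  have "y -` A \<inter> space M \<in> sets (F t)" using measurable_sets[OF y A] by simp
  note ind = indep_future[OF t this B]
  have "(\<lambda>\<omega>. (y \<omega>, ?W \<omega>)) -` (A \<times> B) \<inter> space M = (y -` A \<inter> space M) \<inter> (?W -` B \<inter> space M)" by auto
  then show "emeasure (distr M N y) A * emeasure (distr M ?P ?W) B = emeasure ?r (A \<times> B)"
    using ind by (simp add: emeasure_distr emeasure_eq_measure ennreal_mult)
qed

text \<open>Replacing \<open>r\<close> by \<open>\<eta> (z, q)\<close> with \<open>q\<close> uniform does not change the joint law with \<open>z\<close> and the future noise,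
  so the average over \<open>q\<close> of the new costs is the old cost; as the old cost is minimal, almost every \<open>q\<close>
  yields an optimal control.  The costs before time \<open>t\<close> need not be integrable on their own; comparing with the
  control that vanishes from \<open>t\<close> on removes them.\<close>

lemma eliminate_scalar:
  assumes v: "optimal v" and t: "t < T"
    and z: "z \<in> F t \<rightarrow>\<^sub>M N" and r: "r \<in> borel_measurable (F t)" "\<And>\<omega>. \<omega> \<in> space M \<Longrightarrow> r \<omega> \<in> {0..1::real}"
    and \<xi>: "\<xi> \<in> borel_measurable N" "\<And>\<omega>. \<omega> \<in> space M \<Longrightarrow> state v t \<omega> = \<xi> (z \<omega>)"
    and vm: "\<And>s. t \<le> s \<Longrightarrow> s < T \<Longrightarrow> v s \<in> borel_measurable (vimage_algebra (space M)
        (\<lambda>\<omega>. ((z \<omega>, r \<omega>), \<lambda>i\<in>{Suc t..s}. w i \<omega>)) ((N \<Otimes>\<^sub>M borel) \<Otimes>\<^sub>M PiM {Suc t..s} (\<lambda>_. borel)))"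
  shows "\<exists>v'. optimal v' \<and> (\<forall>s<t. v' s = v s) \<and> (\<forall>s. t \<le> s \<longrightarrow> s < T \<longrightarrow> v' s \<in> borel_measurable
      (vimage_algebra (space M) (\<lambda>\<omega>. (z \<omega>, \<lambda>i\<in>{Suc t..s}. w i \<omega>)) (N \<Otimes>\<^sub>M PiM {Suc t..s} (\<lambda>_. borel))))"
proof -
  have tT: "t \<le> T" using t by simp
  have adm: "admissible v" using v by (simp add: optimal_def)
  then have vc: "v \<in> controls M T U" by (rule admissible_controls)
  have vadm: "v s \<in> L2 M (U s)" "v s \<in> borel_measurable (F s)" "AE \<omega> in M. v s \<omega> \<in> \<Gamma>0 s" if "s < T" for s
    using adm that by (auto simp: admissible_def)
  have zM[measurable]: "z \<in> M \<rightarrow>\<^sub>M N" by (rule measurable_F_M[OF z tT])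
  have rM[measurable]: "r \<in> borel_measurable M" by (rule measurable_F_M[OF r(1) tT])
  define PW :: "(nat \<Rightarrow> 'e) measure" where "PW = PiM {Suc t..T} (\<lambda>_. borel)"
  define Wf where "Wf \<omega> = (\<lambda>s\<in>{Suc t..T}. w s \<omega>)" for \<omega>
  have Wf[measurable]: "Wf \<in> M \<rightarrow>\<^sub>M PW" unfolding Wf_def PW_def by (intro measurable_restrict) auto
  have zsp: "z \<omega> \<in> space N" if "\<omega> \<in> space M" for \<omega> using measurable_space[OF zM that] .
  have "\<exists>\<phi>\<in>borel_measurable ((N \<Otimes>\<^sub>M borel) \<Otimes>\<^sub>M PiM {Suc t..s} (\<lambda>_. borel)).
      \<forall>\<omega>\<in>space M. v s \<omega> = \<phi> ((z \<omega>, r \<omega>), \<lambda>i\<in>{Suc t..s}. w i \<omega>)" if s: "t \<le> s" "s < T" for s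
  proof -
    have sp: "(\<lambda>\<omega>. ((z \<omega>, r \<omega>), \<lambda>i\<in>{Suc t..s}. w i \<omega>)) \<in> space M \<rightarrow> space ((N \<Otimes>\<^sub>M borel) \<Otimes>\<^sub>M PiM {Suc t..s} (\<lambda>_. borel))"
      by (auto simp: space_pair_measure space_PiM zsp)
    show ?thesis by (rule doob_dynkin[OF sp vm[OF s]]) blast
  qed
  then have "\<forall>s\<in>{t..<T}. \<exists>\<phi>. \<phi> \<in> borel_measurable ((N \<Otimes>\<^sub>M borel) \<Otimes>\<^sub>M PiM {Suc t..s} (\<lambda>_. borel)) \<and>
      (\<forall>\<omega>\<in>space M. v s \<omega> = \<phi> ((z \<omega>, r \<omega>), \<lambda>i\<in>{Suc t..s}. w i \<omega>))"
    by (simp add: Bex_def)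
  from bchoice[OF this] obtain \<phi> where \<phi>: "\<forall>s\<in>{t..<T}. \<phi> s \<in> borel_measurable ((N \<Otimes>\<^sub>M borel) \<Otimes>\<^sub>M PiM {Suc t..s} (\<lambda>_. borel)) \<and>
      (\<forall>\<omega>\<in>space M. v s \<omega> = \<phi> s ((z \<omega>, r \<omega>), \<lambda>i\<in>{Suc t..s}. w i \<omega>))" ..
  \<comment> \<open>The projection makes the control legitimate at every point of the product space,
    and reading the noise up to \<open>s\<close> only keeps it nonanticipative.\<close>
  define V where "V s p = (if s < T then closest_point (U s) (\<phi> s (fst p, restrict (snd p) {Suc t..s})) else undefined)" for s p
  have V_in: "V s p \<in> U s" if "s < T" for s p
    using that closest_point_subspace(1)[OF subspace_U[OF that]] by (simp add: V_def)
  have Vs: "(\<lambda>p. closest_point (U s) (\<phi> s p)) \<in> borel_measurable ((N \<Otimes>\<^sub>M borel) \<Otimes>\<^sub>M PiM {Suc t..s} (\<lambda>_. borel))"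
    if "t \<le> s" "s < T" for s
    using \<phi> that by (intro measurable_compose[OF _ closest_point_subspace(3)[OF subspace_U[OF that(2)]]]) auto
  have V_meas[measurable]: "V s \<in> borel_measurable ((N \<Otimes>\<^sub>M borel) \<Otimes>\<^sub>M PW)" if "t \<le> s" "s < T" for s
  proof -
    have "(\<lambda>\<zeta>. restrict \<zeta> {Suc t..s}) \<in> PW \<rightarrow>\<^sub>M PiM {Suc t..s} (\<lambda>_. borel)"
      unfolding PW_def using that by (intro measurable_restrict_subset) auto
    then have "(\<lambda>p. (fst p, restrict (snd p) {Suc t..s})) \<in> (N \<Otimes>\<^sub>M borel) \<Otimes>\<^sub>M PW \<rightarrow>\<^sub>M (N \<Otimes>\<^sub>M borel) \<Otimes>\<^sub>M PiM {Suc t..s} (\<lambda>_. borel)"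
      by (intro measurable_Pair measurable_fst measurable_compose[OF measurable_snd])
    from measurable_compose[OF this Vs[OF that]] show ?thesis using that(2) by (simp add: V_def[abs_def])
  qed
  have Wf_restrict: "restrict (Wf \<omega>) {Suc t..s} = (\<lambda>i\<in>{Suc t..s}. w i \<omega>)" if "s < T" for s \<omega>
    using that by (auto simp: Wf_def restrict_def)
  have v_eq: "v s \<omega> = V s ((z \<omega>, r \<omega>), Wf \<omega>)" if "t \<le> s" "s < T" "\<omega> \<in> space M" for s \<omega>
  proof -
    have "v s \<omega> = \<phi> s ((z \<omega>, r \<omega>), \<lambda>i\<in>{Suc t..s}. w i \<omega>)" using \<phi> that by simp
    then show ?thesis
      using controls_in[OF vc that(2,3)] closest_point_subspace(2)[OF subspace_U[OF that(2)]] that(2)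
      by (simp add: V_def Wf_restrict)
  qed
  \<comment> \<open>The state at \<open>t\<close> is a function of \<open>z\<close> alone, so
    another value in place of \<open>r\<close> leaves the starting point of the tail
    unchanged.\<close>
  define a0 where "a0 p = closest_point (X t) (\<xi> (fst (fst p)))" for p :: "('b \<times> real) \<times> (nat \<Rightarrow> 'e)"
  define b0 where "b0 p s = closest_point (W s) (snd p s)" for p :: "('b \<times> real) \<times> (nat \<Rightarrow> 'e)" and s
  define H where "H p = cost_from T f L K t (a0 p) (\<lambda>s. V s p) (b0 p) - cost_from T f L K t (a0 p) (\<lambda>_. 0) (b0 p)" for p
  have a0_in: "a0 p \<in> X t" for p
    unfolding a0_def by (rule closest_point_subspace(1)[OF subspace_X[OF tT]])
  have b0_in: "b0 p s \<in> W s" if "s \<le> T" for p s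
    unfolding b0_def by (rule closest_point_subspace(1)[OF subspace_W[OF that]])
  have a0m: "a0 \<in> borel_measurable ((N \<Otimes>\<^sub>M borel) \<Otimes>\<^sub>M PW)"
    unfolding a0_def
    by (intro measurable_compose[OF _ closest_point_subspace(3)[OF subspace_X[OF tT]]] measurable_compose[OF _ \<xi>(1)]
        measurable_compose[OF measurable_fst measurable_fst])
  have b0m: "(\<lambda>p. b0 p s) \<in> borel_measurable ((N \<Otimes>\<^sub>M borel) \<Otimes>\<^sub>M PW)" if "t < s" "s \<le> T" for s
  proof -
    have "(\<lambda>\<zeta>. \<zeta> s) \<in> borel_measurable PW" unfolding PW_def using that by (intro measurable_component_singleton) auto
    then show ?thesis
      unfolding b0_def
      by (intro measurable_compose[OF _ closest_point_subspace(3)[OF subspace_W[OF that(2)]]] measurable_compose[OF measurable_snd])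
  qed
  have H[measurable]: "H \<in> borel_measurable ((N \<Otimes>\<^sub>M borel) \<Otimes>\<^sub>M PW)"
    unfolding H_def using a0_in b0_in V_in subspace_0[OF subspace_U]
    by (intro borel_measurable_diff measurable_cost_from tT a0m b0m V_meas) auto
  \<comment> \<open>Integrability of the total cost is available for every element of
    \<open>controls\<close>, constraint or not, so continuing with the zero control is a legitimate
    reference.\<close>
  define u0 where "u0 s = (if s < t then v s else (\<lambda>_. 0))" for s
  have u0c: "u0 \<in> controls M T U"
    using vadm L2_const[OF finite_measure_axioms subspace_0[OF subspace_U]] by (auto simp: u0_def controls_def)
  \<comment> \<open>Valid for any substituted value \<open>\<rho>\<close>: it is used with
    \<open>r\<close> for the old control and with the quantile for the new ones. The cost before
    \<open>t\<close> is common to both and is contained in that of \<open>u0\<close>.\<close>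
  have cost_diff: "total_cost T f L K (\<lambda>s. v' s \<omega>) (\<lambda>s. w s \<omega>) =
      total_cost T f L K (\<lambda>s. u0 s \<omega>) (\<lambda>s. w s \<omega>) + H ((z \<omega>, \<rho>), Wf \<omega>)"
    if \<omega>: "\<omega> \<in> space M" and 1: "\<And>s. s < t \<Longrightarrow> v' s = v s" and 2: "\<And>s. t \<le> s \<Longrightarrow> s < T \<Longrightarrow> v' s \<omega> = V s ((z \<omega>, \<rho>), Wf \<omega>)" for v' \<rho> \<omega>
  proof -
    let ?w = "\<lambda>s. w s \<omega>" and ?p = "((z \<omega>, \<rho>), Wf \<omega>)"
    have st: "state v' s \<omega> = state v s \<omega>" "state u0 s \<omega> = state v s \<omega>" if "s \<le> t" for s
      using 1 that by (auto intro!: traj_cong simp: u0_def)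
    have "a0 ?p = state v t \<omega>"
      using state_in[OF vc tT \<omega>] \<xi>(2)[OF \<omega>] closest_point_subspace(2)[OF subspace_X[OF tT]] by (simp add: a0_def)
    moreover have b: "b0 ?p s = w s \<omega>" if "t < s" "s \<le> T" for s
      using that w_in[OF that(2) \<omega>] closest_point_subspace(2)[OF subspace_W[OF that(2)]] by (simp add: b0_def Wf_def)
    moreover have "cost_from T f L K t (state v t \<omega>) (\<lambda>s. v' s \<omega>) ?w = cost_from T f L K t (state v t \<omega>) (\<lambda>s. V s ?p) (b0 ?p)"
      using 2 b tT by (intro cost_from_cong) auto
    moreover have "cost_from T f L K t (state v t \<omega>) (\<lambda>s. u0 s \<omega>) ?w = cost_from T f L K t (state v t \<omega>) (\<lambda>_. 0) (b0 ?p)"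
      using b tT by (intro cost_from_cong) (auto simp: u0_def)
    moreover have "(\<Sum>s<t. L s (state v' s \<omega>) (v' s \<omega>) (w (Suc s) \<omega>)) = (\<Sum>s<t. L s (state u0 s \<omega>) (u0 s \<omega>) (w (Suc s) \<omega>))"
    proof (intro sum.cong refl)
      fix s assume "s \<in> {..<t}"
      then have "s < t" "u0 s = v s" by (simp_all add: u0_def)
      then show "L s (state v' s \<omega>) (v' s \<omega>) (w (Suc s) \<omega>) = L s (state u0 s \<omega>) (u0 s \<omega>) (w (Suc s) \<omega>)"
        using st[of s] 1[of s] by simp
    qed
    ultimately show ?thesis
      unfolding total_cost_split[OF tT] by (simp add: H_def st)
  qed
  define Q where "Q = uniform_measure lborel {0..1::real}"
  obtain \<eta> where \<eta>[measurable]: "\<eta> \<in> borel_measurable (N \<Otimes>\<^sub>M borel)"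
    and law\<eta>: "distr (distr M N z \<Otimes>\<^sub>M Q) (N \<Otimes>\<^sub>M borel) (\<lambda>(n, q). (n, \<eta> (n, q))) = distr M (N \<Otimes>\<^sub>M borel) (\<lambda>\<omega>. (z \<omega>, r \<omega>))"
    unfolding Q_def by (rule conditional_quantile[OF zM rM r(2)])
  interpret Q: prob_space Q unfolding Q_def by (intro prob_space_uniform_measure) auto
  have setsQ[measurable_cong]: "sets Q = sets borel" by (simp add: Q_def)
  let ?\<nu> = "distr M N z" and ?\<kappa> = "distr M PW Wf"
  interpret \<nu>: prob_space ?\<nu> by (rule prob_space_distr) measurable
  interpret \<kappa>: prob_space ?\<kappa> by (rule prob_space_distr) measurable
  interpret \<nu>\<kappa>: pair_prob_space ?\<nu> ?\<kappa> ..
  interpret \<nu>Q: pair_prob_space ?\<nu> Q ..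
  interpret Q\<nu>\<kappa>: pair_prob_space Q "?\<nu> \<Otimes>\<^sub>M ?\<kappa>" ..
  \<comment> \<open>The level comes first so that Fubini leaves it outermost and yields one
    statement for each level.\<close>
  define m where "m = (\<lambda>(q, (n, \<zeta>)). ((n, \<eta> (n, q)), \<zeta> :: nat \<Rightarrow> 'e))"
  have m[measurable]: "m \<in> Q \<Otimes>\<^sub>M (?\<nu> \<Otimes>\<^sub>M ?\<kappa>) \<rightarrow>\<^sub>M (N \<Otimes>\<^sub>M borel) \<Otimes>\<^sub>M PW"
    unfolding m_def by measurable
  have mq': "(\<lambda>y. m (q, y)) \<in> ?\<nu> \<Otimes>\<^sub>M ?\<kappa> \<rightarrow>\<^sub>M (N \<Otimes>\<^sub>M borel) \<Otimes>\<^sub>M PW" for q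
    by (rule measurable_compose[OF measurable_Pair1' m]) (simp add: Q_def)
  moreover have "sets (?\<nu> \<Otimes>\<^sub>M ?\<kappa>) = sets (N \<Otimes>\<^sub>M PW)" by (intro sets_pair_measure_cong) simp_all
  ultimately have mq: "(\<lambda>y. m (q, y)) \<in> N \<Otimes>\<^sub>M PW \<rightarrow>\<^sub>M (N \<Otimes>\<^sub>M borel) \<Otimes>\<^sub>M PW" for q
    using measurable_cong_sets[of "?\<nu> \<Otimes>\<^sub>M ?\<kappa>" "N \<Otimes>\<^sub>M PW"] by blast
  have law2: "?\<nu> \<Otimes>\<^sub>M ?\<kappa> = distr M (N \<Otimes>\<^sub>M PW) (\<lambda>\<omega>. (z \<omega>, Wf \<omega>))"
    unfolding PW_def Wf_def by (rule joint_law_future[OF tT z])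
  \<comment> \<open>The future noise is independent of everything known at \<open>t\<close>, which
    extends the equality of laws \<open>law\<eta>\<close> from the pair to the whole argument of
    \<open>H\<close>.\<close>
  have law3: "distr (Q \<Otimes>\<^sub>M (?\<nu> \<Otimes>\<^sub>M ?\<kappa>)) ((N \<Otimes>\<^sub>M borel) \<Otimes>\<^sub>M PW) m =
      distr M ((N \<Otimes>\<^sub>M borel) \<Otimes>\<^sub>M PW) (\<lambda>\<omega>. ((z \<omega>, r \<omega>), Wf \<omega>))"
  proof -
    have "distr M (N \<Otimes>\<^sub>M borel) (\<lambda>\<omega>. (z \<omega>, r \<omega>)) \<Otimes>\<^sub>M ?\<kappa> = distr (Q \<Otimes>\<^sub>M (?\<nu> \<Otimes>\<^sub>M ?\<kappa>)) ((N \<Otimes>\<^sub>M borel) \<Otimes>\<^sub>M PW) m" (is "?a = ?b")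
    proof (rule pair_measure_eqI)
      show "sigma_finite_measure (distr M (N \<Otimes>\<^sub>M borel) (\<lambda>\<omega>. (z \<omega>, r \<omega>)))"
        by (intro finite_measure.axioms prob_space.finite_measure prob_space_distr) measurable
      show "sigma_finite_measure ?\<kappa>" ..
      show "sets ?a = sets ?b" by simp
      fix A B assume "A \<in> sets (distr M (N \<Otimes>\<^sub>M borel) (\<lambda>\<omega>. (z \<omega>, r \<omega>)))" "B \<in> sets ?\<kappa>"
      then have A[measurable]: "A \<in> sets (N \<Otimes>\<^sub>M borel)" and B[measurable]: "B \<in> sets PW" by auto
      have gm: "(\<lambda>(n, q). (n, \<eta> (n, q))) \<in> ?\<nu> \<Otimes>\<^sub>M Q \<rightarrow>\<^sub>M N \<Otimes>\<^sub>M borel" by measurable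
      have "emeasure ?b (A \<times> B) = (\<integral>\<^sup>+x. indicator (A \<times> B) x \<partial>?b)" by simp
      also have "\<dots> = (\<integral>\<^sup>+x. indicator (A \<times> B) (m x) \<partial>(Q \<Otimes>\<^sub>M (?\<nu> \<Otimes>\<^sub>M ?\<kappa>)))"
        by (rule nn_integral_distr) measurable
      also have "\<dots> = (\<integral>\<^sup>+q. \<integral>\<^sup>+y. indicator (A \<times> B) (m (q, y)) \<partial>(?\<nu> \<Otimes>\<^sub>M ?\<kappa>) \<partial>Q)"
        by (rule \<nu>\<kappa>.P.nn_integral_fst[symmetric]) measurable
      also have "\<dots> = (\<integral>\<^sup>+q. (\<integral>\<^sup>+n. indicator A (n, \<eta> (n, q)) \<partial>?\<nu>) * emeasure ?\<kappa> B \<partial>Q)"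
      proof (intro nn_integral_cong)
        fix q assume "q \<in> space Q"
        have "(\<integral>\<^sup>+y. indicator (A \<times> B) (m (q, y)) \<partial>(?\<nu> \<Otimes>\<^sub>M ?\<kappa>)) = (\<integral>\<^sup>+n. \<integral>\<^sup>+\<zeta>. indicator (A \<times> B) (m (q, (n, \<zeta>))) \<partial>?\<kappa> \<partial>?\<nu>)"
          by (rule \<kappa>.nn_integral_fst[symmetric])
            (rule measurable_compose[OF mq' borel_measurable_indicator[OF pair_measureI[OF A B]]])
        also have "\<dots> = (\<integral>\<^sup>+n. \<integral>\<^sup>+\<zeta>. indicator A (n, \<eta> (n, q)) * indicator B \<zeta> \<partial>?\<kappa> \<partial>?\<nu>)"
          by (intro nn_integral_cong) (auto simp: m_def indicator_def)
        also have "\<dots> = (\<integral>\<^sup>+n. indicator A (n, \<eta> (n, q)) * emeasure ?\<kappa> B \<partial>?\<nu>)"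
          by (intro nn_integral_cong) (simp add: nn_integral_cmult)
        also have "\<dots> = (\<integral>\<^sup>+n. indicator A (n, \<eta> (n, q)) \<partial>?\<nu>) * emeasure ?\<kappa> B"
          by (rule nn_integral_multc) measurable
        finally show "(\<integral>\<^sup>+y. indicator (A \<times> B) (m (q, y)) \<partial>(?\<nu> \<Otimes>\<^sub>M ?\<kappa>)) = (\<integral>\<^sup>+n. indicator A (n, \<eta> (n, q)) \<partial>?\<nu>) * emeasure ?\<kappa> B" .
      qed
      also have "\<dots> = (\<integral>\<^sup>+q. (\<integral>\<^sup>+n. indicator A (n, \<eta> (n, q)) \<partial>?\<nu>) \<partial>Q) * emeasure ?\<kappa> B"
        by (rule nn_integral_multc) measurable
      also have "(\<integral>\<^sup>+q. (\<integral>\<^sup>+n. indicator A (n, \<eta> (n, q)) \<partial>?\<nu>) \<partial>Q) = (\<integral>\<^sup>+n. (\<integral>\<^sup>+q. indicator A (n, \<eta> (n, q)) \<partial>Q) \<partial>?\<nu>)"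
        by (rule \<nu>Q.Fubini') measurable
      also have "\<dots> = (\<integral>\<^sup>+x. indicator A ((\<lambda>(n, q). (n, \<eta> (n, q))) x) \<partial>(?\<nu> \<Otimes>\<^sub>M Q))"
        using Q.nn_integral_fst[OF measurable_compose[OF gm borel_measurable_indicator[OF A]]] by simp
      also have "\<dots> = emeasure (distr M (N \<Otimes>\<^sub>M borel) (\<lambda>\<omega>. (z \<omega>, r \<omega>))) A"
        unfolding law\<eta>[symmetric]
        using nn_integral_distr[OF gm, of "indicator A"] A by simp
      finally show "emeasure (distr M (N \<Otimes>\<^sub>M borel) (\<lambda>\<omega>. (z \<omega>, r \<omega>))) A * emeasure ?\<kappa> B = emeasure ?b (A \<times> B)" by simp
    qed
    moreover have "(\<lambda>\<omega>. (z \<omega>, r \<omega>)) \<in> F t \<rightarrow>\<^sub>M N \<Otimes>\<^sub>M borel" using z r(1) by (intro measurable_Pair)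
    from joint_law_future[OF tT this] have "?a = distr M ((N \<Otimes>\<^sub>M borel) \<Otimes>\<^sub>M PW) (\<lambda>\<omega>. ((z \<omega>, r \<omega>), Wf \<omega>))"
      unfolding PW_def Wf_def .
    ultimately show ?thesis by simp
  qed
  define pq where "pq q \<omega> = ((z \<omega>, \<eta> (z \<omega>, q)), Wf \<omega>)" for q \<omega>
  have pq_m: "pq q \<omega> = m (q, (z \<omega>, Wf \<omega>))" for q \<omega> by (simp add: pq_def m_def)
  have pq_meas[measurable]: "pq q \<in> M \<rightarrow>\<^sub>M (N \<Otimes>\<^sub>M borel) \<Otimes>\<^sub>M PW" for q unfolding pq_def by measurable
  have pr_meas[measurable]: "(\<lambda>\<omega>. ((z \<omega>, r \<omega>), Wf \<omega>)) \<in> M \<rightarrow>\<^sub>M (N \<Otimes>\<^sub>M borel) \<Otimes>\<^sub>M PW" by measurable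
  have zW[measurable]: "(\<lambda>\<omega>. (z \<omega>, Wf \<omega>)) \<in> M \<rightarrow>\<^sub>M N \<Otimes>\<^sub>M PW" by measurable
  \<comment> \<open>The random level lives on an auxiliary space; after Fubini it is a fixed number,
    so the new controls are again defined on the original probability space.\<close>
  have AEq: "AE q in Q. AE \<omega> in M. P (pq q \<omega>)"
    if AE: "AE \<omega> in M. P ((z \<omega>, r \<omega>), Wf \<omega>)" and P[measurable]: "Measurable.pred ((N \<Otimes>\<^sub>M borel) \<Otimes>\<^sub>M PW) P" for P
  proof -
    have "AE x in distr M ((N \<Otimes>\<^sub>M borel) \<Otimes>\<^sub>M PW) (\<lambda>\<omega>. ((z \<omega>, r \<omega>), Wf \<omega>)). P x"
      using AE by (subst AE_distr_iff) auto
    then have "AE x in Q \<Otimes>\<^sub>M (?\<nu> \<Otimes>\<^sub>M ?\<kappa>). P (m x)"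
      unfolding law3[symmetric] by (subst (asm) AE_distr_iff) auto
    then have "AE q in Q. AE y in ?\<nu> \<Otimes>\<^sub>M ?\<kappa>. P (m (q, y))"
      by (rule Q\<nu>\<kappa>.AE_pair)
    then show ?thesis
    proof eventually_elim
      case (elim q)
      then show ?case unfolding law2 pq_m by (intro AE_distrD[OF zW, of "\<lambda>y. P (m (q, y))"]) 
    qed
  qed
  have intq: "AE q in Q. integrable M (\<lambda>\<omega>. h (pq q \<omega>))"
    "integrable Q (\<lambda>q. \<integral>\<omega>. h (pq q \<omega>) \<partial>M)"
    "(\<integral>q. (\<integral>\<omega>. h (pq q \<omega>) \<partial>M) \<partial>Q) = (\<integral>\<omega>. h ((z \<omega>, r \<omega>), Wf \<omega>) \<partial>M)"
    if h[measurable]: "h \<in> borel_measurable ((N \<Otimes>\<^sub>M borel) \<Otimes>\<^sub>M PW)" and int: "integrable M (\<lambda>\<omega>. h ((z \<omega>, r \<omega>), Wf \<omega>))" for h :: "_ \<Rightarrow> real"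
  proof -
    have "integrable (distr M ((N \<Otimes>\<^sub>M borel) \<Otimes>\<^sub>M PW) (\<lambda>\<omega>. ((z \<omega>, r \<omega>), Wf \<omega>))) h"
      using int by (subst integrable_distr_eq) auto
    then have i: "integrable (Q \<Otimes>\<^sub>M (?\<nu> \<Otimes>\<^sub>M ?\<kappa>)) (\<lambda>x. h (m x))"
      unfolding law3[symmetric] by (subst (asm) integrable_distr_eq) auto
    have hm: "(\<lambda>y. h (m (q, y))) \<in> borel_measurable (N \<Otimes>\<^sub>M PW)" for q
      by (rule measurable_compose[OF mq h])
    have eqi: "integrable (?\<nu> \<Otimes>\<^sub>M ?\<kappa>) (\<lambda>y. h (m (q, y))) \<longleftrightarrow> integrable M (\<lambda>\<omega>. h (pq q \<omega>))" for q
      unfolding law2 pq_m by (rule integrable_distr_eq[OF zW hm])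
    have eqI: "(\<integral>y. h (m (q, y)) \<partial>(?\<nu> \<Otimes>\<^sub>M ?\<kappa>)) = (\<integral>\<omega>. h (pq q \<omega>) \<partial>M)" for q
      unfolding law2 pq_m by (rule integral_distr[OF zW hm])
    show "AE q in Q. integrable M (\<lambda>\<omega>. h (pq q \<omega>))"
      using Q\<nu>\<kappa>.AE_integrable_fst'[OF i] unfolding eqi .
    show "integrable Q (\<lambda>q. \<integral>\<omega>. h (pq q \<omega>) \<partial>M)"
      using Q\<nu>\<kappa>.integrable_fst'[OF i] unfolding eqI .
    have "(\<integral>q. (\<integral>\<omega>. h (pq q \<omega>) \<partial>M) \<partial>Q) = (\<integral>x. h (m x) \<partial>(Q \<Otimes>\<^sub>M (?\<nu> \<Otimes>\<^sub>M ?\<kappa>)))"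
      using Q\<nu>\<kappa>.integral_fst'[OF i] unfolding eqI .
    also have "\<dots> = (\<integral>\<omega>. h ((z \<omega>, r \<omega>), Wf \<omega>) \<partial>M)"
      using integral_distr[OF m h] integral_distr[OF pr_meas h] by (simp add: law3)
    finally show "(\<integral>q. (\<integral>\<omega>. h (pq q \<omega>) \<partial>M) \<partial>Q) = (\<integral>\<omega>. h ((z \<omega>, r \<omega>), Wf \<omega>) \<partial>M)" .
  qed
  define vq where "vq q s = (if s < t then v s else (\<lambda>\<omega>. V s (pq q \<omega>)))" for q s
  have vq_sigma: "vq q s \<in> borel_measurable (vimage_algebra (space M) (\<lambda>\<omega>. (z \<omega>, \<lambda>i\<in>{Suc t..s}. w i \<omega>)) (N \<Otimes>\<^sub>M PiM {Suc t..s} (\<lambda>_. borel)))"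
    if s: "t \<le> s" "s < T" for q s
  proof -
    define g where "g y = closest_point (U s) (\<phi> s ((fst y, \<eta> (fst y, q)), snd y))" for y
    have "(\<lambda>y. ((fst y, \<eta> (fst y, q)), snd y)) \<in> N \<Otimes>\<^sub>M PiM {Suc t..s} (\<lambda>_. borel) \<rightarrow>\<^sub>M (N \<Otimes>\<^sub>M borel) \<Otimes>\<^sub>M PiM {Suc t..s} (\<lambda>_. borel)"
      by measurable
    from measurable_compose[OF this Vs[OF s]]
    have g: "g \<in> borel_measurable (N \<Otimes>\<^sub>M PiM {Suc t..s} (\<lambda>_. borel))" by (simp add: g_def[abs_def])
    have sp: "(\<lambda>\<omega>. (z \<omega>, \<lambda>i\<in>{Suc t..s}. w i \<omega>)) \<in> space M \<rightarrow> space (N \<Otimes>\<^sub>M PiM {Suc t..s} (\<lambda>_. borel))"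
      by (auto simp: space_pair_measure space_PiM zsp)
    have "vq q s = (\<lambda>\<omega>. g (z \<omega>, \<lambda>i\<in>{Suc t..s}. w i \<omega>))"
      using s by (simp add: vq_def g_def V_def pq_def Wf_restrict fun_eq_iff)
    then show ?thesis using measurable_compose[OF measurable_vimage_algebra1[OF sp] g] by simp
  qed
  have sub_F: "g \<in> borel_measurable (F s)"
    if g: "g \<in> borel_measurable (vimage_algebra (space M) (\<lambda>\<omega>. (z \<omega>, \<lambda>i\<in>{Suc t..s}. w i \<omega>)) (N \<Otimes>\<^sub>M PiM {Suc t..s} (\<lambda>_. borel)))"
      and s: "t \<le> s" for g :: "'a \<Rightarrow> 'u" and s
  proof -
    have "(\<lambda>\<omega>. (z \<omega>, \<lambda>i\<in>{Suc t..s}. w i \<omega>)) \<in> F s \<rightarrow>\<^sub>M N \<Otimes>\<^sub>M PiM {Suc t..s} (\<lambda>_. borel)"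
      using measurable_F_mono[OF z s] by (intro measurable_Pair measurable_noise_restrict) auto
    from measurable_sets[OF this]
    have "sets (vimage_algebra (space M) (\<lambda>\<omega>. (z \<omega>, \<lambda>i\<in>{Suc t..s}. w i \<omega>)) (N \<Otimes>\<^sub>M PiM {Suc t..s} (\<lambda>_. borel))) \<subseteq> sets (F s)"
      by (auto simp: sets_vimage_algebra2 space_pair_measure space_PiM zsp)
    then show ?thesis using g by (auto simp: measurable_def)
  qed
  \<comment> \<open>The constraint and square integrability depend on the joint law and therefore
    survive for almost every level; adaptedness holds for each level.\<close>
  have "AE q in Q. admissible (vq q)"
  proof -
    have "AE q in Q. \<forall>s\<in>{t..<T}. AE \<omega> in M. V s (pq q \<omega>) \<in> \<Gamma>0 s"
    proof (intro AE_finite_allI AEq)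
      fix s assume s: "s \<in> {t..<T}"
      then have [measurable]: "V s \<in> borel_measurable ((N \<Otimes>\<^sub>M borel) \<Otimes>\<^sub>M PW)" "\<Gamma>0 s \<in> sets borel"
        using V_meas \<Gamma>0(1) by auto
      show "Measurable.pred ((N \<Otimes>\<^sub>M borel) \<Otimes>\<^sub>M PW) (\<lambda>p. V s p \<in> \<Gamma>0 s)" by measurable
      have "s < T" "t \<le> s" using s by auto
      show "AE \<omega> in M. V s ((z \<omega>, r \<omega>), Wf \<omega>) \<in> \<Gamma>0 s"
        using vadm(3)[OF \<open>s < T\<close>] AE_space
        by eventually_elim (simp add: v_eq[OF \<open>t \<le> s\<close> \<open>s < T\<close>, symmetric])
    qed simp
    moreover have "AE q in Q. \<forall>s\<in>{t..<T}. integrable M (\<lambda>\<omega>. (norm (V s (pq q \<omega>)))\<^sup>2)"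
    proof (intro AE_finite_allI intq(1))
      fix s assume s: "s \<in> {t..<T}"
      then have [measurable]: "V s \<in> borel_measurable ((N \<Otimes>\<^sub>M borel) \<Otimes>\<^sub>M PW)" using V_meas by auto
      show "(\<lambda>p. (norm (V s p))\<^sup>2) \<in> borel_measurable ((N \<Otimes>\<^sub>M borel) \<Otimes>\<^sub>M PW)" by measurable
      have "integrable M (\<lambda>\<omega>. (norm (v s \<omega>))\<^sup>2)" using vadm(1)[of s] s by (simp add: L2_def)
      also have "integrable M (\<lambda>\<omega>. (norm (v s \<omega>))\<^sup>2) \<longleftrightarrow> integrable M (\<lambda>\<omega>. (norm (V s ((z \<omega>, r \<omega>), Wf \<omega>)))\<^sup>2)"
        using s by (intro Bochner_Integration.integrable_cong refl) (simp add: v_eq[symmetric])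
      finally show "integrable M (\<lambda>\<omega>. (norm (V s ((z \<omega>, r \<omega>), Wf \<omega>)))\<^sup>2)" .
    qed simp
    ultimately show ?thesis
    proof eventually_elim
      case (elim q)
      show ?case
        unfolding admissible_def
      proof (intro allI impI)
        fix s assume s: "s < T"
        show "vq q s \<in> L2 M (U s) \<and> vq q s \<in> borel_measurable (F s) \<and> (AE \<omega> in M. vq q s \<omega> \<in> \<Gamma>0 s)"
        proof (cases "s < t")
          case True
          then show ?thesis using vadm[OF s] by (simp add: vq_def)
        next
          case False
          then have ts: "t \<le> s" by simp
          have mF: "vq q s \<in> borel_measurable (F s)" by (rule sub_F[OF vq_sigma[OF ts s] ts])
          have "vq q s \<in> borel_measurable M" using s by (intro measurable_F_M[OF mF]) simp
          then have "vq q s \<in> L2 M (U s)"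
            using elim(2) ts s V_in[OF s] by (auto simp: L2_def RV_def vq_def)
          then show ?thesis using mF elim(1) ts s by (simp add: vq_def)
        qed
      qed
    qed
  qed
  moreover have intH: "integrable M (\<lambda>\<omega>. H ((z \<omega>, r \<omega>), Wf \<omega>))"
    and costv: "cost v = cost u0 + (\<integral>\<omega>. H ((z \<omega>, r \<omega>), Wf \<omega>) \<partial>M)"
  proof -
    have eq: "total_cost T f L K (\<lambda>s. v s \<omega>) (\<lambda>s. w s \<omega>) - total_cost T f L K (\<lambda>s. u0 s \<omega>) (\<lambda>s. w s \<omega>) = H ((z \<omega>, r \<omega>), Wf \<omega>)"
      if "\<omega> \<in> space M" for \<omega>
      using cost_diff[OF that, of v "r \<omega>"] v_eq that by simp
    have "integrable M (\<lambda>\<omega>. total_cost T f L K (\<lambda>s. v s \<omega>) (\<lambda>s. w s \<omega>) - total_cost T f L K (\<lambda>s. u0 s \<omega>) (\<lambda>s. w s \<omega>))"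
      by (intro Bochner_Integration.integrable_diff integrable_total_cost vc u0c)
    also have "?this \<longleftrightarrow> integrable M (\<lambda>\<omega>. H ((z \<omega>, r \<omega>), Wf \<omega>))"
      using eq by (intro Bochner_Integration.integrable_cong refl)
    finally show "integrable M (\<lambda>\<omega>. H ((z \<omega>, r \<omega>), Wf \<omega>))" .
    have "(\<integral>\<omega>. H ((z \<omega>, r \<omega>), Wf \<omega>) \<partial>M) = (\<integral>\<omega>. total_cost T f L K (\<lambda>s. v s \<omega>) (\<lambda>s. w s \<omega>) - total_cost T f L K (\<lambda>s. u0 s \<omega>) (\<lambda>s. w s \<omega>) \<partial>M)"
      using eq by (intro Bochner_Integration.integral_cong refl) simp
    then show "cost v = cost u0 + (\<integral>\<omega>. H ((z \<omega>, r \<omega>), Wf \<omega>) \<partial>M)"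
      using integrable_total_cost[OF vc] integrable_total_cost[OF u0c] by (simp add: cost_def)
  qed
  have costq: "cost (vq q) = cost u0 + (\<integral>\<omega>. H (pq q \<omega>) \<partial>M)" if "admissible (vq q)" for q
  proof -
    have eq: "total_cost T f L K (\<lambda>s. vq q s \<omega>) (\<lambda>s. w s \<omega>) - total_cost T f L K (\<lambda>s. u0 s \<omega>) (\<lambda>s. w s \<omega>) = H (pq q \<omega>)"
      if "\<omega> \<in> space M" for \<omega>
      using cost_diff[OF that, of "vq q" "\<eta> (z \<omega>, q)"] by (simp add: vq_def pq_def)
    have "(\<integral>\<omega>. H (pq q \<omega>) \<partial>M) = (\<integral>\<omega>. total_cost T f L K (\<lambda>s. vq q s \<omega>) (\<lambda>s. w s \<omega>) - total_cost T f L K (\<lambda>s. u0 s \<omega>) (\<lambda>s. w s \<omega>) \<partial>M)"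
      using eq by (intro Bochner_Integration.integral_cong refl) simp
    then show ?thesis
      using integrable_total_cost[OF admissible_controls[OF that]] integrable_total_cost[OF u0c] by (simp add: cost_def)
  qed
  define I0 where "I0 = (\<integral>\<omega>. H ((z \<omega>, r \<omega>), Wf \<omega>) \<partial>M)"
  have ge: "AE q in Q. 0 \<le> (\<integral>\<omega>. H (pq q \<omega>) \<partial>M) - I0"
    using \<open>AE q in Q. admissible (vq q)\<close>
  proof eventually_elim
    case (elim q)
    then have "cost v \<le> cost (vq q)" using v by (simp add: optimal_def)
    then show ?case by (simp add: costv costq[OF elim] I0_def)
  qed
  have "(\<integral>q. ((\<integral>\<omega>. H (pq q \<omega>) \<partial>M) - I0) \<partial>Q) = 0"
    using intq(2,3)[OF H intH] by (simp add: I0_def Q.prob_space)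
  then have "AE q in Q. (\<integral>\<omega>. H (pq q \<omega>) \<partial>M) - I0 = 0"
    using ge intq(2)[OF H intH] by (subst (asm) integral_nonneg_eq_0_iff_AE) auto
  with \<open>AE q in Q. admissible (vq q)\<close> have "AE q in Q. admissible (vq q) \<and> (\<integral>\<omega>. H (pq q \<omega>) \<partial>M) = I0"
    by eventually_elim simp
  then have "\<exists>q. admissible (vq q) \<and> (\<integral>\<omega>. H (pq q \<omega>) \<partial>M) = I0"
  proof (rule contrapos_pp)
    assume "\<nexists>q. admissible (vq q) \<and> (\<integral>\<omega>. H (pq q \<omega>) \<partial>M) = I0"
    then have "(\<lambda>q. admissible (vq q) \<and> (\<integral>\<omega>. H (pq q \<omega>) \<partial>M) = I0) = (\<lambda>_. False)" by blast
    then show "\<not> (AE q in Q. admissible (vq q) \<and> (\<integral>\<omega>. H (pq q \<omega>) \<partial>M) = I0)" by (simp only: Q.AE_False) simp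
  qed
  then obtain q where q: "admissible (vq q)" "(\<integral>\<omega>. H (pq q \<omega>) \<partial>M) = I0" by blast
  have "cost (vq q) = cost v" by (simp add: costq[OF q(1)] q(2) costv I0_def)
  then have "optimal (vq q)" using q(1) v by (simp add: optimal_def)
  moreover have "vq q s = v s" if "s < t" for s using that by (simp add: vq_def)
  ultimately show ?thesis using vq_sigma by blast
qed

text \<open>The controls before \<open>t\<close> are kept, so the feedback property reached so far
  survives. Those after \<open>t\<close> may change, but they have their own turn later.\<close>

lemma markov_step:
  assumes v: "optimal v" and t: "t < T" and past: "\<And>s. s < t \<Longrightarrow> rv_preceq M (v s) (state v s)"
  shows "\<exists>v'. optimal v' \<and> (\<forall>s<Suc t. rv_preceq M (v' s) (state v' s))"
proof -
  \<comment> \<open>The coordinates of the past noise, squeezed into \<open>[0, 1]\<close>; they are eliminated one by one.\<close>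
  define h where "h = (\<lambda>(i, b) \<omega>. 1 / 2 + arctan (w i \<omega> \<bullet> b) / pi)"
  \<comment> \<open>The inverse of the squeezing: no information is lost, and the past noise can be
    recovered from the coordinates.\<close>
  define uh where "uh c = tan (pi * (c - 1 / 2))" for c :: real
  have uh_h: "uh (h (i, b) \<omega>) = w i \<omega> \<bullet> b" for i b \<omega> by (simp add: uh_def h_def tan_arctan)
  have uh_meas[measurable]: "uh \<in> borel_measurable borel"
    unfolding uh_def tan_def by measurable
  have h_F: "h j \<in> borel_measurable (F t)" if "j \<in> {..t} \<times> Basis" for j
    using that w_F[of "fst j" t] by (auto simp: h_def split: prod.split)
  have h01: "h j \<omega> \<in> {0..1}" for j \<omega>
  proof -
    obtain i b where j: "j = (i, b)" by (cases j)
    define y where "y = w i \<omega> \<bullet> b"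
    have "- (1 / 2) \<le> arctan y / pi" "arctan y / pi \<le> 1 / 2"
      using arctan_bounded[of y] by (simp_all add: field_simps)
    then have "0 \<le> 1 / 2 + arctan y / pi" "1 / 2 + arctan y / pi \<le> 1" by linarith+
    then show ?thesis unfolding j h_def y_def by simp
  qed
  \<comment> \<open>\<open>J\<close> collects the past coordinates not yet eliminated. The noise
    after \<open>t\<close> always stays available, because only the past is to be forgotten.\<close>
  define A where "A J v s = vimage_algebra (space M) (\<lambda>\<omega>. ((state v t \<omega>, \<lambda>j\<in>J. h j \<omega>), \<lambda>i\<in>{Suc t..s}. w i \<omega>))
      ((borel \<Otimes>\<^sub>M PiM J (\<lambda>_. borel)) \<Otimes>\<^sub>M PiM {Suc t..s} (\<lambda>_. borel))" for J :: "(nat \<times> 'e) set" and v s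
  \<comment> \<open>The invariant concerns all times from \<open>t\<close> on: to eliminate a
    coordinate, every control that may use it has to be expressed through it.\<close>
  define Q where "Q J v \<longleftrightarrow> optimal v \<and> (\<forall>s<t. rv_preceq M (v s) (state v s)) \<and>
      (\<forall>s. t \<le> s \<longrightarrow> s < T \<longrightarrow> v s \<in> borel_measurable (A J v s))" for J v
  have stF: "state v t \<in> borel_measurable (F t)" if "optimal v" for v
    using that t by (intro state_F admissible_controls) (auto simp: optimal_def admissible_def)
  have start: "Q ({..t} \<times> Basis) v"
    unfolding Q_def
  proof (intro conjI allI impI v past)
    fix s assume s: "t \<le> s" "s < T"
    \<comment> \<open>Rebuilds the noise from squeezed coordinates up to \<open>t\<close> and from
      the noise itself afterwards, so an adapted control satisfies the invariant with all
      coordinates present.\<close>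
    define \<theta> where "\<theta> p = (\<lambda>i\<in>{..s}. if i \<le> t then (\<Sum>b\<in>Basis. uh (snd (fst p) (i, b)) *\<^sub>R b) else snd p i)"
      for p :: "('e \<times> (nat \<times> 'e \<Rightarrow> real)) \<times> (nat \<Rightarrow> 'e)"
    have \<theta>: "\<theta> \<in> (borel \<Otimes>\<^sub>M PiM ({..t} \<times> Basis) (\<lambda>_. borel)) \<Otimes>\<^sub>M PiM {Suc t..s} (\<lambda>_. borel) \<rightarrow>\<^sub>M PiM {..s} (\<lambda>_. borel)"
      unfolding \<theta>_def
    proof (rule measurable_restrict)
      fix i assume i: "i \<in> {..s}"
      show "(\<lambda>p. if i \<le> t then (\<Sum>b\<in>Basis. uh (snd (fst p) (i, b)) *\<^sub>R b) else snd p i)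
        \<in> borel_measurable ((borel \<Otimes>\<^sub>M PiM ({..t} \<times> Basis) (\<lambda>_. borel)) \<Otimes>\<^sub>M PiM {Suc t..s} (\<lambda>_. borel))"
      proof (cases "i \<le> t")
        case True
        have "(\<lambda>p. snd (fst p) (i, b)) \<in> borel_measurable ((borel \<Otimes>\<^sub>M PiM ({..t} \<times> Basis) (\<lambda>_. borel)) \<Otimes>\<^sub>M PiM {Suc t..s} (\<lambda>_. borel))"
          if "b \<in> Basis" for b :: 'e
          using True that
          by (intro measurable_compose[OF measurable_compose[OF measurable_fst measurable_snd] measurable_component_singleton]) auto
        then show ?thesis
          using True by (auto intro!: borel_measurable_sum borel_measurable_scaleR measurable_compose[OF _ uh_meas])
      next
        case False
        then have "i \<in> {Suc t..s}" using i by auto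
        from measurable_compose[OF measurable_snd measurable_component_singleton[OF this]] show ?thesis
          using False by simp
      qed
    qed
    have "v s \<in> borel_measurable (vimage_algebra (space M) (\<lambda>\<omega>. \<lambda>i\<in>{..s}. w i \<omega>) (PiM {..s} (\<lambda>_. borel)))"
      using v s by (simp add: optimal_def admissible_def noise_algebra_def)
    then show "v s \<in> borel_measurable (A ({..t} \<times> Basis) v s)"
      unfolding A_def
    proof (rule measurable_vimage_algebra_factor[OF _ noise_in_space \<theta>])
      show "(\<lambda>i\<in>{..s}. w i \<omega>) = \<theta> ((state v t \<omega>, \<lambda>j\<in>{..t} \<times> Basis. h j \<omega>), \<lambda>i\<in>{Suc t..s}. w i \<omega>)" for \<omega>
        by (auto simp: \<theta>_def uh_h euclidean_representation fun_eq_iff)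
    qed (auto simp: space_pair_measure space_PiM)
  qed
  have elim: "\<exists>v. Q J v" if v: "Q (insert j J) v" and j: "j \<notin> J" "insert j J \<subseteq> {..t} \<times> Basis" for j J v
  proof -
    let ?N = "borel \<Otimes>\<^sub>M PiM J (\<lambda>_. borel) :: ('e \<times> (nat \<times> 'e \<Rightarrow> real)) measure"
    have opt: "optimal v" using v by (simp add: Q_def)
    have "\<exists>v'. optimal v' \<and> (\<forall>s<t. v' s = v s) \<and> (\<forall>s. t \<le> s \<longrightarrow> s < T \<longrightarrow> v' s \<in> borel_measurable
      (vimage_algebra (space M) (\<lambda>\<omega>. ((state v t \<omega>, \<lambda>j\<in>J. h j \<omega>), \<lambda>i\<in>{Suc t..s}. w i \<omega>)) (?N \<Otimes>\<^sub>M PiM {Suc t..s} (\<lambda>_. borel))))"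
    proof (rule eliminate_scalar[where z="\<lambda>\<omega>. (state v t \<omega>, \<lambda>j\<in>J. h j \<omega>)" and r="h j" and \<xi>=fst, OF opt t])
      show "(\<lambda>\<omega>. (state v t \<omega>, \<lambda>j\<in>J. h j \<omega>)) \<in> F t \<rightarrow>\<^sub>M ?N"
        using j by (intro measurable_Pair stF opt measurable_restrict h_F) auto
      show "h j \<in> borel_measurable (F t)" using j by (intro h_F) auto
      show "h j \<omega> \<in> {0..1}" for \<omega> by (rule h01)
      fix s assume s: "t \<le> s" "s < T"
      have vA: "v s \<in> borel_measurable (A (insert j J) v s)" using v s by (simp add: Q_def)
      \<comment> \<open>Puts the coordinate \<open>j\<close>, split off as the scalar to be
        eliminated, back into the tuple.\<close>
      define \<theta> where "\<theta> p = ((fst (fst (fst p)), (snd (fst (fst p)))(j := snd (fst p))), snd p)"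
        for p :: "(('e \<times> (nat \<times> 'e \<Rightarrow> real)) \<times> real) \<times> (nat \<Rightarrow> 'e)"
      have upd: "(\<lambda>p. (snd (fst (fst p)))(j := snd (fst p))) \<in> (?N \<Otimes>\<^sub>M borel) \<Otimes>\<^sub>M PiM {Suc t..s} (\<lambda>_. borel) \<rightarrow>\<^sub>M PiM (insert j J) (\<lambda>_. borel)"
      proof -
        have "(\<lambda>p. (snd (fst (fst p)), snd (fst p))) \<in> (?N \<Otimes>\<^sub>M borel) \<Otimes>\<^sub>M PiM {Suc t..s} (\<lambda>_. borel) \<rightarrow>\<^sub>M PiM J (\<lambda>_. borel) \<Otimes>\<^sub>M borel"
          by measurable
        from measurable_compose[OF this measurable_add_dim[of j J "\<lambda>_. borel"]] show ?thesis by simp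
      qed
      have \<theta>: "\<theta> \<in> (?N \<Otimes>\<^sub>M borel) \<Otimes>\<^sub>M PiM {Suc t..s} (\<lambda>_. borel) \<rightarrow>\<^sub>M
          (borel \<Otimes>\<^sub>M PiM (insert j J) (\<lambda>_. borel)) \<Otimes>\<^sub>M PiM {Suc t..s} (\<lambda>_. borel)"
        unfolding \<theta>_def by (intro measurable_Pair upd) measurable
      show "v s \<in> borel_measurable (vimage_algebra (space M)
        (\<lambda>\<omega>. (((state v t \<omega>, \<lambda>j\<in>J. h j \<omega>), h j \<omega>), \<lambda>i\<in>{Suc t..s}. w i \<omega>)) ((?N \<Otimes>\<^sub>M borel) \<Otimes>\<^sub>M PiM {Suc t..s} (\<lambda>_. borel)))"
        using vA unfolding A_def
      proof (rule measurable_vimage_algebra_factor[OF _ _ \<theta>])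
        show "((state v t \<omega>, \<lambda>j\<in>insert j J. h j \<omega>), \<lambda>i\<in>{Suc t..s}. w i \<omega>) =
          \<theta> (((state v t \<omega>, \<lambda>j\<in>J. h j \<omega>), h j \<omega>), \<lambda>i\<in>{Suc t..s}. w i \<omega>)" for \<omega>
          using j by (auto simp: \<theta>_def fun_eq_iff)
      qed (auto simp: space_pair_measure space_PiM)
    qed simp_all
    then obtain v' where v': "optimal v'" "\<forall>s<t. v' s = v s"
      "\<forall>s. t \<le> s \<longrightarrow> s < T \<longrightarrow> v' s \<in> borel_measurable (A J v s)"
      unfolding A_def by blast
    have st: "state v' s \<omega> = state v s \<omega>" if "s \<le> t" for s \<omega>
      using v'(2) that by (intro traj_cong) simp
    \<comment> \<open>\<open>A\<close> refers to the control through the state at \<open>t\<close>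
      only, and that state is fixed by the unchanged earlier controls.\<close>
    have "A J v' s = A J v s" for s by (simp add: A_def st[OF order_refl])
    then have "Q J v'" using v v' st by (simp add: Q_def)
    then show ?thesis by (rule exI[of "Q J" v'])
  qed
  have "finite J \<Longrightarrow> J \<subseteq> {..t} \<times> Basis \<Longrightarrow> Q J v \<Longrightarrow> \<exists>v. Q {} v" for J v
  proof (induction J arbitrary: v rule: finite_induct)
    case (insert j J)
    then obtain v' where "Q J v'" using elim[of j J v] by blast
    then show ?case using insert by blast
  qed blast
  from this[OF _ _ start] obtain v' where v': "Q {} v'" by auto
  \<comment> \<open>At \<open>s = t\<close> the range of later noise is empty, like the set of
    coordinates, so only the state is left; the constants \<open>undefined\<close> below are the
    unique elements of empty products.\<close>
  have "v' t \<in> borel_measurable (A {} v' t)" using v' t by (simp add: Q_def)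
  then have "v' t \<in> borel_measurable (vimage_algebra (space M) (state v' t) borel)"
    unfolding A_def
  proof (rule measurable_vimage_algebra_factor)
    show "(\<lambda>a. ((a, \<lambda>_. undefined), \<lambda>_. undefined)) \<in> borel \<rightarrow>\<^sub>M (borel \<Otimes>\<^sub>M PiM {} (\<lambda>_. borel)) \<Otimes>\<^sub>M PiM {Suc t..t} (\<lambda>_. borel)"
      by (intro measurable_Pair measurable_const) (auto simp: space_PiM)
    show "((state v' t \<omega>, \<lambda>j\<in>{}. h j \<omega>), \<lambda>i\<in>{Suc t..t}. w i \<omega>) = ((state v' t \<omega>, \<lambda>_. undefined), \<lambda>_. undefined)" for \<omega>
      by (auto simp: restrict_def)
  qed (auto simp: space_pair_measure space_PiM)
  from measurable_sets[OF this] have "rv_preceq M (v' t) (state v' t)"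
    by (auto simp: rv_preceq_def sigma_rv_def sets_vimage_algebra2)
  then have "\<forall>s<Suc t. rv_preceq M (v' s) (state v' s)" using v' by (auto simp: Q_def less_Suc_eq)
  then show ?thesis using v' by (auto simp: Q_def)
qed

lemma markov_solution:
  assumes "optimal v"
  shows "\<exists>v'. optimal v' \<and> (\<forall>s<T. rv_preceq M (v' s) (state v' s))"
proof -
  have "t \<le> T \<Longrightarrow> \<exists>v'. optimal v' \<and> (\<forall>s<t. rv_preceq M (v' s) (state v' s))" for t
  proof (induction t)
    case (Suc t)
    then obtain v' where v': "optimal v'" "\<forall>s<t. rv_preceq M (v' s) (state v' s)" by auto
    show ?case by (rule markov_step[OF v'(1)]) (use Suc v' in auto)
  qed (use assms in auto)
  then show ?thesis by blast
qed

section \<open>Solutions of the stochastic problem\<close>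

lemma state_equation_AE:
  assumes "state_equation M T f w u x" "t \<le> T"
  shows "AE \<omega> in M. x t \<omega> = state u t \<omega>"
  using assms(2)
proof (induction t)
  case 0
  then show ?case using assms(1) by (simp add: state_equation_def)
next
  case (Suc t)
  then have "AE \<omega> in M. x t \<omega> = state u t \<omega>" by simp
  moreover have "AE \<omega> in M. x (Suc t) \<omega> = f t (x t \<omega>) (u t \<omega>) (w (Suc t) \<omega>)"
    using assms(1) Suc by (simp add: state_equation_def)
  ultimately show ?case by eventually_elim simp
qed

lemma expected_cost_eq:
  assumes u: "u \<in> controls M T U" and x: "x \<in> states M T X" "state_equation M T f w u x"
  shows "expected_cost M T L K w u x = cost u"
  unfolding expected_cost_def cost_def
proof (rule integral_cong_AE)
  have xm: "x t \<in> borel_measurable M" "\<omega> \<in> space M \<Longrightarrow> x t \<omega> \<in> X t" if "t \<le> T" for t \<omega>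
    using x(1) that by (auto simp: states_def RV_def)
  show "(\<lambda>\<omega>. (\<Sum>t<T. L t (x t \<omega>) (u t \<omega>) (w (Suc t) \<omega>)) + K (x T \<omega>)) \<in> borel_measurable M"
    using xm u by (intro borel_measurable_add borel_measurable_sum measurable_L measurable_K)
      (auto simp: controls_in controls_measurable w_in)
  show "(\<lambda>\<omega>. total_cost T f L K (\<lambda>s. u s \<omega>) (\<lambda>s. w s \<omega>)) \<in> borel_measurable M"
    by (rule borel_measurable_integrable[OF integrable_total_cost[OF u]])
  have "AE \<omega> in M. \<forall>t\<in>{..T}. x t \<omega> = state u t \<omega>"
    by (intro AE_finite_allI) (auto intro: state_equation_AE[OF x(2)])
  then show "AE \<omega> in M. (\<Sum>t<T. L t (x t \<omega>) (u t \<omega>) (w (Suc t) \<omega>)) + K (x T \<omega>) =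
      total_cost T f L K (\<lambda>s. u s \<omega>) (\<lambda>s. w s \<omega>)"
    by eventually_elim (simp add: total_cost_def)
qed

lemma state_states:
  assumes "u \<in> controls M T U" shows "state u \<in> states M T X" "state_equation M T f w u (state u)"
  using assms state_M state_in by (auto simp: states_def RV_def state_equation_def)

text \<open>Here the Markovian hypothesis enters: the observation algebras have the same sets as the
  noise filtration, and the random constraint sets are constant up to null sets.\<close>

lemma feasible_iff:
  assumes "\<And>t. t < T \<Longrightarrow> sets (G t) = sets (F t)" "\<And>t. t < T \<Longrightarrow> AE \<omega> in M. \<Gamma> t \<omega> = \<Gamma>0 t"
  shows "feasible M T X U f w G \<Gamma> u x \<longleftrightarrow> admissible u \<and> x \<in> states M T X \<and> state_equation M T f w u x"
proof -
  have "u t \<in> U_as M (U t) (\<Gamma> t) \<inter> U_me M (U t) (G t) \<longleftrightarrow>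
      u t \<in> L2 M (U t) \<and> u t \<in> borel_measurable (F t) \<and> (AE \<omega> in M. u t \<omega> \<in> \<Gamma>0 t)" if "t < T" for t
    using U_as_cong[OF assms(2)[OF that], of "U t"] measurable_cong_sets[OF assms(1)[OF that] refl, of borel]
    by (auto simp: U_as_def U_me_def)
  then show ?thesis
    unfolding feasible_def admissible_def controls_def by auto
qed

lemma is_solution_iff:
  assumes G: "\<And>t. t < T \<Longrightarrow> sets (G t) = sets (F t)" and \<Gamma>: "\<And>t. t < T \<Longrightarrow> AE \<omega> in M. \<Gamma> t \<omega> = \<Gamma>0 t"
  shows "is_solution M T X U f L K w G \<Gamma> u x \<longleftrightarrow> optimal u \<and> x \<in> states M T X \<and> state_equation M T f w u x"
proof -
  note feas = feasible_iff[of G \<Gamma>, OF G \<Gamma>]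
  have cost: "expected_cost M T L K w u x = cost u" if "feasible M T X U f w G \<Gamma> u x" for u x
    using that by (intro expected_cost_eq admissible_controls) (auto simp: feas)
  have ex: "feasible M T X U f w G \<Gamma> u (state u)" if "admissible u" for u
    using that state_states[OF admissible_controls[OF that]] by (auto simp: feas)
  show ?thesis
  proof
    assume sol: "is_solution M T X U f L K w G \<Gamma> u x"
    then have fu: "feasible M T X U f w G \<Gamma> u x" by (simp add: is_solution_def)
    have "cost u \<le> cost v" if "admissible v" for v
      using sol ex[OF that] cost[OF fu] cost[OF ex[OF that]] unfolding is_solution_def by metis
    then show "optimal u \<and> x \<in> states M T X \<and> state_equation M T f w u x"
      using fu by (auto simp: feas optimal_def)
  next
    assume opt: "optimal u \<and> x \<in> states M T X \<and> state_equation M T f w u x"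
    then have fu: "feasible M T X U f w G \<Gamma> u x" by (auto simp: feas optimal_def)
    have "expected_cost M T L K w u x \<le> expected_cost M T L K w u' x'" if "feasible M T X U f w G \<Gamma> u' x'" for u' x'
      using opt that cost[OF fu] cost[OF that] by (auto simp: feas optimal_def)
    then show "is_solution M T X U f L K w G \<Gamma> u x" using fu by (auto simp: is_solution_def)
  qed
qed

lemma optimality_system_exists:
  assumes G: "\<And>t. t < T \<Longrightarrow> sets (G t) = sets (F t)" and \<Gamma>: "\<And>t. t < T \<Longrightarrow> AE \<omega> in M. \<Gamma> t \<omega> = \<Gamma>0 t"
    and u: "optimal u" and x: "x \<in> states M T X" "state_equation M T f w u x"
  shows "\<exists>\<Lambda>. optimality_system M T X U f L K w G \<Gamma> u x \<Lambda> \<and>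
    ((\<forall>t<T. rv_preceq M (u t) (x t)) \<longrightarrow> (\<forall>t<T. rv_preceq M (\<Lambda> (Suc t)) (x (Suc t)) \<and>
      (AE \<omega> in M. cond_exp_vec M (F t) (u_gradient U f L w u x \<Lambda> t) \<omega> =
        cond_exp_vec M (sigma_rv M (x t)) (u_gradient U f L w u x \<Lambda> t) \<omega>)))"
proof -
  have ce: "cond_exp_vec M (G t) = cond_exp_vec M (F t)" if "t < T" for t
    by (rule cond_exp_vec_sets_cong[OF G[OF that]])
  have as: "U_as M (U t) (\<Gamma> t) = U_as M (U t) (\<lambda>_. \<Gamma>0 t)" if "t < T" for t
    by (rule U_as_cong[OF \<Gamma>[OF that]])
  have xr: "x s \<in> RV M (X s)" if "s \<le> T" for s using x(1) that by (simp add: states_def)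
  have xe: "AE \<omega> in M. x s \<omega> = state u s \<omega>" if "s \<le> T" for s by (rule state_equation_AE[OF x(2) that])
  let ?markov = "\<lambda>\<Lambda>. (\<forall>t<T. rv_preceq M (u t) (x t)) \<longrightarrow> (\<forall>t<T. rv_preceq M (\<Lambda> (Suc t)) (x (Suc t)) \<and>
      (AE \<omega> in M. cond_exp_vec M (F t) (u_gradient U f L w u x \<Lambda> t) \<omega> =
        cond_exp_vec M (sigma_rv M (x t)) (u_gradient U f L w u x \<Lambda> t) \<omega>))"
  have "\<exists>\<Lambda>. (\<forall>t\<le>T. \<Lambda> t \<in> RV M (X t)) \<and> (AE \<omega> in M. \<Lambda> T \<omega> = grad_on (X T) K (x T \<omega>)) \<and>
    (\<forall>t<T. (AE \<omega> in M. \<Lambda> t \<omega> = cond_exp_vec M (F t) (x_gradient X f L w u x \<Lambda> t) \<omega>) \<and>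
      (\<exists>r\<in>subdiff_indicator M (U t) (U_as M (U t) (\<lambda>_. \<Gamma>0 t)) (u t).
        AE \<omega> in M. cond_exp_vec M (F t) (u_gradient U f L w u x \<Lambda> t) \<omega> = - r \<omega>)) \<and> ?markov \<Lambda>"
    by (rule optimality_conditions[OF u xr xe])
  then obtain \<Lambda> where \<Lambda>: "\<forall>t\<le>T. \<Lambda> t \<in> RV M (X t)" "AE \<omega> in M. \<Lambda> T \<omega> = grad_on (X T) K (x T \<omega>)"
    "\<forall>t<T. (AE \<omega> in M. \<Lambda> t \<omega> = cond_exp_vec M (F t) (x_gradient X f L w u x \<Lambda> t) \<omega>) \<and>
      (\<exists>r\<in>subdiff_indicator M (U t) (U_as M (U t) (\<lambda>_. \<Gamma>0 t)) (u t).
        AE \<omega> in M. cond_exp_vec M (F t) (u_gradient U f L w u x \<Lambda> t) \<omega> = - r \<omega>)"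
    and markov: "?markov \<Lambda>"
    by (elim exE conjE)
  have "optimality_system M T X U f L K w G \<Gamma> u x \<Lambda>"
    unfolding optimality_system_def
  proof (intro conjI allI impI)
    show "\<Lambda> \<in> states M T X" using \<Lambda>(1) by (simp add: states_def)
    fix t assume t: "t < T"
    show "AE \<omega> in M. \<Lambda> t \<omega> = cond_exp_vec M (F t) (x_gradient X f L w u x \<Lambda> t) \<omega>" using \<Lambda>(3) t by blast
    show "\<exists>r\<in>subdiff_indicator M (U t) (U_as M (U t) (\<Gamma> t)) (u t).
        AE \<omega> in M. cond_exp_vec M (G t) (u_gradient U f L w u x \<Lambda> t) \<omega> = - r \<omega>"
      unfolding ce[OF t] as[OF t] using \<Lambda>(3) t by blast
  qed (fact x(2) \<Lambda>(2))+
  then show ?thesis using markov by (intro exI[of _ \<Lambda>] conjI)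
qed

end

theorem theorem2p6:
  fixes M :: "'a measure" and T :: nat
    and X W :: "nat \<Rightarrow> 'e::euclidean_space set"
    and U :: "nat \<Rightarrow> 'u::euclidean_space set"
    and Y :: "nat \<Rightarrow> 'y::euclidean_space set"
    and w :: "nat \<Rightarrow> 'a \<Rightarrow> 'e" and y :: "nat \<Rightarrow> 'a \<Rightarrow> 'y"
    and htil :: "nat \<Rightarrow> (nat \<Rightarrow> 'e) \<Rightarrow> 'y"
    and f :: "nat \<Rightarrow> 'e \<Rightarrow> 'u \<Rightarrow> 'e \<Rightarrow> 'e"
    and L :: "nat \<Rightarrow> 'e \<Rightarrow> 'u \<Rightarrow> 'e \<Rightarrow> real" and K :: "'e \<Rightarrow> real"
    and \<Gamma> :: "nat \<Rightarrow> 'a \<Rightarrow> 'u set" and \<Gamma>0 :: "nat \<Rightarrow> 'u set"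
    and F G :: "nat \<Rightarrow> 'a measure"
    and u :: "nat \<Rightarrow> 'a \<Rightarrow> 'u" and x :: "nat \<Rightarrow> 'a \<Rightarrow> 'e"
  defines "F \<equiv> noise_algebra M w" and "G \<equiv> (\<lambda>t. sigma_rv M (y t))"
  \<comment> \<open>standing assumptions\<close>
  assumes "prob_space M" and "T \<ge> 1"
    and "\<And>t. t \<le> T \<Longrightarrow> subspace (X t)" and "\<And>t. t \<le> T \<Longrightarrow> subspace (W t)"
    and "\<And>t. t \<le> T \<Longrightarrow> subspace (Y t)" and "\<And>t. t < T \<Longrightarrow> subspace (U t)"
    and "W 0 = X 0"
    and "\<And>t. t \<le> T \<Longrightarrow> w t \<in> RV M (W t)"
    and "\<And>t a v b. t < T \<Longrightarrow> a \<in> X t \<Longrightarrow> v \<in> U t \<Longrightarrow> b \<in> W (Suc t) \<Longrightarrow> f t a v b \<in> X (Suc t)"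
    and "\<And>t. t \<le> T \<Longrightarrow> y t \<in> RV M (Y t)"
    and "\<And>t. t \<le> T \<Longrightarrow> htil t \<in> measurable (PiM {..T} (\<lambda>s. restrict_space borel (W s)))
                                            (restrict_space borel (Y t))"
    and "\<And>t. t \<le> T \<Longrightarrow> AE \<omega> in M. y t \<omega> = htil t (\<lambda>s\<in>{..T}. w s \<omega>)"
    and "\<And>t \<omega>. t < T \<Longrightarrow> \<omega> \<in> space M \<Longrightarrow> \<Gamma> t \<omega> \<subseteq> U t"
  \<comment> \<open>(1)\<close>
    and "\<And>t \<omega>. t < T \<Longrightarrow> \<omega> \<in> space M \<Longrightarrow> closed (\<Gamma> t \<omega>) \<and> convex (\<Gamma> t \<omega>)"
  \<comment> \<open>(2)\<close>
    and "\<And>t b. t < T \<Longrightarrow> b \<in> W (Suc t) \<Longrightarrow> C1_on (X t \<times> U t) (\<lambda>(a, v). f t a v b)"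
    and "\<And>t b. t < T \<Longrightarrow> b \<in> W (Suc t) \<Longrightarrow> C1_on (X t \<times> U t) (\<lambda>(a, v). L t a v b)"
    and "C1_on (X T) K"
    and "\<And>t. t < T \<Longrightarrow> normal_integrand (restrict_space borel (W (Suc t))) (X t \<times> U t)
                          (\<lambda>b (a, v). ereal (L t a v b))"
    and "\<And>t i. t < T \<Longrightarrow> i \<in> Basis \<Longrightarrow>
           normal_integrand (restrict_space borel (W (Suc t))) (X t \<times> U t)
             (\<lambda>b (a, v). ereal (f t a v b \<bullet> i))"
    and "derivatives_square_integrable M T X U f L K w"
  \<comment> \<open>(3)\<close>
    and "\<And>t. t \<le> T \<Longrightarrow> sets (G t) = sets (F t)"
    and "prob_space.indep_vars M (\<lambda>_. borel) w {..T}"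
    and "\<And>t. t < T \<Longrightarrow> \<Gamma>0 t \<subseteq> U t" and "\<And>t. t < T \<Longrightarrow> AE \<omega> in M. \<Gamma> t \<omega> = \<Gamma>0 t"
  \<comment> \<open>existence of a solution\<close>
    and "is_solution M T X U f L K w G \<Gamma> u x"
  shows
    "(\<exists>\<Lambda>. optimality_system M T X U f L K w G \<Gamma> u x \<Lambda> \<and>
        ((\<forall>t<T. rv_preceq M (u t) (x t)) \<longrightarrow>
         (\<forall>t<T. rv_preceq M (\<Lambda> (Suc t)) (x (Suc t)) \<and>
            (AE \<omega> in M. cond_exp_vec M (F t) (u_gradient U f L w u x \<Lambda> t) \<omega> =
                        cond_exp_vec M (sigma_rv M (x t)) (u_gradient U f L w u x \<Lambda> t) \<omega>)))) \<and>
     (\<exists>u' x' \<Lambda>. is_solution M T X U f L K w G \<Gamma> u' x' \<and>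
        optimality_system M T X U f L K w G \<Gamma> u' x' \<Lambda> \<and>
        (\<forall>t<T. rv_preceq M (\<Lambda> (Suc t)) (x' (Suc t)) \<and>
               rv_preceq M (u' t) (x' t) \<and>
               (AE \<omega> in M. cond_exp_vec M (F t) (u_gradient U f L w u' x' \<Lambda> t) \<omega> =
                           cond_exp_vec M (sigma_rv M (x' t)) (u_gradient U f L w u' x' \<Lambda> t) \<omega>)))"
proof -
  interpret prob_space M by (rule assms(3))
  \<comment> \<open>An almost sure equality on a probability space holds at one point at least, and
    closedness and convexity are inherited from the value of \<open>\<Gamma> t\<close>
    there.\<close>
  have \<Gamma>0: "closed (\<Gamma>0 t)" "convex (\<Gamma>0 t)" if t: "t < T" for t
  proof -
    have "\<exists>\<omega>\<in>space M. \<Gamma> t \<omega> = \<Gamma>0 t"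
    proof (rule ccontr)
      assume "\<not> (\<exists>\<omega>\<in>space M. \<Gamma> t \<omega> = \<Gamma>0 t)"
      with assms(26)[OF t] AE_space have "AE \<omega> in M. False" by (auto elim: eventually_elim2)
      then show False by simp
    qed
    then obtain \<omega> where "\<omega> \<in> space M" "\<Gamma> t \<omega> = \<Gamma>0 t" by blast
    then show "closed (\<Gamma>0 t)" "convex (\<Gamma>0 t)" using assms(16)[OF t, of \<omega>] by simp_all
  qed
  interpret stochastic_control_problem M T X W U f L K w \<Gamma>0
    by unfold_locales (rule assms(3-) \<Gamma>0; assumption)+
  have G: "sets (G t) = sets (noise_algebra M w t)" if "t < T" for t
    using assms(23)[OF less_imp_le[OF that]] by (simp add: F_def)
  note \<Gamma>eq = assms(26)
  have sol: "is_solution M T X U f L K w G \<Gamma> u x \<longleftrightarrow> optimal u \<and> x \<in> states M T X \<and> state_equation M T f w u x" for u x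
    by (rule is_solution_iff[OF G \<Gamma>eq])
  have u: "optimal u" "x \<in> states M T X" "state_equation M T f w u x"
    using assms(27) by (simp_all only: sol)
  \<comment> \<open>This solution may differ from \<open>u\<close>. Its exact trajectory is taken as
    the state process, since the feedback property was obtained for that version.\<close>
  obtain v where v: "optimal v" "\<forall>s<T. rv_preceq M (v s) (state v s)" using markov_solution[OF u(1)] by blast
  have vc: "v \<in> controls M T U" using v(1) by (simp add: optimal_def admissible_controls)
  note st = state_states[OF vc]
  have v_sol: "is_solution M T X U f L K w G \<Gamma> v (state v)" using v(1) st by (simp only: sol)
  have "\<exists>\<Lambda>. optimality_system M T X U f L K w G \<Gamma> v (state v) \<Lambda> \<and>
    ((\<forall>t<T. rv_preceq M (v t) (state v t)) \<longrightarrow> (\<forall>t<T. rv_preceq M (\<Lambda> (Suc t)) (state v (Suc t)) \<and>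
      (AE \<omega> in M. cond_exp_vec M (F t) (u_gradient U f L w v (state v) \<Lambda> t) \<omega> =
        cond_exp_vec M (sigma_rv M (state v t)) (u_gradient U f L w v (state v) \<Lambda> t) \<omega>)))"
    unfolding F_def by (rule optimality_system_exists[OF G \<Gamma>eq v(1) st])
  then obtain \<Lambda> where \<Lambda>: "optimality_system M T X U f L K w G \<Gamma> v (state v) \<Lambda>"
    and \<Lambda>v: "(\<forall>t<T. rv_preceq M (v t) (state v t)) \<longrightarrow> (\<forall>t<T. rv_preceq M (\<Lambda> (Suc t)) (state v (Suc t)) \<and>
      (AE \<omega> in M. cond_exp_vec M (F t) (u_gradient U f L w v (state v) \<Lambda> t) \<omega> =
        cond_exp_vec M (sigma_rv M (state v t)) (u_gradient U f L w v (state v) \<Lambda> t) \<omega>))"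
    by (elim exE conjE)
  have \<Lambda>t: "\<forall>t<T. rv_preceq M (\<Lambda> (Suc t)) (state v (Suc t)) \<and> rv_preceq M (v t) (state v t) \<and>
      (AE \<omega> in M. cond_exp_vec M (F t) (u_gradient U f L w v (state v) \<Lambda> t) \<omega> =
        cond_exp_vec M (sigma_rv M (state v t)) (u_gradient U f L w v (state v) \<Lambda> t) \<omega>)"
    using mp[OF \<Lambda>v v(2)] v(2) by simp
  show ?thesis
  proof (rule conjI)
    show "\<exists>\<Lambda>. optimality_system M T X U f L K w G \<Gamma> u x \<Lambda> \<and>
      ((\<forall>t<T. rv_preceq M (u t) (x t)) \<longrightarrow> (\<forall>t<T. rv_preceq M (\<Lambda> (Suc t)) (x (Suc t)) \<and>
        (AE \<omega> in M. cond_exp_vec M (F t) (u_gradient U f L w u x \<Lambda> t) \<omega> =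
          cond_exp_vec M (sigma_rv M (x t)) (u_gradient U f L w u x \<Lambda> t) \<omega>)))"
      unfolding F_def by (rule optimality_system_exists[OF G \<Gamma>eq u])
  qed (intro exI conjI, rule v_sol, rule \<Lambda>, rule \<Lambda>t)
qed

end
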